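(* Let $\mathbb T$ be a time scale and let $\mathcal A:\mathbb T\to\mathbf M_n(\mathbb R)$ be a bounded, rd-continuous and uniformly regressive matrix function. Let $\chi(\mathcal A)$ be the central upper exponent of the system $x^\Delta=\mathcal A(t)x$. (i) If $\chi(\mathcal A)>0$, then there exists a continuous map $f:\mathbb T_0^+\times B_1\to\mathbb R^n$ such that $f\in\mathcal F$ (with $r=1$) and the solution $x(t)\equiv0$ of the system $x^\Delta=\mathcal A(t)x+f(t,x)$ is unstable. (ii) If the time scale $\mathbb T$ is syndetic, the same conclusion holds provided $\chi(\mathcal A)\ge0$.
   Context: A time scale $\mathbb T$ is an unbounded closed subset of $\mathbb R$ with $0\in\mathbb T$; $\mathbb T_a^+=[a,\infty)\cap\mathbb T$. Forward jump: $\sigma(t)=\inf\{s\in\mathbb T: s>t\}$; graininess: $\mu(t)=\sigma(t)-t$. $\mathbb S=\{t\in\mathbb T:\sigma(t)>t\}$ is the set of right-scattered points; points with $\sigma(t)=t$ are right-dense. It is always assumed that $\sup\mathbb S=+\infty$. $\mathbb T$ is syndetic if $\limsup_{\mathbb T\ni t\to+\infty}\mu(t)<+\infty$. $B_r$ is the Euclidean ball of radius $r$ centred at $0$ in $\mathbb R^n$, $|\cdot|$ is a vector norm and the corresponding operator norm, $E_n$ is the identity matrix. A function $f:\mathbb T_0^+\times B_r\to\mathbb R^n$ belongs to the class $\mathcal F$ if: $f(t,0)=0$ for all $t\in\mathbb T_0^+$; $\frac{\partial f}{\partial x}(t,0)=0$ for all $t\in\mathbb T_0^+$; and the Jacobi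 matrix $\frac{\partial f}{\partial x}(t,x)$ is uniformly continuous on $\mathbb T_0^+\times B_r$. A function on $\mathbb T$ is rd-continuous if it is continuous at right-dense points and has finite left-sided limits at left-dense points. $f^\Delta(t)=\gamma$ means: for every $\epsilon>0$ there is a neighbourhood $W$ of $t$ with $|f(\sigma(t))-f(s)-\gamma(\sigma(t)-s)|\le\epsilon|\sigma(t)-s|$ for all $s\in W\cap\mathbb T$. If $F^\Delta=f$, then $\int_\tau^s f(t)\,\Delta t=F(s)-F(\tau)$. A matrix function $\mathcal A$ is regressive if $E_n+\mu(t)\mathcal A(t)$ is invertible for all $t\in\mathbb T$, and uniformly regressive if in addition $(E_n+\mu(t)\mathcal A(t))^{-1}$ is bounded on $\mathbb T$. $\Phi_{\mathcal A}(t,s)$, $t\ge s$, is the fundamental matrix: $\Phi_{\mathcal A}^\Delta(t,s)=\mathcal A(t)\Phi_{\mathcal A}(t,s)$ (derivative in $t$), $\Phi_{\mathcal A}(s,s)=E_n$. Generalized exponential: $e_u(t,s)=\exp\left(\int_s^t\xi_{\mu(\tau)}(u(\tau))\,\Delta\tau\right)$, where $\xi_h(z)=\log(1+zh)/h$ for $h\ne0$ and $\xi_0(z)=z$. An upper function for $x^\Delta=\mathcal A(t)x$ is an rd-continuous function $u:\mathbb T_0^+\to\mathbb R$ (with $1+\mu(t)u(t)>0$) for which there is $C>0$ such that $|\Phi_{\mathcal A}(t,s)|\le C e_u(t,s)$ for all $t,s\in\mathbb T_0^+$, $t\ge s$. The central upper exponent is $$\chi(\mathcal A)=\inf_{u}\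 \limsup_{t\to\infty}\frac1t\int_0^t \xi_{\mu(\tau)}(u(\tau))\,\Delta\tau=\inf_u\ \limsup_{t\to\infty}\frac1t\log e_u(t,0),$$ the infimum being over all upper functions $u$. The zero solution is stable if for every $t_0\in\mathbb T_0^+$ and $\epsilon>0$ there is $\delta>0$ such that $|x_0|<\delta$ implies that the solution with $x(t_0)=x_0$ exists and satisfies $|x(t)|<\epsilon$ for all $t\in\mathbb T_{t_0}^+$; it is unstable if it is not stable. *)

theory Defs
  imports "HOL-Analysis.Analysis"
begin

text \<open>
  A time scale is represented by its carrier \<open>T :: real set\<close>; functions on \<open>T\<close> are total
  functions on the reals of which only the values on \<open>T\<close> matter.
\<close>

definition time_scale :: "real set \<Rightarrow> bool" where
  "time_scale T \<longleftrightarrow> closed T \<and> \<not> bounded T \<and> 0 \<in> T"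

definition ts_from :: "real set \<Rightarrow> real \<Rightarrow> real set" where
  "ts_from T a = T \<inter> {a..}"

definition fwd_jump :: "real set \<Rightarrow> real \<Rightarrow> real" where
  "fwd_jump T t = Inf {s \<in> T. s > t}"

definition graininess :: "real set \<Rightarrow> real \<Rightarrow> real" where
  "graininess T t = fwd_jump T t - t"

definition right_scattered :: "real set \<Rightarrow> real set" where
  "right_scattered T = {t \<in> T. fwd_jump T t > t}"

definition ts_at_top :: "real set \<Rightarrow> real filter" where
  "ts_at_top T = inf at_top (principal T)"

definition syndetic :: "real set \<Rightarrow> bool" where
  "syndetic T \<longleftrightarrow> Limsup (ts_at_top T) (\<lambda>t. ereal (graininess T t)) < \<infinity>"

text \<open>
  At a point \<open>t\<close> that is not left-dense the filter \<open>at t within (T \<inter> {..<t})\<close> is trivial, so the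
  second conjunct only constrains left-dense points.
\<close>

definition rd_continuous :: "real set \<Rightarrow> (real \<Rightarrow> 'a::topological_space) \<Rightarrow> bool" where
  "rd_continuous T g \<longleftrightarrow>
     (\<forall>t\<in>T. (fwd_jump T t = t \<longrightarrow> (g \<longlongrightarrow> g t) (at t within T)) \<and>
            (\<exists>l. (g \<longlongrightarrow> l) (at t within (T \<inter> {..<t}))))"

text \<open>
  Functions that live only on \<open>ts_from T a\<close> are differentiated relative to the time scale
  \<open>ts_from T a\<close>, whose forward jump agrees with that of \<open>T\<close>.
\<close>

definition has_delta_derivative ::
    "real set \<Rightarrow> (real \<Rightarrow> 'a::real_normed_vector) \<Rightarrow> 'a \<Rightarrow> real \<Rightarrow> bool" where
  "has_delta_derivative T f D t \<longleftrightarrow>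
     (\<forall>\<epsilon>>0. \<forall>\<^sub>F s in nhds t. s \<in> T \<longrightarrow>
        norm (f (fwd_jump T t) - f s - (fwd_jump T t - s) *\<^sub>R D) \<le> \<epsilon> * \<bar>fwd_jump T t - s\<bar>)"

definition delta_integral :: "real set \<Rightarrow> (real \<Rightarrow> real) \<Rightarrow> real \<Rightarrow> real \<Rightarrow> real" where
  "delta_integral T f a b =
     (THE I. \<exists>F. (\<forall>t\<in>T. has_delta_derivative T F (f t) t) \<and> I = F b - F a)"

definition uniformly_regressive :: "real set \<Rightarrow> (real \<Rightarrow> real^'n^'n) \<Rightarrow> bool" where
  "uniformly_regressive T A \<longleftrightarrow>
     (\<forall>t\<in>T. invertible (mat 1 + graininess T t *\<^sub>R A t)) \<and>
     bounded ((\<lambda>t. matrix_inv (mat 1 + graininess T t *\<^sub>R A t)) ` T)"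

definition fundamental_matrix ::
    "real set \<Rightarrow> (real \<Rightarrow> real^'n^'n) \<Rightarrow> real \<Rightarrow> real \<Rightarrow> real^'n^'n" where
  "fundamental_matrix T A t s =
     (THE M. \<exists>X. X s = mat 1 \<and>
        (\<forall>\<tau>\<in>ts_from T s. has_delta_derivative (ts_from T s) X (A \<tau> ** X \<tau>) \<tau>) \<and> M = X t)"

text \<open>
  The vector norm \<open>N\<close> is arbitrary. It enters the quantitative estimates below; boundedness,
  continuity and differentiability use the library norms, on which they do not depend.
\<close>

definition vector_norm :: "(real^'n \<Rightarrow> real) \<Rightarrow> bool" where
  "vector_norm N \<longleftrightarrow>
     (\<forall>x. N x \<ge> 0 \<and> (N x = 0 \<longleftrightarrow> x = 0)) \<and>
     (\<forall>c x. N (c *\<^sub>R x) = \<bar>c\<bar> * N x) \<and> (\<forall>x y. N (x + y) \<le> N x + N y)"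

definition operator_norm :: "(real^'n \<Rightarrow> real) \<Rightarrow> real^'n^'n \<Rightarrow> real" where
  "operator_norm N M = Sup {N (M *v x) | x. N x \<le> 1}"

definition cylinder :: "real \<Rightarrow> real \<Rightarrow> real" where
  "cylinder h z = (if h = 0 then z else ln (1 + z * h) / h)"

definition exponent_integral :: "real set \<Rightarrow> (real \<Rightarrow> real) \<Rightarrow> real \<Rightarrow> real \<Rightarrow> real" where
  "exponent_integral T u s t =
     delta_integral (ts_from T 0) (\<lambda>\<tau>. cylinder (graininess T \<tau>) (u \<tau>)) s t"

definition gen_exp :: "real set \<Rightarrow> (real \<Rightarrow> real) \<Rightarrow> real \<Rightarrow> real \<Rightarrow> real" where
  "gen_exp T u t s = exp (exponent_integral T u s t)"

definition upper_function ::
    "(real^'n \<Rightarrow> real) \<Rightarrow> real set \<Rightarrow> (real \<Rightarrow> real^'n^'n) \<Rightarrow> (real \<Rightarrow> real) \<Rightarrow> bool" where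
  "upper_function N T A u \<longleftrightarrow>
     rd_continuous (ts_from T 0) u \<and>
     (\<forall>t\<in>ts_from T 0. 1 + graininess T t * u t > 0) \<and>
     (\<exists>C>0. \<forall>s\<in>ts_from T 0. \<forall>t\<in>ts_from T s.
        operator_norm N (fundamental_matrix T A t s) \<le> C * gen_exp T u t s)"

definition central_upper_exponent ::
    "(real^'n \<Rightarrow> real) \<Rightarrow> real set \<Rightarrow> (real \<Rightarrow> real^'n^'n) \<Rightarrow> ereal" where
  "central_upper_exponent N T A =
     (INF u \<in> {u. upper_function N T A u}.
        Limsup (ts_at_top T) (\<lambda>t. ereal (1 / t * exponent_integral T u 0 t)))"

definition class_F :: "real set \<Rightarrow> real \<Rightarrow> (real \<Rightarrow> real^'n \<Rightarrow> real^'n) set" where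
  "class_F T r = {f.
     (\<forall>t\<in>ts_from T 0. f t 0 = 0) \<and>
     (\<forall>t\<in>ts_from T 0. \<forall>x\<in>ball 0 r. f t differentiable (at x)) \<and>
     (\<forall>t\<in>ts_from T 0. jacobian (f t) (at 0) = 0) \<and>
     uniformly_continuous_on (ts_from T 0 \<times> ball 0 r) (\<lambda>(t, x). jacobian (f t) (at x))}"

text \<open>
  \<open>f t\<close> is only meaningful on the ball of radius \<open>r\<close>, so a solution has to stay in that ball.
\<close>

definition is_solution ::
    "real set \<Rightarrow> real \<Rightarrow> (real \<Rightarrow> real^'n^'n) \<Rightarrow> (real \<Rightarrow> real^'n \<Rightarrow> real^'n) \<Rightarrow>
     real \<Rightarrow> (real \<Rightarrow> real^'n) \<Rightarrow> bool" where
  "is_solution T r A f t0 x \<longleftrightarrow>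
     (\<forall>t\<in>ts_from T t0. x t \<in> ball 0 r \<and>
        has_delta_derivative (ts_from T t0) x (A t *v x t + f t (x t)) t)"

definition zero_stable ::
    "(real^'n \<Rightarrow> real) \<Rightarrow> real set \<Rightarrow> real \<Rightarrow> (real \<Rightarrow> real^'n^'n) \<Rightarrow>
     (real \<Rightarrow> real^'n \<Rightarrow> real^'n) \<Rightarrow> bool" where
  "zero_stable N T r A f \<longleftrightarrow>
     (\<forall>t0\<in>ts_from T 0. \<forall>\<epsilon>>0. \<exists>\<delta>>0. \<forall>x0. N x0 < \<delta> \<longrightarrow>
        (\<exists>x. is_solution T r A f t0 x \<and> x t0 = x0 \<and> (\<forall>t\<in>ts_from T t0. N (x t) < \<epsilon>)))"

abbreviation zero_unstable ::
    "(real^'n \<Rightarrow> real) \<Rightarrow> real set \<Rightarrow> real \<Rightarrow> (real \<Rightarrow> real^'n^'n) \<Rightarrow>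
     (real \<Rightarrow> real^'n \<Rightarrow> real^'n) \<Rightarrow> bool" where
  "zero_unstable N T r A f \<equiv> \<not> zero_stable N T r A f"

end

theory Submission
  imports Defs
begin

text \<open>
  If every linear perturbation of size at most \<open>\<omega>\<close> left the orbits bounded by \<open>G\<close> times their initial
  value, the exponent would be small. Indeed, cut the scale into blocks of length at least \<open>H\<close>; a
  perturbation of size \<open>\<omega>\<close> can turn the orbit, within the first unit of time of a block, so far towards the
  direction of largest growth of that block that it grows by at least \<open>\<kappa>\<close> times the norm of the transition
  matrix, where \<open>\<kappa>\<close> depends on \<open>\<omega>\<close> but not on \<open>H\<close>. Hence the product of these norms is at most
  \<open>G \<kappa>\<^sup>-\<^sup>m\<close> after \<open>m\<close> blocks, and interpolating its logarithm yields an upper function with exponent at most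
  \<open>- ln \<kappa> / H\<close>, which tends to \<open>0\<close> as \<open>H\<close> grows. On a syndetic scale the perturbation can in addition
  contain a small multiple of the identity up to the jumps, which improves the bound to \<open>- ln \<kappa> / H - \<delta>\<close>.

  The turning perturbation is only rd-continuous, and it is replaced by its Steklov means, which are
  continuous and converge pointwise on the scale. The growing orbits for \<open>\<omega> = 1 / (k + 1)\<close> are placed in
  consecutive windows of time that are separated by gaps. In the \<open>k\<close>-th window the linear perturbation is
  multiplied by a function that is \<open>1\<close> along the \<open>k\<close>-th orbit and vanishes near the origin, where all later orbits
  stay during that window.
\<close>

section \<open>Induction and differential inequalities on a time scale\<close>

text \<open>The gaps of the scale shape every estimate. A gap may be longer than any constant, and
  across it a perturbation acts only through its value at the left end. Boundedness and uniform
  regressivity give one rate K such that the flow changes lengths at most by exp(K |t - s|),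
  forwards and backwards. A turn that starts within one unit of time therefore costs exp(2K), and
  \<kappa> of the order \<omega> exp(-2K) / (1 + M) works for every H. A gain of exp(\<delta> \<mu>)
  over a gap of length \<mu> must be paid by a perturbation whose contribution is at most of the
  order \<omega> \<mu>; this is why a positive \<delta> needs bounded gaps, and it is \<delta> that
  makes the exponent negative in the syndetic case. Membership in the class F rests on two facts:
  the cutoff multiplies the Jacobian by at most 9 whatever its radius, and the k-th perturbation has
  size 1 / (k + 1), so the Jacobian tends to 0 and only compact time intervals matter for its
  uniform continuity. The growth demanded in a window starting at a includes exp(K a), so that the
  orbit can be continued back to time 0 and is still small there.\<close>

locale half_scale =
  fixes S :: "real set" and a :: real
  assumes closed_S: "closed S" and start_in: "a \<in> S"
    and start_le: "\<And>s. s \<in> S \<Longrightarrow> a \<le> s" and unbounded_S: "\<not> bdd_above S"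
begin

lemma exists_above: "\<exists>s\<in>S. t < s"
  using unbounded_S by (meson bdd_above.I not_le_imp_less)

lemma fwd_jump_le: "s \<in> S \<Longrightarrow> t < s \<Longrightarrow> fwd_jump S t \<le> s"
  unfolding fwd_jump_def by (rule cInf_lower) (auto intro: bdd_belowI[where m=t])

lemma fwd_jump_ge: "t \<le> fwd_jump S t"
  unfolding fwd_jump_def using exists_above[of t] by (intro cInf_greatest) auto

lemma fwd_jump_in: "fwd_jump S t \<in> S"
proof -
  have "Inf {s \<in> S. s > t} \<in> closure {s \<in> S. s > t}"
    using exists_above[of t] by (intro closure_contains_Inf) (auto intro: bdd_belowI[where m=t])
  also have "\<dots> \<subseteq> S"
    using closed_S by (intro closure_minimal) auto
  finally show ?thesis unfolding fwd_jump_def .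
qed

lemma graininess_ge_0: "graininess S t \<ge> 0"
  using fwd_jump_ge unfolding graininess_def by simp

lemma right_dense_point:
  assumes "fwd_jump S t = t" "t < e"
  shows "\<exists>s\<in>S. t < s \<and> s < e"
proof -
  have "Inf {s \<in> S. s > t} < e" using assms unfolding fwd_jump_def by simp
  then show ?thesis
    using exists_above[of t] by (subst (asm) cInf_less_iff) (auto intro: bdd_belowI[where m=t])
qed

text \<open>The infimum \<open>m\<close> of the counterexamples lies in S because S is closed, and
  every earlier point is good. Then \<open>m\<close> is good as well: it is the start, or
  left-dense, or the jump of the last point before it. A good \<open>m\<close> cannot be
  right-scattered, since its jump would be a larger lower bound; and at a right-dense
  \<open>m\<close> the property extends beyond \<open>m\<close>, against the choice of the
  infimum.\<close>

lemma scale_induct [consumes 1, case_names start scattered right_dense left_dense]: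
  assumes "t \<in> S"
    and start: "P a"
    and scattered: "\<And>t. t \<in> S \<Longrightarrow> fwd_jump S t > t \<Longrightarrow> P t \<Longrightarrow> P (fwd_jump S t)"
    and right_dense: "\<And>t. t \<in> S \<Longrightarrow> fwd_jump S t = t \<Longrightarrow> P t \<Longrightarrow>
                 \<exists>e>t. \<forall>s\<in>S. t < s \<and> s < e \<longrightarrow> P s"
    and left_dense: "\<And>t. t \<in> S \<Longrightarrow> t > a \<Longrightarrow> (\<And>s. s \<in> S \<Longrightarrow> s < t \<Longrightarrow> P s) \<Longrightarrow>
                 (\<And>e. e < t \<Longrightarrow> \<exists>s\<in>S. e < s \<and> s < t) \<Longrightarrow> P t"
  shows "P t"
proof (rule ccontr)
  assume "\<not> P t"
  define Bad where "Bad = {s \<in> S. \<not> P s}"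
  define m where "m = Inf Bad"
  have ne: "Bad \<noteq> {}" using \<open>\<not> P t\<close> \<open>t \<in> S\<close> by (auto simp: Bad_def)
  have bb: "bdd_below Bad" by (rule bdd_belowI[where m=a]) (auto simp: Bad_def start_le)
  have "m \<in> closure Bad" unfolding m_def using ne bb by (rule closure_contains_Inf)
  moreover have "closure Bad \<subseteq> S" using closed_S by (intro closure_minimal) (auto simp: Bad_def)
  ultimately have mS: "m \<in> S" by blast
  have below: "P s" if "s \<in> S" "s < m" for s
    using cInf_lower[OF _ bb, of s] that by (fastforce simp: Bad_def m_def)
  have Pm: "P m"
  proof (cases "\<forall>e<m. \<exists>s\<in>S. e < s \<and> s < m")
    case True
    show ?thesis
    proof (cases "m = a")
      case False
      then show ?thesis using left_dense[OF mS] below True start_le[OF mS] by force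
    qed (use start in simp)
  next
    case False
    then obtain e where e: "e < m" "\<And>s. s \<in> S \<Longrightarrow> s < m \<Longrightarrow> s \<le> e" by force
    show ?thesis
    proof (cases "m = a")
      case True then show ?thesis using start by simp
    next
      case False
      then have ae: "a \<le> e" using e(2)[OF start_in] start_le[OF mS] by simp
      define r where "r = Sup (S \<inter> {..e})"
      have "r \<in> S \<inter> {..e}" unfolding r_def
        using ae start_in closed_S by (intro closed_contains_Sup) auto
      then have r: "r \<in> S" "r \<le> e" by auto
      have rub: "s \<le> r" if "s \<in> S" "s \<le> e" for s
        unfolding r_def using that by (intro cSup_upper) auto
      have "fwd_jump S r = m"
      proof (rule antisym)
        show "fwd_jump S r \<le> m" using r e mS by (intro fwd_jump_le) auto
        show "m \<le> fwd_jump S r" unfolding fwd_jump_def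
        proof (rule cInf_greatest)
          show "{s \<in> S. r < s} \<noteq> {}" using exists_above[of r] by auto
        qed (use rub e in force)
      qed
      then show ?thesis using scattered[OF r(1)] below[OF r(1)] r e by auto
    qed
  qed
  have fm: "fwd_jump S m = m"
  proof (rule ccontr)
    assume "fwd_jump S m \<noteq> m"
    then have gt: "fwd_jump S m > m" using fwd_jump_ge[of m] by simp
    have "fwd_jump S m \<le> m" unfolding m_def
    proof (rule cInf_greatest[OF ne])
      fix s assume s: "s \<in> Bad"
      then have "m \<le> s" unfolding m_def using bb by (intro cInf_lower)
      moreover have "s \<noteq> m" using s Pm by (auto simp: Bad_def)
      ultimately show "fwd_jump S (Inf Bad) \<le> s" using s fwd_jump_le[of s m] 
        by (auto simp: Bad_def m_def)
    qed
    with gt show False by simp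
  qed
  obtain e where e: "e > m" "\<And>s. s \<in> S \<Longrightarrow> m < s \<Longrightarrow> s < e \<Longrightarrow> P s"
    using right_dense[OF mS fm Pm] by blast
  have "e \<le> m" unfolding m_def
  proof (rule cInf_greatest[OF ne])
    fix s assume s: "s \<in> Bad"
    then have "m \<le> s" unfolding m_def using bb by (intro cInf_lower)
    then show "e \<le> s" using s Pm e(2)[of s] by (force simp: Bad_def)
  qed
  with e(1) show False by simp
qed

end

text \<open>Near a right-scattered t the distance from s to \<sigma> stays bounded and away from 0,
  so the defining estimate amounts to continuity at t together with exactness at s = t.\<close>

lemma delta_derivative_right_scattered_iff:
  fixes f :: "real \<Rightarrow> 'a::real_normed_vector"
  assumes "t \<in> S" "fwd_jump S t > t"
  shows "has_delta_derivative S f D t \<longleftrightarrow>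
    (f \<longlongrightarrow> f t) (at t within S) \<and> f (fwd_jump S t) = f t + graininess S t *\<^sub>R D"
proof -
  define \<sigma> where "\<sigma> = fwd_jump S t"
  have gt: "\<sigma> > t" using assms by (simp add: \<sigma>_def)
  show ?thesis
  proof (intro iffI conjI)
    assume d: "has_delta_derivative S f D t"
    have ev: "\<forall>\<^sub>F s in nhds t. s \<in> S \<longrightarrow> norm (f \<sigma> - f s - (\<sigma> - s) *\<^sub>R D) \<le> \<epsilon> * \<bar>\<sigma> - s\<bar>" if "\<epsilon> > 0" for \<epsilon>
      using d that by (auto simp: has_delta_derivative_def \<sigma>_def)
    \<comment> \<open>The filter \<open>nhds t\<close> includes t itself, so the estimate may be
      evaluated at s = t with every tolerance.\<close>
    have "norm (f \<sigma> - f t - (\<sigma> - t) *\<^sub>R D) \<le> 0 + e" if "e > 0" for e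
    proof -
      have "norm (f \<sigma> - f t - (\<sigma> - t) *\<^sub>R D) \<le> (e / (\<sigma> - t)) * \<bar>\<sigma> - t\<bar>"
        using eventually_nhds_x_imp_x[OF ev[of "e / (\<sigma> - t)"]] that gt assms by simp
      then show ?thesis using gt by simp
    qed
    then have "norm (f \<sigma> - f t - (\<sigma> - t) *\<^sub>R D) \<le> 0" by (rule field_le_epsilon)
    then have eq: "f \<sigma> = f t + (\<sigma> - t) *\<^sub>R D" by (simp add: algebra_simps)
    then show "f (fwd_jump S t) = f t + graininess S t *\<^sub>R D" by (simp add: \<sigma>_def graininess_def)
    show "(f \<longlongrightarrow> f t) (at t within S)"
    proof (rule tendstoI)
      fix e :: real assume e: "e > 0"
      define \<epsilon> where "\<epsilon> = e / (2 * (\<sigma> - t + 1))"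
      have \<epsilon>: "\<epsilon> > 0" using e gt by (simp add: \<epsilon>_def)
      have "((\<lambda>s. \<bar>s - t\<bar> * norm D) \<longlongrightarrow> \<bar>t - t\<bar> * norm D) (nhds t)"
        by (intro tendsto_intros filterlim_ident)
      then have 1: "\<forall>\<^sub>F s in nhds t. \<bar>s - t\<bar> * norm D < e / 2"
        using e by (intro order_tendstoD) auto
      have "((\<lambda>s. s) \<longlongrightarrow> t) (nhds t)" by (simp add: filterlim_ident)
      then have 2: "\<forall>\<^sub>F s in nhds t. s > t - 1 \<and> s < \<sigma>"
        using gt by (intro eventually_conj order_tendstoD(1)[of _ t] order_tendstoD(2)[of _ t]) auto
      have "\<forall>\<^sub>F s in nhds t. s \<in> S \<longrightarrow> dist (f s) (f t) < e"
        using 1 2 ev[OF \<epsilon>]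
      proof eventually_elim
        case (elim s)
        show ?case
        proof
          assume "s \<in> S"
          then have "norm (f \<sigma> - f s - (\<sigma> - s) *\<^sub>R D) \<le> \<epsilon> * (\<sigma> - s)" using elim by simp
          also have "\<dots> \<le> \<epsilon> * (\<sigma> - t + 1)" using elim \<epsilon> by (intro mult_left_mono) auto
          also have "\<dots> = e / 2" using gt by (simp add: \<epsilon>_def divide_simps)
          finally have A: "norm (f \<sigma> - f s - (\<sigma> - s) *\<^sub>R D) \<le> e / 2" .
          have "f s - f t = (s - t) *\<^sub>R D - (f \<sigma> - f s - (\<sigma> - s) *\<^sub>R D)"
            unfolding eq by (simp add: algebra_simps)
          then have "norm (f s - f t) \<le> norm ((s - t) *\<^sub>R D) + norm (f \<sigma> - f s - (\<sigma> - s) *\<^sub>R D)"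
            by (metis norm_triangle_ineq4)
          then show "dist (f s) (f t) < e" using A elim by (simp add: dist_norm)
        qed
      qed
      then show "\<forall>\<^sub>F s in at t within S. dist (f s) (f t) < e"
        unfolding eventually_at_filter by eventually_elim auto
    qed
  next
    assume A: "(f \<longlongrightarrow> f t) (at t within S) \<and> f (fwd_jump S t) = f t + graininess S t *\<^sub>R D"
    then have eq: "f \<sigma> = f t + (\<sigma> - t) *\<^sub>R D" by (simp add: \<sigma>_def graininess_def)
    show "has_delta_derivative S f D t"
      unfolding has_delta_derivative_def \<sigma>_def[symmetric]
    proof (intro allI impI)
      fix \<epsilon> :: real assume \<epsilon>: "\<epsilon> > 0"
      define e where "e = \<epsilon> * (\<sigma> - t) / 4"
      have e: "e > 0" using \<epsilon> gt by (simp add: e_def)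
      have "((\<lambda>s. \<bar>s - t\<bar> * norm D) \<longlongrightarrow> \<bar>t - t\<bar> * norm D) (nhds t)"
        by (intro tendsto_intros filterlim_ident)
      then have 1: "\<forall>\<^sub>F s in nhds t. \<bar>s - t\<bar> * norm D < e"
        using e by (intro order_tendstoD) auto
      have "((\<lambda>s. s) \<longlongrightarrow> t) (nhds t)" by (simp add: filterlim_ident)
      then have 2: "\<forall>\<^sub>F s in nhds t. s < (t + \<sigma>) / 2"
        using gt by (intro order_tendstoD(2)[of _ t]) auto
      have "\<forall>\<^sub>F s in at t within S. dist (f s) (f t) < e"
        using A e by (auto intro: tendstoD)
      then have 3: "\<forall>\<^sub>F s in nhds t. s \<noteq> t \<longrightarrow> s \<in> S \<longrightarrow> dist (f s) (f t) < e"
        by (simp add: eventually_at_filter)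
      show "\<forall>\<^sub>F s in nhds t. s \<in> S \<longrightarrow> norm (f \<sigma> - f s - (\<sigma> - s) *\<^sub>R D) \<le> \<epsilon> * \<bar>\<sigma> - s\<bar>"
        using 1 2 3
      proof eventually_elim
        case (elim s)
        show ?case
        proof
          assume s: "s \<in> S"
          have "dist (f s) (f t) < e" using elim s e by (cases "s = t") auto
          moreover have "f \<sigma> - f s - (\<sigma> - s) *\<^sub>R D = (s - t) *\<^sub>R D - (f s - f t)"
            unfolding eq by (simp add: algebra_simps)
          then have "norm (f \<sigma> - f s - (\<sigma> - s) *\<^sub>R D) \<le> norm ((s - t) *\<^sub>R D) + norm (f s - f t)"
            by (metis norm_triangle_ineq4)
          ultimately have "norm (f \<sigma> - f s - (\<sigma> - s) *\<^sub>R D) \<le> 2 * e" using elim by (simp add: dist_norm)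
          also have "\<dots> = \<epsilon> * ((\<sigma> - t) / 2)" by (simp add: e_def)
          also have "\<dots> \<le> \<epsilon> * \<bar>\<sigma> - s\<bar>" using \<epsilon> elim(2) by (intro mult_left_mono) (auto simp: abs_if field_simps)
          finally show "norm (f \<sigma> - f s - (\<sigma> - s) *\<^sub>R D) \<le> \<epsilon> * \<bar>\<sigma> - s\<bar>" .
        qed
      qed
    qed
  qed
qed

text \<open>With \<sigma>(t) = t both differences in the definition merely change sign, and what
  remains is the ordinary derivative within S.\<close>

lemma delta_derivative_right_dense_iff:
  fixes f :: "real \<Rightarrow> 'a::real_normed_vector"
  assumes "t \<in> S" "fwd_jump S t = t"
  shows "has_delta_derivative S f D t \<longleftrightarrow> (f has_vector_derivative D) (at t within S)"
proof -
  have *: "norm (f t - f s - (t - s) *\<^sub>R D) = norm (f s - f t - (s - t) *\<^sub>R D)" for s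
  proof -
    have "f t - f s - (t - s) *\<^sub>R D = - (f s - f t - (s - t) *\<^sub>R D)" by (simp add: algebra_simps)
    then show ?thesis by (metis norm_minus_cancel)
  qed
  show ?thesis
    unfolding has_delta_derivative_def has_vector_derivative_def has_derivative_within_alt2
      eventually_at_filter assms * abs_minus_commute[of t]
    by (auto simp: bounded_linear_scaleR_left elim!: all_forward eventually_mono)
qed

section \<open>Calculus of the delta derivative and growth estimates\<close>

context half_scale begin

lemma delta_derivative_continuous:
  fixes f :: "real \<Rightarrow> 'a::real_normed_vector"
  assumes "t \<in> S" "has_delta_derivative S f D t"
  shows "(f \<longlongrightarrow> f t) (at t within S)"
proof (cases "fwd_jump S t = t")
  case True
  then show ?thesis using assms has_vector_derivative_continuous
    by (auto simp: delta_derivative_right_dense_iff continuous_within)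
next
  case False
  then show ?thesis using assms fwd_jump_ge[of t] by (auto simp: delta_derivative_right_scattered_iff)
qed

lemma delta_derivative_jump:
  fixes f :: "real \<Rightarrow> 'a::real_normed_vector"
  assumes "t \<in> S" "has_delta_derivative S f D t"
  shows "f (fwd_jump S t) = f t + graininess S t *\<^sub>R D"
proof (cases "fwd_jump S t = t")
  case False
  then show ?thesis using assms fwd_jump_ge[of t] by (auto simp: delta_derivative_right_scattered_iff)
qed (simp add: graininess_def)

lemma delta_derivative_subset:
  fixes f :: "real \<Rightarrow> 'a::real_normed_vector"
  assumes "has_delta_derivative S f D t" "R \<subseteq> S" "fwd_jump R t = fwd_jump S t"
  shows "has_delta_derivative R f D t"
  using assms by (auto simp: has_delta_derivative_def elim!: all_forward eventually_mono)

lemma delta_derivative_diff: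
  fixes f g :: "real \<Rightarrow> 'a::real_normed_vector"
  assumes "t \<in> S" "has_delta_derivative S f D t" "has_delta_derivative S g E t"
  shows "has_delta_derivative S (\<lambda>t. f t - g t) (D - E) t"
proof (cases "fwd_jump S t = t")
  case True
  then show ?thesis using assms by (auto simp: delta_derivative_right_dense_iff intro: has_vector_derivative_diff)
next
  case False
  then show ?thesis using assms fwd_jump_ge[of t]
    by (auto simp: delta_derivative_right_scattered_iff algebra_simps intro: tendsto_intros)
qed

lemma delta_derivative_bounded_linear:
  fixes f :: "real \<Rightarrow> 'a::real_normed_vector" and h :: "'a \<Rightarrow> 'b::real_normed_vector"
  assumes "t \<in> S" "has_delta_derivative S f D t" "bounded_linear h"
  shows "has_delta_derivative S (\<lambda>t. h (f t)) (h D) t"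
proof -
  interpret bounded_linear h by fact
  show ?thesis
  proof (cases "fwd_jump S t = t")
    case True
    then show ?thesis using assms by (auto simp: delta_derivative_right_dense_iff intro: has_vector_derivative)
  next
    case False
    then show ?thesis using assms fwd_jump_ge[of t]
      by (auto simp: delta_derivative_right_scattered_iff add scaleR intro: tendsto)
  qed
qed

lemma left_dense_nontrivial:
  assumes "\<And>e. e < t \<Longrightarrow> \<exists>s\<in>S. e < s \<and> s < t"
  shows "at t within (S \<inter> {..<t}) \<noteq> bot"
proof -
  have "t islimpt (S \<inter> {..<t})"
    unfolding islimpt_approachable_real
  proof (intro allI impI)
    fix e :: real assume "e > 0"
    then obtain s where "s \<in> S" "t - e < s" "s < t" using assms[of "t - e"] by auto
    then show "\<exists>s\<in>S \<inter> {..<t}. s \<noteq> t \<and> \<bar>s - t\<bar> < e" by force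
  qed
  then show ?thesis by (simp add: trivial_limit_within)
qed

text \<open>
  The estimate follows \<open>norm y\<close> along the scale with the rate \<open>L + \<eta>\<close> and the initial slack \<open>\<eta>\<close>,
  which leaves room for the error terms at right-dense points.
\<close>

lemma delta_gronwall:
  fixes y :: "real \<Rightarrow> 'a::real_normed_vector"
  assumes L: "L \<ge> 0" and b: "b \<in> S"
    and der: "\<And>t. t \<in> S \<Longrightarrow> t < b \<Longrightarrow> has_delta_derivative S y (D t) t"
    and bound: "\<And>t. t \<in> S \<Longrightarrow> t < b \<Longrightarrow> norm (D t) \<le> L * norm (y t)"
    and cont: "(y \<longlongrightarrow> y b) (at b within S)"
  shows "norm (y b) \<le> exp (L * (b - a)) * norm (y a)"
proof -
  have main: "norm (y b) \<le> exp ((L + \<eta>) * (b - a)) * (norm (y a) + \<eta>)" if \<eta>: "\<eta> > 0" for \<eta>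
  proof -
    define E where "E t = exp ((L + \<eta>) * (t - a)) * (norm (y a) + \<eta>)" for t
    have Epos: "E t > 0" for t using \<eta> by (auto simp: E_def intro!: mult_pos_pos add_nonneg_pos)
    have Estep: "E s = exp ((L + \<eta>) * (s - t)) * E t" for s t
      by (simp add: E_def exp_add[symmetric] algebra_simps)
    have Ecomp: "(1 + (L + \<eta>) * (s - t)) * E t \<le> E s" for s t
      unfolding Estep[of s t] using Epos[of t] exp_ge_add_one_self by (intro mult_right_mono) auto
    have tends: "(y \<longlongrightarrow> y t) (at t within S)" if "t \<in> S" "t \<le> b" for t
      using delta_derivative_continuous[OF that(1) der[OF that(1)]] that cont by (cases "t = b") auto
    have "t \<le> b \<longrightarrow> norm (y t) \<le> E t" if "t \<in> S" for t
      using that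
    proof (induction rule: scale_induct)
      case start
      then show ?case using \<eta> by (simp add: E_def)
    next
      case (scattered t)
      show ?case
      proof
        assume le: "fwd_jump S t \<le> b"
        have n: "norm (y t) \<le> E t" using scattered le by simp
        have "y (fwd_jump S t) = y t + graininess S t *\<^sub>R D t"
          using scattered le by (intro delta_derivative_jump der) auto
        then have "norm (y (fwd_jump S t)) \<le> norm (y t) + graininess S t * norm (D t)"
          using norm_triangle_ineq[of "y t" "graininess S t *\<^sub>R D t"] graininess_ge_0[of t] by simp
        also have "\<dots> \<le> norm (y t) + graininess S t * (L * norm (y t))"
          using scattered le graininess_ge_0[of t] by (intro add_left_mono mult_left_mono bound) auto
        also have "\<dots> = (1 + L * graininess S t) * norm (y t)" by (simp add: algebra_simps)
        also have "\<dots> \<le> (1 + (L + \<eta>) * graininess S t) * E t"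
          using n L \<eta> graininess_ge_0[of t] by (intro mult_mono add_left_mono mult_right_mono) auto
        also have "\<dots> \<le> E (fwd_jump S t)" using Ecomp[where t=t] by (simp add: graininess_def)
        finally show "norm (y (fwd_jump S t)) \<le> E (fwd_jump S t)" .
      qed
    next
      case (right_dense t)
      show ?case
      proof (cases "t < b")
        case False
        then show ?thesis by (intro exI[of _ "t + 1"]) auto
      next
        case True
        then have d: "has_delta_derivative S y (D t) t" and n: "norm (y t) \<le> E t"
          and Dt: "norm (D t) \<le> L * norm (y t)"
          using der right_dense bound by auto
        have "\<eta> * E t > 0" using \<eta> Epos by simp
        then obtain e where e: "e > 0" "\<And>s. dist s t < e \<Longrightarrow> s \<in> S \<Longrightarrow>
            norm (y t - y s - (t - s) *\<^sub>R D t) \<le> \<eta> * E t * \<bar>t - s\<bar>"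
          using d right_dense unfolding has_delta_derivative_def eventually_nhds_metric by metis
        show ?thesis
        proof (intro exI[of _ "t + e"] conjI ballI impI)
          fix s assume s: "s \<in> S" "t < s \<and> s < t + e" "s \<le> b"
          have "y s = y t + (s - t) *\<^sub>R D t - (y t - y s - (t - s) *\<^sub>R D t)" by (simp add: algebra_simps)
          then have "norm (y s) \<le> norm (y t + (s - t) *\<^sub>R D t) + norm (y t - y s - (t - s) *\<^sub>R D t)"
            by (metis norm_triangle_ineq4)
          also have "\<dots> \<le> norm (y t) + (s - t) * norm (D t) + \<eta> * E t * (s - t)"
            using e(2)[of s] s norm_triangle_ineq[of "y t" "(s - t) *\<^sub>R D t"] by (auto simp: dist_real_def)
          also have "\<dots> \<le> E t + (s - t) * (L * E t) + \<eta> * E t * (s - t)"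
            using s n Dt L by (intro add_right_mono add_mono mult_left_mono) (auto intro: order_trans mult_left_mono)
          also have "\<dots> = (1 + (L + \<eta>) * (s - t)) * E t" by (simp add: algebra_simps)
          also have "\<dots> \<le> E s" by (rule Ecomp)
          finally show "norm (y s) \<le> E s" .
        qed (use e in auto)
      qed
    next
      case (left_dense t)
      show ?case
      proof
        assume tb: "t \<le> b"
        have nt: "at t within (S \<inter> {..<t}) \<noteq> bot"
          using left_dense by (intro left_dense_nontrivial) auto
        have "((\<lambda>s. norm (y s)) \<longlongrightarrow> norm (y t)) (at t within (S \<inter> {..<t}))"
          by (intro tendsto_norm tendsto_within_subset[OF tends]) (use left_dense tb in auto)
        moreover have "(E \<longlongrightarrow> E t) (at t within (S \<inter> {..<t}))"
          unfolding E_def by (intro tendsto_intros)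
        moreover have "\<forall>\<^sub>F s in at t within (S \<inter> {..<t}). norm (y s) \<le> E s"
          using left_dense tb by (auto simp: eventually_at_filter)
        ultimately show "norm (y t) \<le> E t" using tendsto_le[OF nt] by blast
      qed
    qed
    then show ?thesis using b by (simp add: E_def)
  qed
  have "((\<lambda>\<eta>. exp ((L + \<eta>) * (b - a)) * (norm (y a) + \<eta>)) \<longlongrightarrow>
      exp ((L + 0) * (b - a)) * (norm (y a) + 0)) (at_right 0)"
    by (intro tendsto_intros)
  then show ?thesis
    by (intro tendsto_lowerbound[of _ "exp (L * (b - a)) * norm (y a)" "at_right (0::real)"])
      (auto simp: eventually_at_filter intro!: always_eventually main)
qed


lemma exp_minus_double_le:
  fixes u :: real
  assumes "0 \<le> u" "u \<le> 1 / 2"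
  shows "exp (- 2 * u) \<le> 1 - u"
proof -
  have "exp (- 2 * u) = inverse (exp (2 * u))" by (simp add: exp_minus)
  also have "\<dots> \<le> inverse (1 + 2 * u)"
    using assms exp_ge_add_one_self[of "2 * u"] by (intro le_imp_inverse_le) auto
  also have "\<dots> \<le> 1 - u"
  proof -
    have "0 \<le> u * (1 - 2 * u)" using assms by simp
    then have "1 \<le> (1 - u) * (1 + 2 * u)" by (simp add: algebra_simps)
    then show ?thesis using assms by (simp add: inverse_eq_divide divide_le_eq)
  qed
  finally show ?thesis .
qed

text \<open>
  Across a gap, smallness of the gap gives the lower bound through \<open>1 - \<mu> M\<close>; a gap that is not small
  is long enough to absorb the factor \<open>R\<close> in the exponent.
\<close>

lemma delta_lower_bound:
  fixes y :: "real \<Rightarrow> 'a::real_normed_vector"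
  assumes M: "M \<ge> 0" and R: "R \<ge> 1" and b: "b \<in> S"
    and der: "\<And>t. t \<in> S \<Longrightarrow> has_delta_derivative S y (D t) t"
    and bound: "\<And>t. t \<in> S \<Longrightarrow> norm (D t) \<le> M * norm (y t)"
    and regr: "\<And>t. t \<in> S \<Longrightarrow> norm (y t) \<le> R * norm (y (fwd_jump S t))"
  shows "exp (- (2 * (M + 1) * (1 + ln R)) * (b - a)) * norm (y a) \<le> norm (y b)"
proof (cases "norm (y a) = 0")
  case False
  \<comment> \<open>Origin of the rate: while \<open>(M + 1) * h \<le> 1 / 2\<close>, the inequality
    1 - u >= exp(-2u) gives 2 * (M + 1), where 1 is added to M to absorb the error term at
    right-dense points. A longer gap has \<open>2 * (M + 1) * h > 1\<close>, so the summand with ln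
    R outweighs one division by R.\<close>
  define K where "K = 2 * (M + 1) * (1 + ln R)"
  define E where "E t = exp (- K * (t - a)) * norm (y a)" for t
  have lnR: "ln R \<ge> 0" using R by simp
  have Kge: "K \<ge> 2 * (M + 1)" and Kge2: "K \<ge> 2 * (M + 1) * ln R" 
    using M lnR by (auto simp: K_def algebra_simps)
  have Epos: "E t > 0" for t using False by (simp add: E_def)
  have Estep: "E s = exp (- K * (s - t)) * E t" for s t
    by (simp add: E_def exp_add[symmetric] algebra_simps)
  have exp_le: "exp (- K * h) \<le> 1 - (M + 1) * h" if "h \<ge> 0" "(M + 1) * h \<le> 1 / 2" for h
  proof -
    have "exp (- K * h) \<le> exp (- 2 * ((M + 1) * h))"
      using Kge that mult_right_mono[of "2 * (M + 1)" K h] by (simp add: algebra_simps)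
    also have "\<dots> \<le> 1 - (M + 1) * h" using that M by (intro exp_minus_double_le) auto
    finally show ?thesis .
  qed
  have "E t \<le> norm (y t)" if "t \<in> S" for t
    using that
  proof (induction rule: scale_induct)
    case start
    then show ?case by (simp add: E_def)
  next
    case (scattered t)
    define h where "h = graininess S t"
    have h: "h \<ge> 0" by (simp add: h_def graininess_ge_0)
    have jump: "y (fwd_jump S t) = y t + h *\<^sub>R D t"
      unfolding h_def using scattered by (intro delta_derivative_jump der)
    have "exp (- K * h) * norm (y t) \<le> norm (y (fwd_jump S t))"
    proof (cases "(M + 1) * h \<le> 1 / 2")
      case True
      have "exp (- K * h) * norm (y t) \<le> (1 - (M + 1) * h) * norm (y t)"
        using h True by (intro mult_right_mono exp_le) auto
      also have "\<dots> \<le> norm (y t) - h * (M * norm (y t))" using h by (simp add: algebra_simps)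
      also have "\<dots> \<le> norm (y t) - h * norm (D t)"
        using bound scattered h by (intro diff_left_mono mult_left_mono) auto
      also have "\<dots> \<le> norm (y t + h *\<^sub>R D t)"
        using h norm_diff_ineq[of "y t" "h *\<^sub>R D t"] by simp
      finally show ?thesis by (simp add: jump)
    next
      case False
      have "ln R = 1 * ln R" by simp
      also have "1 * ln R \<le> (2 * (M + 1) * h) * ln R" using False lnR by (intro mult_right_mono) (auto simp: algebra_simps)
      also have "\<dots> = (2 * (M + 1) * ln R) * h" by simp
      also have "\<dots> \<le> K * h" using h Kge2 by (intro mult_right_mono) auto
      finally have "exp (- K * h) \<le> exp (- ln R)" by simp
      also have "\<dots> = 1 / R" using R by (simp add: exp_minus inverse_eq_divide)
      finally have "exp (- K * h) * norm (y t) \<le> (1 / R) * (R * norm (y (fwd_jump S t)))"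
        using regr[of t] scattered R by (intro mult_mono) auto
      then show ?thesis using R by simp
    qed
    moreover have "E (fwd_jump S t) \<le> exp (- K * h) * norm (y t)"
      unfolding Estep[of "fwd_jump S t" t] h_def graininess_def using scattered by (intro mult_left_mono) auto
    ultimately show ?case by linarith
  next
    case (right_dense t)
    have ypos: "norm (y t) > 0" using Epos[of t] right_dense by linarith
    then obtain e where e: "e > 0" "\<And>s. dist s t < e \<Longrightarrow> s \<in> S \<Longrightarrow>
        norm (y t - y s - (t - s) *\<^sub>R D t) \<le> norm (y t) * \<bar>t - s\<bar>"
      using der right_dense unfolding has_delta_derivative_def eventually_nhds_metric by metis
    show ?case
    proof (intro exI[of _ "t + min e (1 / (2 * (M + 1)))"] conjI ballI impI)
      fix s assume s: "s \<in> S" "t < s \<and> s < t + min e (1 / (2 * (M + 1)))"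
      have small: "(M + 1) * (s - t) \<le> 1 / 2"
      proof -
        have "(M + 1) * (s - t) \<le> (M + 1) * (1 / (2 * (M + 1)))" using s M by (intro mult_left_mono) auto
        also have "\<dots> = 1 / 2" using M by (simp add: divide_simps)
        finally show ?thesis .
      qed
      have "E s \<le> exp (- K * (s - t)) * norm (y t)"
        unfolding Estep[of s t] using right_dense by (intro mult_left_mono) auto
      also have "\<dots> \<le> (1 - (M + 1) * (s - t)) * norm (y t)"
        using s small by (intro mult_right_mono exp_le) auto
      also have "\<dots> = norm (y t) - (s - t) * (M * norm (y t)) - norm (y t) * (s - t)"
        by (simp add: algebra_simps)
      also have "\<dots> \<le> norm (y t) - (s - t) * norm (D t) - norm (y t - y s - (t - s) *\<^sub>R D t)"
        using bound[of t] right_dense s e(2)[of s]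
        by (intro diff_mono mult_left_mono) (auto simp: dist_real_def)
      also have "\<dots> \<le> norm (y s)"
      proof -
        have "y t = y s - (s - t) *\<^sub>R D t + (y t - y s - (t - s) *\<^sub>R D t)" by (simp add: algebra_simps)
        then have "norm (y t) \<le> norm (y s - (s - t) *\<^sub>R D t) + norm (y t - y s - (t - s) *\<^sub>R D t)"
          by (metis norm_triangle_ineq)
        moreover have "norm (y s - (s - t) *\<^sub>R D t) \<le> norm (y s) + (s - t) * norm (D t)"
          using norm_triangle_ineq4[of "y s" "(s - t) *\<^sub>R D t"] s by simp
        ultimately show ?thesis by linarith
      qed
      finally show "E s \<le> norm (y s)" .
    qed (use e M in auto)
  next
    case (left_dense t)
    have nt: "at t within (S \<inter> {..<t}) \<noteq> bot"
      using left_dense by (intro left_dense_nontrivial) auto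
    have "((\<lambda>s. norm (y s)) \<longlongrightarrow> norm (y t)) (at t within (S \<inter> {..<t}))"
      by (intro tendsto_norm tendsto_within_subset[OF delta_derivative_continuous[OF _ der]])
        (use left_dense in auto)
    moreover have "(E \<longlongrightarrow> E t) (at t within (S \<inter> {..<t}))"
      unfolding E_def by (intro tendsto_intros)
    moreover have "\<forall>\<^sub>F s in at t within (S \<inter> {..<t}). E s \<le> norm (y s)"
      using left_dense by (auto simp: eventually_at_filter)
    ultimately show "E t \<le> norm (y t)" using tendsto_le[OF nt] by blast
  qed
  then show ?thesis using b by (simp add: E_def K_def)
qed simp

end

section \<open>Integrals along a time scale\<close>

lemma rd_continuous_compose2:
  fixes f :: "real \<Rightarrow> 'a::real_normed_vector" and g :: "real \<Rightarrow> 'b::real_normed_vector"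
    and h :: "'a \<Rightarrow> 'b \<Rightarrow> 'c::real_normed_vector"
  assumes "bounded_bilinear h" "rd_continuous S f" "rd_continuous S g"
  shows "rd_continuous S (\<lambda>t. h (f t) (g t))"
  unfolding rd_continuous_def
proof (intro ballI conjI impI)
  fix t assume t: "t \<in> S"
  show "((\<lambda>t. h (f t) (g t)) \<longlongrightarrow> h (f t) (g t)) (at t within S)" if "fwd_jump S t = t"
    using assms t that by (auto simp: rd_continuous_def intro: bounded_bilinear.tendsto)
  obtain l m where "(f \<longlongrightarrow> l) (at t within S \<inter> {..<t})" "(g \<longlongrightarrow> m) (at t within S \<inter> {..<t})"
    using assms t by (meson rd_continuous_def)
  then show "\<exists>l. ((\<lambda>t. h (f t) (g t)) \<longlongrightarrow> l) (at t within S \<inter> {..<t})"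
    using bounded_bilinear.tendsto[OF assms(1)] by blast
qed

lemma rd_continuous_add:
  fixes f g :: "real \<Rightarrow> 'a::real_normed_vector"
  assumes "rd_continuous S f" "rd_continuous S g"
  shows "rd_continuous S (\<lambda>t. f t + g t)"
  unfolding rd_continuous_def
proof (intro ballI conjI impI)
  fix t assume t: "t \<in> S"
  show "((\<lambda>t. f t + g t) \<longlongrightarrow> f t + g t) (at t within S)" if "fwd_jump S t = t"
    using assms t that by (auto simp: rd_continuous_def intro: tendsto_add)
  obtain l m where "(f \<longlongrightarrow> l) (at t within S \<inter> {..<t})" "(g \<longlongrightarrow> m) (at t within S \<inter> {..<t})"
    using assms t by (meson rd_continuous_def)
  then show "\<exists>l. ((\<lambda>t. f t + g t) \<longlongrightarrow> l) (at t within S \<inter> {..<t})"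
    using tendsto_add by blast
qed

lemma continuous_imp_rd_continuous:
  fixes f :: "real \<Rightarrow> 'a::topological_space"
  assumes "continuous_on S f"
  shows "rd_continuous S f"
  unfolding rd_continuous_def
proof (intro ballI conjI impI)
  fix t assume t: "t \<in> S"
  show lim: "(f \<longlongrightarrow> f t) (at t within S)" using assms t by (simp add: continuous_on_def)
  show "\<exists>l. (f \<longlongrightarrow> l) (at t within S \<inter> {..<t})"
    using tendsto_within_subset[OF lim] by blast
qed

lemma matrix_add_rdistrib: "(A + B) ** C = A ** C + B ** C" for A B :: "'a::semiring_1^'n^'m"
  by (simp add: matrix_matrix_mult_def vec_eq_iff distrib_right sum.distrib)

lemma bounded_bilinear_matrix_mult:
  "bounded_bilinear ((**) :: real^'n^'n \<Rightarrow> real^'n^'n \<Rightarrow> real^'n^'n)"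
  unfolding bilinear_conv_bounded_bilinear[symmetric]
  by (auto simp: bilinear_def linear_iff matrix_add_ldistrib matrix_add_rdistrib
      matrix_scalar_ac scalar_matrix_assoc scalar_mult_eq_scaleR)

lemma bounded_bilinear_matrix_vector_mult:
  "bounded_bilinear ((*v) :: real^'n^'n \<Rightarrow> real^'n \<Rightarrow> real^'n)"
  unfolding bilinear_conv_bounded_bilinear[symmetric]
  by (auto simp: bilinear_def linear_iff matrix_vector_mult_add_rdistrib matrix_vector_right_distrib
      matrix_vector_mult_scaleR scaleR_matrix_vector_assoc)

text \<open>The norm of a matrix is here the Euclidean norm of all its entries, so Cauchy-Schwarz in
  each row suffices.\<close>

lemma norm_matrix_vector_le: "norm (A *v x) \<le> norm A * norm (x :: real^'n)" for A :: "real^'n^'m"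
proof -
  have "norm (A *v x) \<le> L2_set (\<lambda>i. norm (A $ i) * norm x) UNIV"
    unfolding norm_vec_def[of "A *v x"]
  proof (rule L2_set_mono)
    fix i
    have "norm ((A *v x) $ i) = \<bar>(A $ i) \<bullet> x\<bar>"
      by (simp add: matrix_vector_mult_def inner_vec_def)
    also have "\<dots> \<le> norm (A $ i) * norm x" by (rule Cauchy_Schwarz_ineq2)
    finally show "norm ((A *v x) $ i) \<le> norm (A $ i) * norm x" .
  qed auto
  also have "\<dots> = norm A * norm x" unfolding norm_vec_def[of A]
    by (rule L2_set_left_distrib[symmetric]) auto
  finally show ?thesis .
qed

text \<open>Tannery's theorem: the majorant makes the partial sums converge uniformly in
  \<open>n\<close>, so the two limits may be exchanged.\<close>

lemma tendsto_suminf_dominated: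
  fixes f :: "nat \<Rightarrow> nat \<Rightarrow> 'a::banach"
  assumes lim: "\<And>k. (\<lambda>n. f n k) \<longlonglongrightarrow> g k" and le: "\<And>n k. norm (f n k) \<le> M k" and "summable M"
  shows "(\<lambda>n. \<Sum>k. f n k) \<longlonglongrightarrow> (\<Sum>k. g k)"
proof (rule swap_uniform_limit')
  show "\<forall>\<^sub>F N in sequentially. ((\<lambda>n. \<Sum>k<N. f n k) \<longlongrightarrow> (\<Sum>k<N. g k)) sequentially"
    by (intro always_eventually allI tendsto_sum lim)
  have "norm (g k) \<le> M k" for k
    using tendsto_norm[OF lim] by (rule tendsto_upperbound) (auto simp: le)
  then have "summable g" by (intro summable_comparison_test[OF _ \<open>summable M\<close>]) auto
  then show "(\<lambda>N. \<Sum>k<N. g k) \<longlonglongrightarrow> (\<Sum>k. g k)" by (rule summable_LIMSEQ)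
  show "uniform_limit UNIV (\<lambda>N n. \<Sum>k<N. f n k) (\<lambda>n. \<Sum>k. f n k) sequentially"
    by (rule Weierstrass_m_test[OF _ \<open>summable M\<close>]) (simp add: le)
qed auto

section \<open>Delta integrals as ordinary integrals of a composition with the floor of the
  scale\<close>

context half_scale begin

text \<open>The last point of S up to \<tau>, extended by the constant \<open>a\<close> to the left
  of S. Composing with it turns a delta integral into an ordinary one: across the gap after t the
  integrand keeps its value at t, and so contributes the graininess times that value.\<close>

definition scale_floor :: "real \<Rightarrow> real" where
  "scale_floor \<tau> = Sup (S \<inter> {..max a \<tau>})"

lemma scale_floor_aux: "scale_floor \<tau> \<in> S \<inter> {..max a \<tau>}"
  unfolding scale_floor_def
  using start_in closed_S by (intro closed_contains_Sup) auto

lemma scale_floor_in: "scale_floor \<tau> \<in> S"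
  using scale_floor_aux by blast

lemma scale_floor_le: "a \<le> \<tau> \<Longrightarrow> scale_floor \<tau> \<le> \<tau>"
  using scale_floor_aux[of \<tau>] by (auto simp: max_def)

lemma scale_floor_upper: "s \<in> S \<Longrightarrow> s \<le> \<tau> \<Longrightarrow> s \<le> scale_floor \<tau>"
  unfolding scale_floor_def by (intro cSup_upper) auto

lemma scale_floor_id: "t \<in> S \<Longrightarrow> scale_floor t = t"
  using scale_floor_upper[of t t] scale_floor_le[of t] start_le[of t] by auto

lemma scale_floor_below: "\<tau> \<le> a \<Longrightarrow> scale_floor \<tau> = a"
  using scale_floor_aux[of \<tau>] start_le scale_floor_in[of \<tau>] by (force simp: max_def)

lemma scale_floor_gap:
  assumes "t \<in> S" "t \<le> \<tau>" "\<tau> < fwd_jump S t"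
  shows "scale_floor \<tau> = t"
  using assms scale_floor_upper[of t \<tau>] scale_floor_le[of \<tau>] start_le[of t]
    fwd_jump_le[of "scale_floor \<tau>" t] scale_floor_in[of \<tau>] by force

lemma mono_scale_floor: "mono scale_floor"
  unfolding scale_floor_def
  by (intro monoI cSup_subset_mono) (use start_in in auto)

lemma less_fwd_jump_scale_floor:
  assumes "a \<le> \<tau>" "fwd_jump S (scale_floor \<tau>) > scale_floor \<tau>"
  shows "\<tau> < fwd_jump S (scale_floor \<tau>)"
  using scale_floor_upper[OF fwd_jump_in[of "scale_floor \<tau>"], of \<tau>] assms by force

lemma fwd_jump_mono_strict:
  assumes "s \<in> S" "t \<in> S" "s < t" "fwd_jump S t > t"
  shows "fwd_jump S s < fwd_jump S t"
  using fwd_jump_le[of t s] assms by simp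

lemma not_isCont_scale_floor:
  assumes "t \<in> S" "fwd_jump S t > t"
  shows "\<not> isCont scale_floor (fwd_jump S t)"
proof
  let ?u = "fwd_jump S t"
  assume "isCont scale_floor ?u"
  then have "(scale_floor \<longlongrightarrow> ?u) (at_left ?u)"
    using scale_floor_id[OF fwd_jump_in] by (metis filterlim_at_split isCont_def)
  moreover have "\<forall>\<^sub>F \<tau> in at_left ?u. scale_floor \<tau> = t"
    unfolding eventually_at_left_field
    using assms by (intro exI[of _ t]) (auto intro: scale_floor_gap)
  then have "(scale_floor \<longlongrightarrow> t) (at_left ?u)" by (rule tendsto_eventually)
  ultimately have "?u = t" by (intro tendsto_unique[of "at_left ?u"]) auto
  then show False using assms by simp
qed

text \<open>\<open>scale_floor\<close> jumps at the right end of every gap, distinct gaps have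
  distinct right ends, and a monotone function has only countably many discontinuities.\<close>

lemma countable_right_scattered: "countable {t \<in> S. fwd_jump S t > t}"
proof (rule countable_image_inj_on)
  show "countable (fwd_jump S ` {t \<in> S. fwd_jump S t > t})"
    by (rule countable_subset[OF _ mono_ctble_discont[OF mono_scale_floor]])
      (use not_isCont_scale_floor in auto)
  show "inj_on (fwd_jump S) {t \<in> S. fwd_jump S t > t}"
  proof (rule inj_onI)
    fix s t assume "s \<in> {t \<in> S. fwd_jump S t > t}" "t \<in> {t \<in> S. fwd_jump S t > t}" "fwd_jump S s = fwd_jump S t"
    then show "s = t" using fwd_jump_mono_strict[of s t] fwd_jump_mono_strict[of t s] by force
  qed
qed

text \<open>Outside countably many times the composition is continuous. If the floor of \<tau> is
  right-dense, \<open>p\<close> is continuous there along S. Otherwise \<tau> lies strictly inside a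
  gap or to the left of S, where the floor is locally constant. The left ends of gaps are excluded
  because \<open>p\<close> may jump there.\<close>

lemma rd_continuous_floor_measurable:
  fixes p :: "real \<Rightarrow> 'a::topological_space"
  assumes "rd_continuous S p"
  shows "(\<lambda>\<tau>. p (scale_floor \<tau>)) \<in> borel_measurable borel"
proof (rule borel_measurable_continuous_countable_exceptions)
  let ?X = "{\<tau>. \<not> isCont scale_floor \<tau>} \<union> {t \<in> S. fwd_jump S t > t}"
  show "countable ?X"
    using mono_ctble_discont[OF mono_scale_floor] countable_right_scattered by blast
  have "isCont (\<lambda>\<tau>. p (scale_floor \<tau>)) \<tau>" if \<tau>: "\<tau> \<notin> ?X" for \<tau>
  proof (cases "fwd_jump S (scale_floor \<tau>) = scale_floor \<tau>")
    case True
    then have "continuous (at (scale_floor \<tau>) within S) p"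
      using assms scale_floor_in[of \<tau>] by (auto simp: rd_continuous_def continuous_within)
    then have "continuous (at (scale_floor \<tau>) within range scale_floor) p"
      by (rule continuous_within_subset) (use scale_floor_in in auto)
    then show ?thesis using \<tau> continuous_within_compose[of \<tau> UNIV scale_floor p] by (auto simp: o_def)
  next
    case False
    then have gt: "fwd_jump S (scale_floor \<tau>) > scale_floor \<tau>" using fwd_jump_ge[of "scale_floor \<tau>"] by simp
    have "\<forall>\<^sub>F x in nhds \<tau>. scale_floor x = scale_floor \<tau>"
    proof (cases "\<tau> < a")
      case True
      then have "\<forall>\<^sub>F x in nhds \<tau>. x < a" by (intro order_tendstoD(2)[OF filterlim_ident])
      then show ?thesis by eventually_elim (use True in \<open>simp add: scale_floor_below\<close>)
    next
      case False
      then have 1: "\<tau> < fwd_jump S (scale_floor \<tau>)" using less_fwd_jump_scale_floor gt by simp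
      have "\<tau> \<noteq> scale_floor \<tau>" using \<tau> gt scale_floor_in[of \<tau>] by force
      then have 2: "scale_floor \<tau> < \<tau>" using scale_floor_le[of \<tau>] False by simp
      have "\<forall>\<^sub>F x in nhds \<tau>. scale_floor \<tau> < x \<and> x < fwd_jump S (scale_floor \<tau>)"
        using 1 2 by (intro eventually_conj order_tendstoD(1)[OF filterlim_ident] order_tendstoD(2)[OF filterlim_ident])
      then show ?thesis by eventually_elim (intro scale_floor_gap, auto simp: scale_floor_in)
    qed
    then have "\<forall>\<^sub>F x in nhds \<tau>. p (scale_floor x) = p (scale_floor \<tau>)" by eventually_elim simp
    then show ?thesis using isCont_cong[where g="\<lambda>_. p (scale_floor \<tau>)"] by auto
  qed
  then show "continuous_on (- ?X) (\<lambda>\<tau>. p (scale_floor \<tau>))"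
    by (meson ComplD continuous_at_imp_continuous_on)
qed

lemma rd_continuous_floor_integrable:
  fixes p :: "real \<Rightarrow> 'a::euclidean_space"
  assumes "rd_continuous S p" and "a \<le> u" and bound: "\<And>t. t \<in> S \<Longrightarrow> t \<le> v \<Longrightarrow> norm (p t) \<le> B"
  shows "(\<lambda>\<tau>. p (scale_floor \<tau>)) integrable_on {u..v}"
proof (rule measurable_bounded_by_integrable_imp_integrable)
  have "(\<lambda>\<tau>. p (scale_floor \<tau>)) \<in> borel_measurable lebesgue"
    using rd_continuous_floor_measurable[OF assms(1)] by (intro measurable_completion) simp
  then show "(\<lambda>\<tau>. p (scale_floor \<tau>)) \<in> borel_measurable (lebesgue_on {u..v})"
    by (rule measurable_restrict_space1)
  show "(\<lambda>\<tau>. B) integrable_on {u..v}" by (rule integrable_const_ivl)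
  show "norm (p (scale_floor x)) \<le> B" if "x \<in> {u..v}" for x
    using that assms(2) scale_floor_le[of x] scale_floor_in[of x] by (intro bound) auto
qed auto

text \<open>Across a gap the integrand is constant, which gives the difference quotient exactly. At
  a right-dense t the floor of every time between s and t again lies between s and t, so continuity
  of \<open>p\<close> along S controls the whole integral.\<close>

lemma delta_derivative_floor_integral:
  fixes p :: "real \<Rightarrow> 'a::euclidean_space"
  assumes rd: "rd_continuous S p" and bound: "\<And>c. \<exists>B. \<forall>t\<in>S. t \<le> c \<longrightarrow> norm (p t) \<le> B"
    and t: "t \<in> S"
  shows "has_delta_derivative S (\<lambda>t. integral {a..t} (\<lambda>\<tau>. p (scale_floor \<tau>))) (p t) t"
proof -
  define F where "F = (\<lambda>t. integral {a..t} (\<lambda>\<tau>. p (scale_floor \<tau>)))"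
  have int: "(\<lambda>\<tau>. p (scale_floor \<tau>)) integrable_on {u..v}" if "a \<le> u" for u v
    using bound[of v] rd_continuous_floor_integrable[OF rd that] by blast
  have Fdiff: "F v - F u = integral {u..v} (\<lambda>\<tau>. p (scale_floor \<tau>))" if "a \<le> u" "u \<le> v" for u v
    using Henstock_Kurzweil_Integration.integral_combine[OF that int[of a v]] by (simp add: F_def algebra_simps)
  have at: "a \<le> t" using start_le t by simp
  have "has_delta_derivative S F (p t) t"
  proof (cases "fwd_jump S t = t")
    case False
    then have gt: "fwd_jump S t > t" using fwd_jump_ge[of t] by simp
    have "continuous_on {a..t+1} F" unfolding F_def by (intro indefinite_integral_continuous_1 int) simp
    then have "(F \<longlongrightarrow> F t) (at t within {a..t+1})" using at by (simp add: continuous_on_def)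
    moreover have "at t within S = at t within (S \<inter> {..t+1})"
      by (rule at_within_nhd[of _ "{..<t+1}"]) auto
    moreover have "S \<inter> {..t+1} \<subseteq> {a..t+1}" using start_le by auto
    ultimately have "(F \<longlongrightarrow> F t) (at t within S)" by (metis tendsto_within_subset)
    moreover have "F (fwd_jump S t) = F t + graininess S t *\<^sub>R p t"
    proof -
      \<comment> \<open>At the right end of the gap the floor is already the next point of the
        scale; this single time is discarded.\<close>
      have "integral {t..fwd_jump S t} (\<lambda>\<tau>. p (scale_floor \<tau>)) = integral {t..fwd_jump S t} (\<lambda>\<tau>. p t)"
        by (rule integral_spike[of "{fwd_jump S t}"]) (auto simp: scale_floor_gap[OF t])
      then show ?thesis using Fdiff[OF at fwd_jump_ge] fwd_jump_ge[of t] by (simp add: graininess_def algebra_simps)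
    qed
    ultimately show ?thesis using gt t by (simp add: delta_derivative_right_scattered_iff)
  next
    case True
    then have lim: "(p \<longlongrightarrow> p t) (at t within S)" using rd t by (simp add: rd_continuous_def)
    show ?thesis unfolding has_delta_derivative_def True
    proof (intro allI impI)
      fix \<epsilon> :: real assume \<epsilon>: "\<epsilon> > 0"
      obtain d where d: "d > 0" "\<And>s. s \<in> S \<Longrightarrow> dist s t < d \<Longrightarrow> norm (p s - p t) \<le> \<epsilon>"
      proof -
        have "\<forall>\<^sub>F s in at t within S. dist (p s) (p t) < \<epsilon>" using lim \<epsilon> by (rule tendstoD)
        then obtain d where "d > 0" "\<And>s. s \<in> S \<Longrightarrow> s \<noteq> t \<Longrightarrow> dist s t < d \<Longrightarrow> dist (p s) (p t) < \<epsilon>"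
          unfolding eventually_at by blast
        then show ?thesis using that[of d] \<epsilon> by (metis dist_norm less_eq_real_def norm_zero diff_self)
      qed
      have est: "norm (F v - F u - (v - u) *\<^sub>R p t) \<le> \<epsilon> * (v - u)"
        if uv: "u \<in> S" "u \<le> v" "\<And>\<tau>. u \<le> \<tau> \<Longrightarrow> \<tau> \<le> v \<Longrightarrow> dist (scale_floor \<tau>) t < d" for u v
      proof -
        have au: "a \<le> u" using start_le uv by simp
        have "F v - F u - (v - u) *\<^sub>R p t = integral {u..v} (\<lambda>\<tau>. p (scale_floor \<tau>)) - integral {u..v} (\<lambda>\<tau>. p t)"
          using uv au by (simp add: Fdiff)
        also have "\<dots> = integral {u..v} (\<lambda>\<tau>. p (scale_floor \<tau>) - p t)"
          using int[OF au] by (intro Henstock_Kurzweil_Integration.integral_diff[symmetric]) auto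
        also have "norm \<dots> \<le> integral {u..v} (\<lambda>\<tau>. \<epsilon>)"
          by (intro integral_norm_bound_integral integrable_diff int au)
            (use d uv scale_floor_in in auto)
        finally show ?thesis using uv by (simp add: mult.commute)
      qed
      have "\<forall>\<^sub>F s in nhds t. dist s t < d" using d eventually_nhds_metric by blast
      then show "\<forall>\<^sub>F s in nhds t. s \<in> S \<longrightarrow> norm (F t - F s - (t - s) *\<^sub>R p t) \<le> \<epsilon> * \<bar>t - s\<bar>"
      proof eventually_elim
        case (elim s)
        show ?case
        proof
          assume s: "s \<in> S"
          show "norm (F t - F s - (t - s) *\<^sub>R p t) \<le> \<epsilon> * \<bar>t - s\<bar>"
          proof (cases "s \<le> t")
            case True
            have "dist (scale_floor \<tau>) t < d" if "s \<le> \<tau>" "\<tau> \<le> t" for \<tau>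
              using scale_floor_upper[OF s that(1)] scale_floor_le[of \<tau>] start_le[OF s] that elim
              by (auto simp: dist_real_def)
            then show ?thesis using est[OF s True] True by simp
          next
            case False
            have "dist (scale_floor \<tau>) t < d" if "t \<le> \<tau>" "\<tau> \<le> s" for \<tau>
              using scale_floor_upper[OF t that(1)] scale_floor_le[of \<tau>] start_le[OF t] that elim
              by (auto simp: dist_real_def)
            then have "norm (F s - F t - (s - t) *\<^sub>R p t) \<le> \<epsilon> * (s - t)" using False by (intro est t) auto
            moreover have "F t - F s - (t - s) *\<^sub>R p t = - (F s - F t - (s - t) *\<^sub>R p t)"
              by (simp add: algebra_simps)
            ultimately show ?thesis using False by (metis norm_minus_cancel abs_minus_commute abs_of_pos diff_gt_0_iff_gt not_le)
          qed
        qed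
      qed
    qed
  qed
  then show ?thesis by (simp add: F_def)
qed

end

section \<open>Linear systems\<close>

lemma matrix_mult_bound:
  obtains K where "K > 0" "\<And>(A :: real^'n^'n) (X :: real^'n^'n). norm A \<le> M \<Longrightarrow> norm (A ** X) \<le> K * norm X"
proof -
  obtain C where C: "C > 0" "\<And>(A :: real^'n^'n) (B :: real^'n^'n). norm (A ** B) \<le> norm A * norm B * C"
    using bounded_bilinear.pos_bounded[OF bounded_bilinear_matrix_mult] by blast
  have "norm (A ** X) \<le> (\<bar>M\<bar> + 1) * C * norm X" if "norm A \<le> M" for A :: "real^'n^'n" and X :: "real^'n^'n"
  proof -
    have "norm (A ** X) \<le> norm A * norm X * C" by (rule C)
    also have "\<dots> \<le> (\<bar>M\<bar> + 1) * norm X * C" using that C by (intro mult_right_mono) auto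
    finally show ?thesis by (simp add: mult_ac)
  qed
  with C show ?thesis by (intro that[of "(\<bar>M\<bar> + 1) * C"]) auto
qed

lemma continuous_on_atLeastI:
  fixes f :: "real \<Rightarrow> 'a::topological_space"
  assumes "\<And>b. continuous_on {a..b} f"
  shows "continuous_on {a..} f"
  unfolding continuous_on_def
proof
  fix t assume t: "t \<in> {a..}"
  then have "(f \<longlongrightarrow> f t) (at t within {a..t+1})" using assms[of "t+1"] by (simp add: continuous_on_def)
  moreover have "at t within {a..} = at t within {a..t+1}"
    by (rule at_within_nhd[of _ "{..<t+1}"]) auto
  ultimately show "(f \<longlongrightarrow> f t) (at t within {a..})" by simp
qed

lemma delta_derivative_add_const:
  "has_delta_derivative S (\<lambda>t. c + f t) D t \<longleftrightarrow> has_delta_derivative S f D t"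
  by (simp add: has_delta_derivative_def)

section \<open>Uniqueness, the Peano-Baker series and dependence on the coefficients\<close>

context half_scale begin

lemma S_subset: "S \<subseteq> {a..}"
  using start_le by auto

lemma delta_derivative_cong:
  assumes "\<And>s. s \<in> S \<Longrightarrow> f s = g s"
  shows "has_delta_derivative S f D t \<longleftrightarrow> has_delta_derivative S g D t"
  unfolding has_delta_derivative_def using assms fwd_jump_in
  by (intro all_cong1 imp_cong refl eventually_cong always_eventually) auto

text \<open>Gronwall for the difference. The right-hand sides are compared only along the two given
  solutions and only before \<open>b\<close>, so the lemma also identifies solutions of two
  different systems whose right-hand sides agree along one of them.\<close>

lemma delta_unique:
  fixes y z :: "real \<Rightarrow> 'a::real_normed_vector"
  assumes "b \<in> S" "L \<ge> 0"
    and y: "\<And>t. t \<in> S \<Longrightarrow> has_delta_derivative S y (D t) t"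
    and z: "\<And>t. t \<in> S \<Longrightarrow> has_delta_derivative S z (E t) t"
    and bound: "\<And>t. t \<in> S \<Longrightarrow> t < b \<Longrightarrow> norm (D t - E t) \<le> L * norm (y t - z t)"
    and "y a = z a"
  shows "y b = z b"
proof -
  have d: "has_delta_derivative S (\<lambda>t. y t - z t) (D t - E t) t" if "t \<in> S" for t
    using that y z by (intro delta_derivative_diff)
  have "norm (y b - z b) \<le> exp (L * (b - a)) * norm (y a - z a)"
    using assms d delta_derivative_continuous[OF _ d]
    by (intro delta_gronwall[where y="\<lambda>t. y t - z t" and D="\<lambda>t. D t - E t"]) auto
  then show ?thesis using assms by simp
qed

lemma floor_integral_continuous:
  fixes p :: "real \<Rightarrow> 'a::euclidean_space"
  assumes rd: "rd_continuous S p" and bound: "\<And>c. \<exists>B. \<forall>t\<in>S. t \<le> c \<longrightarrow> norm (p t) \<le> B"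
  shows "continuous_on {a..} (\<lambda>t. integral {a..t} (\<lambda>\<tau>. p (scale_floor \<tau>)))"
  using rd_continuous_floor_integrable[OF rd order_refl] bound
  by (intro continuous_on_atLeastI indefinite_integral_continuous_1) blast

text \<open>The terms of the Peano-Baker series. They are defined for all real times, not only on S,
  so that each term is continuous on the half-line and can be integrated again after composition
  with the floor.\<close>

primrec picard :: "(real \<Rightarrow> real^'n^'n) \<Rightarrow> nat \<Rightarrow> real \<Rightarrow> real^'n^'n" where
  "picard A 0 = (\<lambda>t. mat 1)"
| "picard A (Suc n) = (\<lambda>t. integral {a..t} (\<lambda>\<tau>. A (scale_floor \<tau>) ** picard A n (scale_floor \<tau>)))"

definition transition :: "(real \<Rightarrow> real^'n^'n) \<Rightarrow> real \<Rightarrow> real^'n^'n" where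
  "transition A t = (\<Sum>n. picard A n t)"

lemma rd_continuous_matrix_mult:
  fixes A :: "real \<Rightarrow> real^'n^'n"
  assumes "rd_continuous S A" "continuous_on {a..} (X :: real \<Rightarrow> real^'n^'n)"
  shows "rd_continuous S (\<lambda>t. A t ** X t)"
  by (rule rd_continuous_compose2[OF bounded_bilinear_matrix_mult])
    (use assms S_subset in \<open>auto intro: continuous_imp_rd_continuous continuous_on_subset\<close>)

text \<open>A majorant that reproduces itself: doubling the exponential rate M turns one integration
  into a factor 1/2, so a geometric series takes the place of the usual factorials.\<close>

definition picard_major :: "real \<Rightarrow> real \<Rightarrow> nat \<Rightarrow> real \<Rightarrow> real" where
  "picard_major M c n t = c * (1/2)^n * exp (2 * M * (t - a))"

lemma picard_major_mono: "M > 0 \<Longrightarrow> c \<ge> 0 \<Longrightarrow> s \<le> t \<Longrightarrow> picard_major M c n s \<le> picard_major M c n t"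
  unfolding picard_major_def by (intro mult_left_mono) auto

lemma picard_major_integral:
  assumes "M > 0" "t \<ge> a"
  shows "((\<lambda>\<tau>. M * picard_major M c n \<tau>) has_integral (picard_major M c (Suc n) t - picard_major M c (Suc n) a)) {a..t}"
proof (rule fundamental_theorem_of_calculus[OF assms(2)])
  fix x
  show "(picard_major M c (Suc n) has_vector_derivative M * picard_major M c n x) (at x within {a..t})"
    unfolding has_real_derivative_iff_has_vector_derivative[symmetric] picard_major_def
    by (rule derivative_eq_intros refl | simp)+
qed

text \<open>Bound, continuity and integrability are proved together because each term is an integral
  of the one before. The bound survives the floor, since the majorant is increasing and the floor of
  \<tau> is at most \<tau>.\<close>

lemma picard_properties:
  fixes A :: "real \<Rightarrow> real^'n^'n"
  assumes rd: "rd_continuous S A" and "M > 0"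
    and bound: "\<And>t X. t \<in> S \<Longrightarrow> norm (A t ** X) \<le> M * norm (X :: real^'n^'n)"
  defines "c \<equiv> norm (mat 1 :: real^'n^'n)"
  shows "(\<forall>t\<ge>a. norm (picard A n t) \<le> picard_major M c n t) \<and> continuous_on {a..} (picard A n) \<and>
    (\<forall>v. (\<lambda>\<tau>. A (scale_floor \<tau>) ** picard A n (scale_floor \<tau>)) integrable_on {a..v})"
proof (induction n)
  have c: "c \<ge> 0" by (simp add: c_def)
  have bd: "\<exists>B. \<forall>t\<in>S. t \<le> v \<longrightarrow> norm (A t ** picard A n t) \<le> B"
    if "\<forall>t\<ge>a. norm (picard A n t) \<le> picard_major M c n t" for n v
  proof (intro exI ballI impI)
    fix t assume t: "t \<in> S" "t \<le> v"
    have "norm (A t ** picard A n t) \<le> M * norm (picard A n t)" using bound t by blast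
    also have "\<dots> \<le> M * picard_major M c n t" using that t start_le \<open>M > 0\<close> by (intro mult_left_mono) auto
    also have "\<dots> \<le> M * picard_major M c n v" using t \<open>M > 0\<close> c by (intro mult_left_mono picard_major_mono) auto
    finally show "norm (A t ** picard A n t) \<le> M * picard_major M c n v" .
  qed
  have int: "(\<lambda>\<tau>. A (scale_floor \<tau>) ** picard A n (scale_floor \<tau>)) integrable_on {a..v}"
    if "\<forall>t\<ge>a. norm (picard A n t) \<le> picard_major M c n t" "continuous_on {a..} (picard A n)" for n v
    using bd[OF that(1), of v] rd_continuous_floor_integrable[OF rd_continuous_matrix_mult[OF rd that(2)] order_refl]
    by blast
  case 0
  have *: "\<forall>t\<ge>a. norm (picard A 0 t) \<le> picard_major M c 0 t"
    using \<open>M > 0\<close> c mult_left_mono[of 1 _ c] by (auto simp: picard_major_def c_def)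
  show ?case using * int[OF *] by auto
  case (Suc n)
  then have IH: "\<forall>t\<ge>a. norm (picard A n t) \<le> picard_major M c n t" "continuous_on {a..} (picard A n)"
    and ii: "\<And>v. (\<lambda>\<tau>. A (scale_floor \<tau>) ** picard A n (scale_floor \<tau>)) integrable_on {a..v}"
    by auto
  have 1: "continuous_on {a..} (picard A (Suc n))"
    using floor_integral_continuous[OF rd_continuous_matrix_mult[OF rd IH(2)] bd[OF IH(1)]] by simp
  have 2: "\<forall>t\<ge>a. norm (picard A (Suc n) t) \<le> picard_major M c (Suc n) t"
  proof (intro allI impI)
    fix t assume t: "t \<ge> a"
    have "norm (picard A (Suc n) t) \<le> integral {a..t} (\<lambda>\<tau>. M * picard_major M c n \<tau>)"
      unfolding picard.simps
    proof (rule integral_norm_bound_integral[OF ii])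
      show "(\<lambda>\<tau>. M * picard_major M c n \<tau>) integrable_on {a..t}"
        using picard_major_integral[OF \<open>M > 0\<close> t] by blast
      fix \<tau> assume \<tau>: "\<tau> \<in> {a..t}"
      have "norm (A (scale_floor \<tau>) ** picard A n (scale_floor \<tau>)) \<le> M * norm (picard A n (scale_floor \<tau>))"
        using bound scale_floor_in by blast
      also have "\<dots> \<le> M * picard_major M c n (scale_floor \<tau>)"
        using IH start_le scale_floor_in \<open>M > 0\<close> by (intro mult_left_mono) auto
      also have "\<dots> \<le> M * picard_major M c n \<tau>"
        using \<tau> scale_floor_le \<open>M > 0\<close> c by (intro mult_left_mono picard_major_mono) auto
      finally show "norm (A (scale_floor \<tau>) ** picard A n (scale_floor \<tau>)) \<le> M * picard_major M c n \<tau>" .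
    qed
    also have "\<dots> = picard_major M c (Suc n) t - picard_major M c (Suc n) a"
      by (rule integral_unique[OF picard_major_integral[OF \<open>M > 0\<close> t]])
    also have "\<dots> \<le> picard_major M c (Suc n) t" using c by (simp add: picard_major_def)
    finally show "norm (picard A (Suc n) t) \<le> picard_major M c (Suc n) t" .
  qed
  show ?case using 1 2 int[OF 2 1] by blast
qed

lemma picard_major_summable: "summable (\<lambda>n. picard_major M c n t)"
  unfolding picard_major_def by (intro summable_mult2 summable_mult summable_geometric) auto

text \<open>Integrating the partial sums of the series, after multiplication by the coefficient,
  gives the partial sums of the shifted series; the majorant at time t permits dominated
  convergence.\<close>

lemma transition_integral:
  fixes A :: "real \<Rightarrow> real^'n^'n"
  assumes rd: "rd_continuous S A" and "M > 0"
    and bound: "\<And>t X. t \<in> S \<Longrightarrow> norm (A t ** X) \<le> M * norm (X :: real^'n^'n)"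
    and t: "t \<ge> a"
  shows "(\<lambda>\<tau>. A (scale_floor \<tau>) ** transition A (scale_floor \<tau>)) integrable_on {a..t}"
    and "transition A t = mat 1 + integral {a..t} (\<lambda>\<tau>. A (scale_floor \<tau>) ** transition A (scale_floor \<tau>))"
proof -
  let ?c = "norm (mat 1 :: real^'n^'n)"
  have P: "norm (picard A n s) \<le> picard_major M ?c n s" if "s \<ge> a" for n s
    using picard_properties[OF rd \<open>M > 0\<close> bound, of n] that by blast
  have I: "(\<lambda>\<tau>. A (scale_floor \<tau>) ** picard A n (scale_floor \<tau>)) integrable_on {a..t}" for n
    using picard_properties[OF rd \<open>M > 0\<close> bound, where n=n] by blast
  have sm: "summable (\<lambda>n. picard A n s)" if "s \<ge> a" for s
    by (rule summable_comparison_test[OF _ picard_major_summable[of M ?c s]]) (use P that in auto)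
  interpret mm: bounded_bilinear "(**) :: real^'n^'n \<Rightarrow> real^'n^'n \<Rightarrow> real^'n^'n" by (rule bounded_bilinear_matrix_mult)
  let ?f = "\<lambda>N \<tau>. \<Sum>n<N. A (scale_floor \<tau>) ** picard A n (scale_floor \<tau>)"
  have int: "integral {a..t} (?f N) = (\<Sum>n<N. picard A (Suc n) t)" for N
    by (simp add: Henstock_Kurzweil_Integration.integral_sum I)
  have conv: "(\<lambda>N. ?f N \<tau>) \<longlonglongrightarrow> A (scale_floor \<tau>) ** transition A (scale_floor \<tau>)" if "\<tau> \<in> {a..t}" for \<tau>
    unfolding mm.sum_right[symmetric] transition_def
    using start_le scale_floor_in by (intro mm.tendsto tendsto_const summable_LIMSEQ sm) auto
  have dom: "norm (?f N \<tau>) \<le> M * (\<Sum>n. picard_major M ?c n t)" if \<tau>: "\<tau> \<in> {a..t}" for N \<tau>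
  proof -
    have "norm (?f N \<tau>) \<le> (\<Sum>n<N. M * picard_major M ?c n t)"
    proof (rule sum_norm_le)
      fix n
      have "norm (A (scale_floor \<tau>) ** picard A n (scale_floor \<tau>)) \<le> M * norm (picard A n (scale_floor \<tau>))"
        using bound scale_floor_in by blast
      also have "\<dots> \<le> M * picard_major M ?c n (scale_floor \<tau>)"
        using P start_le scale_floor_in \<open>M > 0\<close> by (intro mult_left_mono) auto
      also have "\<dots> \<le> M * picard_major M ?c n t"
        using \<tau> scale_floor_le[of \<tau>] \<open>M > 0\<close> by (intro mult_left_mono picard_major_mono) auto
      finally show "norm (A (scale_floor \<tau>) ** picard A n (scale_floor \<tau>)) \<le> M * picard_major M ?c n t" .
    qed
    also have "\<dots> = M * (\<Sum>n<N. picard_major M ?c n t)" by (simp add: sum_distrib_left)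
    also have "\<dots> \<le> M * (\<Sum>n. picard_major M ?c n t)"
      using \<open>M > 0\<close> picard_major_summable
      by (intro mult_left_mono sum_le_suminf) (auto simp: picard_major_def)
    finally show ?thesis .
  qed
  have fint: "?f N integrable_on {a..t}" for N by (intro integrable_sum I) auto
  note dc = dominated_convergence[OF fint integrable_const_ivl dom conv]
  show "(\<lambda>\<tau>. A (scale_floor \<tau>) ** transition A (scale_floor \<tau>)) integrable_on {a..t}"
    using dc(1) by blast
  have "(\<lambda>N. \<Sum>n<N. picard A (Suc n) t) \<longlonglongrightarrow> (\<Sum>n. picard A (Suc n) t)"
    using sm[OF t] summable_Suc_iff summable_LIMSEQ by blast
  moreover have "(\<lambda>N. \<Sum>n<N. picard A (Suc n) t) \<longlonglongrightarrow>
      integral {a..t} (\<lambda>\<tau>. A (scale_floor \<tau>) ** transition A (scale_floor \<tau>))"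
    using dc(2) unfolding int by blast
  ultimately have "(\<Sum>n. picard A (Suc n) t) = integral {a..t} (\<lambda>\<tau>. A (scale_floor \<tau>) ** transition A (scale_floor \<tau>))"
    by (rule LIMSEQ_unique)
  then show "transition A t = mat 1 + integral {a..t} (\<lambda>\<tau>. A (scale_floor \<tau>) ** transition A (scale_floor \<tau>))"
    using suminf_split_head[OF sm[OF t]] by (simp add: transition_def algebra_simps)
qed

text \<open>The series solves the integral equation; as a continuous function it is bounded on
  compact intervals, so the integrand is rd-continuous and locally bounded, and differentiating the
  integral gives the delta equation.\<close>

lemma
  fixes A :: "real \<Rightarrow> real^'n^'n"
  assumes rd: "rd_continuous S A" and le: "\<And>t. t \<in> S \<Longrightarrow> norm (A t) \<le> M"
  shows transition_start: "transition A a = mat 1"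
    and transition_continuous: "continuous_on {a..} (transition A)"
    and transition_delta_derivative: "\<And>t. t \<in> S \<Longrightarrow> has_delta_derivative S (transition A) (A t ** transition A t) t"
proof -
  obtain K where K: "K > 0" "\<And>(A :: real^'n^'n) (X :: real^'n^'n). norm A \<le> M \<Longrightarrow> norm (A ** X) \<le> K * norm X"
    using matrix_mult_bound by blast
  have bound: "norm (A t ** X) \<le> K * norm X" if "t \<in> S" for t and X :: "real^'n^'n"
    using that le K by blast
  note T = transition_integral[OF rd K(1) bound]
  have "transition A a = mat 1 + integral {a..a} (\<lambda>\<tau>. A (scale_floor \<tau>) ** transition A (scale_floor \<tau>))"
    by (rule T(2)) auto
  also have "integral {a..a} (\<lambda>\<tau>. A (scale_floor \<tau>) ** transition A (scale_floor \<tau>)) = 0"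
    using integral_refl by force
  finally show "transition A a = mat 1" by simp
  have cont: "continuous_on {a..b} (transition A)" for b
  proof (cases "a \<le> b")
    case True
    have "continuous_on {a..b} (\<lambda>t. mat 1 + integral {a..t} (\<lambda>\<tau>. A (scale_floor \<tau>) ** transition A (scale_floor \<tau>)))"
      using T(1)[OF _ True] by (intro continuous_intros indefinite_integral_continuous_1) auto
    then show ?thesis by (rule continuous_on_eq) (auto intro!: T(2)[symmetric])
  qed simp
  then show c: "continuous_on {a..} (transition A)" by (rule continuous_on_atLeastI)
  fix t assume t: "t \<in> S"
  have bd: "\<exists>B. \<forall>t\<in>S. t \<le> v \<longrightarrow> norm (A t ** transition A t) \<le> B" for v
  proof -
    have "compact (transition A ` {a..v})" by (intro compact_continuous_image cont) simp
    then obtain B where B: "\<And>t. t \<in> {a..v} \<Longrightarrow> norm (transition A t) \<le> B"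
      by (meson compact_imp_bounded bounded_iff imageI)
    show ?thesis
    proof (intro exI ballI impI)
      fix t assume "t \<in> S" "t \<le> v"
      then have "norm (A t ** transition A t) \<le> K * norm (transition A t)" using bound by blast
      also have "\<dots> \<le> K * B" using B start_le \<open>t \<in> S\<close> \<open>t \<le> v\<close> K by (intro mult_left_mono) auto
      finally show "norm (A t ** transition A t) \<le> K * B" .
    qed
  qed
  have "has_delta_derivative S (\<lambda>t. mat 1 + integral {a..t} (\<lambda>\<tau>. A (scale_floor \<tau>) ** transition A (scale_floor \<tau>)))
      (A t ** transition A t) t"
    unfolding delta_derivative_add_const
    by (rule delta_derivative_floor_integral[OF rd_continuous_matrix_mult[OF rd c] bd t])
  moreover have "mat 1 + integral {a..s} (\<lambda>\<tau>. A (scale_floor \<tau>) ** transition A (scale_floor \<tau>)) = transition A s"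
    if "s \<in> S" for s using that start_le by (intro T(2)[symmetric]) auto
  ultimately show "has_delta_derivative S (transition A) (A t ** transition A t) t"
    by (rule iffD1[OF delta_derivative_cong, rotated])
qed

text \<open>Pointwise convergence on the scale suffices, which is all that Steklov means provide:
  each Peano-Baker term converges by dominated convergence, and the common bound of the coefficients
  gives one majorant for all the series.\<close>

lemma transition_dependence:
  fixes A :: "real \<Rightarrow> real^'n^'n" and An :: "nat \<Rightarrow> real \<Rightarrow> real^'n^'n"
  assumes rdn: "\<And>n. rd_continuous S (An n)" and rd: "rd_continuous S A"
    and len: "\<And>n t. t \<in> S \<Longrightarrow> norm (An n t) \<le> M"
    and lim: "\<And>t. t \<in> S \<Longrightarrow> (\<lambda>n. An n t) \<longlonglongrightarrow> A t"
    and t: "t \<ge> a"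
  shows "(\<lambda>n. transition (An n) t) \<longlonglongrightarrow> transition A t"
proof -
  obtain K where K: "K > 0" "\<And>(A :: real^'n^'n) (X :: real^'n^'n). norm A \<le> M \<Longrightarrow> norm (A ** X) \<le> K * norm X"
    using matrix_mult_bound by blast
  have bound: "norm (An n t ** X) \<le> K * norm X" if "t \<in> S" for n t and X :: "real^'n^'n"
    using that len K by blast
  let ?c = "norm (mat 1 :: real^'n^'n)"
  have P: "norm (picard (An n) k s) \<le> picard_major K ?c k s" if "s \<ge> a" for n k s
    using picard_properties[OF rdn K(1) bound, where n=k] that by blast
  have I: "(\<lambda>\<tau>. An n (scale_floor \<tau>) ** picard (An n) k (scale_floor \<tau>)) integrable_on {a..v}" for n k v
    using picard_properties[OF rdn K(1) bound, where n=k] by blast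
  interpret mm: bounded_bilinear "(**) :: real^'n^'n \<Rightarrow> real^'n^'n \<Rightarrow> real^'n^'n" by (rule bounded_bilinear_matrix_mult)
  have step: "(\<lambda>n. picard (An n) k t) \<longlonglongrightarrow> picard A k t" if "t \<ge> a" for k t
    using that
  proof (induction k arbitrary: t)
    case 0 then show ?case by simp
  next
    case (Suc k)
    show ?case unfolding picard.simps
    proof (rule dominated_convergence(2)[OF I integrable_const_ivl])
      fix n \<tau> assume \<tau>: "\<tau> \<in> {a..t}"
      have "norm (An n (scale_floor \<tau>) ** picard (An n) k (scale_floor \<tau>)) \<le> K * norm (picard (An n) k (scale_floor \<tau>))"
        using bound scale_floor_in by blast
      also have "\<dots> \<le> K * picard_major K ?c k (scale_floor \<tau>)"
        using P start_le scale_floor_in K by (intro mult_left_mono) auto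
      also have "\<dots> \<le> K * picard_major K ?c k t"
        using \<tau> scale_floor_le[of \<tau>] K by (intro mult_left_mono picard_major_mono) auto
      finally show "norm (An n (scale_floor \<tau>) ** picard (An n) k (scale_floor \<tau>)) \<le> K * picard_major K ?c k t" .
    next
      fix \<tau> assume "\<tau> \<in> {a..t}"
      show "(\<lambda>n. An n (scale_floor \<tau>) ** picard (An n) k (scale_floor \<tau>)) \<longlonglongrightarrow> A (scale_floor \<tau>) ** picard A k (scale_floor \<tau>)"
        using start_le scale_floor_in by (intro mm.tendsto lim Suc.IH) auto
    qed
  qed
  show ?thesis unfolding transition_def
    by (rule tendsto_suminf_dominated[OF step[OF t] P[OF t] picard_major_summable])
qed

lemma linear_solution_unique:
  fixes A :: "real \<Rightarrow> real^'n^'n"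
  assumes rd: "rd_continuous S A" and le: "\<And>t. t \<in> S \<Longrightarrow> norm (A t) \<le> M"
    and y: "\<And>t. t \<in> S \<Longrightarrow> has_delta_derivative S y (A t *v y t) t" and b: "b \<in> S"
  shows "y b = transition A b *v y a"
proof (rule delta_unique[OF b _ y])
  have "M \<ge> 0" using le[OF start_in] norm_ge_zero order_trans by blast
  then show "M \<ge> 0" .
  have bl: "bounded_linear (\<lambda>X :: real^'n^'n. X *v y a)"
    by (rule bounded_bilinear.bounded_linear_left[OF bounded_bilinear_matrix_vector_mult])
  show "has_delta_derivative S (\<lambda>t. transition A t *v y a) (A t *v (transition A t *v y a)) t" if "t \<in> S" for t
    using delta_derivative_bounded_linear[OF that transition_delta_derivative[OF rd le that] bl]
    by (simp add: matrix_vector_mul_assoc)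
  show "norm (A t *v y t - A t *v (transition A t *v y a)) \<le> M * norm (y t - transition A t *v y a)"
    if "t \<in> S" for t
  proof -
    have "norm (A t *v y t - A t *v (transition A t *v y a)) = norm (A t *v (y t - transition A t *v y a))"
      by (simp add: matrix_vector_mult_diff_distrib)
    also have "\<dots> \<le> norm (A t) * norm (y t - transition A t *v y a)" by (rule norm_matrix_vector_le)
    also have "\<dots> \<le> M * norm (y t - transition A t *v y a)" using le that by (intro mult_right_mono) auto
    finally show ?thesis .
  qed
  show "y a = transition A a *v y a" using transition_start[OF rd le] by simp
qed

lemma transition_solution:
  fixes A :: "real \<Rightarrow> real^'n^'n"
  assumes rd: "rd_continuous S A" and le: "\<And>t. t \<in> S \<Longrightarrow> norm (A t) \<le> M" and "t \<in> S"
  shows "has_delta_derivative S (\<lambda>t. transition A t *v v) (A t *v (transition A t *v v)) t"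
  using delta_derivative_bounded_linear[OF \<open>t \<in> S\<close> transition_delta_derivative[OF rd le \<open>t \<in> S\<close>]
      bounded_bilinear.bounded_linear_left[OF bounded_bilinear_matrix_vector_mult, of v]]
  by (simp add: matrix_vector_mul_assoc)

text \<open>
  Steklov means are continuous, yet converge pointwise on the scale: they are eventually constant at a
  right-scattered point and converge by right continuity at a right-dense one.
\<close>

definition steklov :: "(real \<Rightarrow> 'b::euclidean_space) \<Rightarrow> nat \<Rightarrow> real \<Rightarrow> 'b" where
  "steklov p n t = real (Suc n) *\<^sub>R integral {t..t + 1 / real (Suc n)} (\<lambda>\<tau>. p (scale_floor \<tau>))"

lemma steklov_properties:
  fixes p :: "real \<Rightarrow> 'b::euclidean_space"
  assumes rd: "rd_continuous S p" and le: "\<And>t. t \<in> S \<Longrightarrow> norm (p t) \<le> w"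
  shows "continuous_on {a..} (steklov p n)" and "\<And>t. t \<ge> a \<Longrightarrow> norm (steklov p n t) \<le> w"
    and "\<And>t. t \<in> S \<Longrightarrow> (\<lambda>n. steklov p n t) \<longlonglongrightarrow> p t"
proof -
  have int: "(\<lambda>\<tau>. p (scale_floor \<tau>)) integrable_on {u..v}" if "a \<le> u" for u v
    using rd_continuous_floor_integrable[OF rd that] le by blast
  let ?F = "\<lambda>t. integral {a..t} (\<lambda>\<tau>. p (scale_floor \<tau>))"
  have Fdiff: "?F v - ?F u = integral {u..v} (\<lambda>\<tau>. p (scale_floor \<tau>))" if "a \<le> u" "u \<le> v" for u v
    using Henstock_Kurzweil_Integration.integral_combine[OF that int[of a v]] by (simp add: algebra_simps)
  have F: "continuous_on {a..} ?F" using le by (intro floor_integral_continuous rd) blast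
  have "continuous_on {a..} (\<lambda>t. real (Suc n) *\<^sub>R (?F (t + 1 / real (Suc n)) - ?F t))"
    by (intro continuous_intros F continuous_on_compose2[OF F, of _ "\<lambda>t. t + 1 / real (Suc n)"]) (auto intro: add_increasing2)
  then show "continuous_on {a..} (steklov p n)"
    by (rule continuous_on_eq) (auto simp: Fdiff steklov_def)
  \<comment> \<open>The bound is asked only on the half-open window of averaging: at its right end
    the floor may already be the next point of the scale.\<close>
  have est: "norm (steklov p n t - c) \<le> e"
    if t: "t \<ge> a" and c: "\<And>\<tau>. t \<le> \<tau> \<Longrightarrow> \<tau> < t + 1 / real (Suc n) \<Longrightarrow> norm (p (scale_floor \<tau>) - c) \<le> e" for t c e n
  proof -
    let ?h = "1 / real (Suc n)"
    have hp: "?h > 0" by simp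
    have "integral {t..t+?h} (\<lambda>\<tau>. p (scale_floor \<tau>)) - ?h *\<^sub>R c =
        integral {t..t+?h} (\<lambda>\<tau>. p (scale_floor \<tau>) - c)"
      using int[OF t] by (subst Henstock_Kurzweil_Integration.integral_diff) auto
    also have "\<dots> = integral {t..t+?h} (\<lambda>\<tau>. if \<tau> = t + ?h then 0 else p (scale_floor \<tau>) - c)"
      by (rule integral_spike[of "{t+?h}"]) auto
    also have "norm \<dots> \<le> integral {t..t+?h} (\<lambda>\<tau>. e)"
    proof (rule integral_norm_bound_integral)
      have "(\<lambda>\<tau>. p (scale_floor \<tau>) - c) integrable_on {t..t+?h}" using int[OF t] by (intro integrable_diff) auto
      then show "(\<lambda>\<tau>. if \<tau> = t + ?h then 0 else p (scale_floor \<tau>) - c) integrable_on {t..t+?h}"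
        by (rule integrable_spike[of _ _ "{t+?h}"]) auto
      have "norm (p (scale_floor t) - c) \<le> e" using hp by (intro c) auto
      then have "e \<ge> 0" using norm_ge_zero order_trans by blast
      then show "norm (if x = t + ?h then 0 else p (scale_floor x) - c) \<le> e" if "x \<in> {t..t+?h}" for x
        using that c[of x] by auto
    qed auto
    also have "\<dots> = ?h * e" using hp by simp
    finally have le: "norm (integral {t..t+?h} (\<lambda>\<tau>. p (scale_floor \<tau>)) - ?h *\<^sub>R c) \<le> ?h * e" .
    have "steklov p n t - c = real (Suc n) *\<^sub>R (integral {t..t+?h} (\<lambda>\<tau>. p (scale_floor \<tau>)) - ?h *\<^sub>R c)"
      by (simp add: steklov_def scaleR_right_diff_distrib)
    then have "norm (steklov p n t - c) \<le> real (Suc n) * (?h * e)"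
      using mult_left_mono[OF le, of "real (Suc n)"] by simp
    then show ?thesis by simp
  qed
  show "norm (steklov p n t) \<le> w" if "t \<ge> a" for t
    using est[OF that, of n 0 w] le scale_floor_in by simp
  show "(\<lambda>n. steklov p n t) \<longlonglongrightarrow> p t" if t: "t \<in> S" for t
  proof (rule LIMSEQ_I)
    fix r :: real assume r: "r > 0"
    have "\<exists>d>0. \<forall>\<tau>. t \<le> \<tau> \<and> \<tau> < t + d \<longrightarrow> norm (p (scale_floor \<tau>) - p t) \<le> r / 2"
    proof (cases "fwd_jump S t = t")
      case False
      then have "fwd_jump S t > t" using fwd_jump_ge[of t] by simp
      then show ?thesis using r scale_floor_gap[OF t] by (intro exI[of _ "fwd_jump S t - t"]) auto
    next
      case True
      then have "(p \<longlongrightarrow> p t) (at t within S)" using rd t by (simp add: rd_continuous_def)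
      then have "\<forall>\<^sub>F s in at t within S. dist (p s) (p t) < r / 2" using r by (intro tendstoD) auto
      then obtain d where d: "d > 0" "\<And>s. s \<in> S \<Longrightarrow> s \<noteq> t \<Longrightarrow> dist s t < d \<Longrightarrow> dist (p s) (p t) < r / 2"
        unfolding eventually_at by blast
      show ?thesis
      proof (intro exI[of _ d] conjI d allI impI)
        fix \<tau> assume \<tau>: "t \<le> \<tau> \<and> \<tau> < t + d"
        have "t \<le> scale_floor \<tau>" "scale_floor \<tau> \<le> \<tau>"
          using \<tau> scale_floor_upper[OF t] scale_floor_le start_le[OF t] by auto
        then show "norm (p (scale_floor \<tau>) - p t) \<le> r / 2"
          using d(2)[of "scale_floor \<tau>"] scale_floor_in[of \<tau>] \<tau> r
          by (cases "scale_floor \<tau> = t") (auto simp: dist_norm)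
      qed
    qed
    then obtain d where d: "d > 0" "\<And>\<tau>. t \<le> \<tau> \<Longrightarrow> \<tau> < t + d \<Longrightarrow> norm (p (scale_floor \<tau>) - p t) \<le> r / 2" by blast
    obtain N where N: "inverse (real (Suc N)) < d" using reals_Archimedean d by blast
    show "\<exists>no. \<forall>n\<ge>no. norm (steklov p n t - p t) < r"
    proof (intro exI allI impI)
      fix n assume "n \<ge> N"
      then have "1 / real (Suc n) \<le> inverse (real (Suc N))" by (simp add: field_simps)
      then have "norm (steklov p n t - p t) \<le> r / 2" using N start_le[OF t] by (intro est d) auto
      then show "norm (steklov p n t - p t) < r" using r by simp
    qed
  qed
qed

text \<open>Averaging preserves the bound \<open>w\<close>, so stability applies to every Steklov
  mean. The estimate passes to the limit because a solution is the transition matrix applied to its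
  initial value.\<close>

lemma rd_continuous_perturbation_bound:
  fixes A B :: "real \<Rightarrow> real^'n^'n"
  assumes rdA: "rd_continuous S A" and leA: "\<And>t. t \<in> S \<Longrightarrow> norm (A t) \<le> M"
    and stable: "\<And>B y b. continuous_on {a..} B \<Longrightarrow> (\<And>t. t \<ge> a \<Longrightarrow> norm (B t) \<le> w) \<Longrightarrow>
      (\<And>t. t \<in> S \<Longrightarrow> has_delta_derivative S y ((A t + B t) *v y t) t) \<Longrightarrow> b \<in> S \<Longrightarrow>
      norm (y b) \<le> G * norm (y a)"
    and rdB: "rd_continuous S B" and leB: "\<And>t. t \<in> S \<Longrightarrow> norm (B t) \<le> w"
    and y: "\<And>t. t \<in> S \<Longrightarrow> has_delta_derivative S y ((A t + B t) *v y t) t" and b: "b \<in> S"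
  shows "norm (y b) \<le> G * norm (y a)"
proof -
  note sp = steklov_properties[OF rdB leB]
  define C where "C n t = A t + steklov B n t" for n t
  have rdC: "rd_continuous S (C n)" for n
    unfolding C_def using S_subset sp(1)[of n]
    by (intro rd_continuous_add rdA continuous_imp_rd_continuous) (auto intro: continuous_on_subset)
  have leC: "norm (C n t) \<le> M + w" if "t \<in> S" for n t
    unfolding C_def using norm_triangle_mono leA sp(2) that start_le by blast
  have rdAB: "rd_continuous S (\<lambda>t. A t + B t)" by (intro rd_continuous_add rdA rdB)
  have leAB: "norm (A t + B t) \<le> M + w" if "t \<in> S" for t using norm_triangle_mono leA leB that by blast
  have "(\<lambda>n. transition (C n) b) \<longlonglongrightarrow> transition (\<lambda>t. A t + B t) b"
    by (rule transition_dependence[OF rdC rdAB leC]) (use b start_le in \<open>auto simp: C_def intro!: tendsto_intros sp(3)\<close>)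
  then have "(\<lambda>n. norm (transition (C n) b *v y a)) \<longlonglongrightarrow> norm (transition (\<lambda>t. A t + B t) b *v y a)"
    by (intro tendsto_norm bounded_bilinear.tendsto[OF bounded_bilinear_matrix_vector_mult] tendsto_const)
  then have "norm (transition (\<lambda>t. A t + B t) b *v y a) \<le> G * norm (y a)"
  proof (rule tendsto_upperbound)
    have "norm (transition (C n) b *v y a) \<le> G * norm (transition (C n) a *v y a)" for n
      using transition_solution[OF rdC leC] sp(1,2) b
      by (intro stable[of "steklov B n"]) (auto simp: C_def)
    then show "\<forall>\<^sub>F n in sequentially. norm (transition (C n) b *v y a) \<le> G * norm (y a)"
      using transition_start[OF rdC leC] by simp
  qed simp
  then show ?thesis using linear_solution_unique[OF rdAB leAB y b] by simp
qed

end

section \<open>Smooth steps\<close>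

text \<open>A quadratic spline whose derivative is the tent of height 2 on [0, 1]. A continuous
  derivative is all that delta quotients and a continuous Jacobian require, and outside [0, 1] the
  step is exactly constant.\<close>

definition smooth_step :: "real \<Rightarrow> real" where
  "smooth_step x = 2 * (max 0 x)\<^sup>2 - 4 * (max 0 (x - 1/2))\<^sup>2 + 2 * (max 0 (x - 1))\<^sup>2"

definition smooth_step_deriv :: "real \<Rightarrow> real" where
  "smooth_step_deriv x = 4 * max 0 x - 8 * max 0 (x - 1/2) + 4 * max 0 (x - 1)"

lemma has_real_derivative_max_0_square:
  "((\<lambda>x::real. (max 0 x)\<^sup>2) has_real_derivative 2 * max 0 x) (at x)"
proof (cases x "0::real" rule: linorder_cases)
  case less
  have "((\<lambda>x::real. 0) has_real_derivative 0) (at x)" by simp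
  then have "((\<lambda>x::real. (max 0 x)\<^sup>2) has_real_derivative 0) (at x)"
    by (rule has_field_derivative_transform_within_open[where S="{..<0}"]) (use less in auto)
  then show ?thesis using less by simp
next
  case greater
  have "((\<lambda>x::real. x\<^sup>2) has_real_derivative 2 * x) (at x)"
    by (rule derivative_eq_intros refl | simp)+
  then have "((\<lambda>x::real. (max 0 x)\<^sup>2) has_real_derivative 2 * x) (at x)"
    by (rule has_field_derivative_transform_within_open[where S="{0<..}"]) (use greater in auto)
  then show ?thesis using greater by simp
next
  case equal
  have "((\<lambda>h::real. (max 0 h)\<^sup>2 / h) \<longlongrightarrow> 0) (at 0)"
  proof (rule Lim_null_comparison)
    show "\<forall>\<^sub>F h in at 0. norm ((max 0 h)\<^sup>2 / h) \<le> \<bar>h\<bar>" for h :: real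
      by (rule always_eventually) (auto simp: max_def power2_eq_square)
    show "((\<lambda>h::real. \<bar>h\<bar>) \<longlongrightarrow> 0) (at 0)" by (rule tendsto_eq_intros refl | simp)+
  qed
  then show ?thesis using equal by (simp add: has_field_derivative_iff)
qed

lemma smooth_step_has_derivative:
  "(smooth_step has_real_derivative smooth_step_deriv x) (at x)"
proof -
  have sh: "((\<lambda>x::real. (max 0 (x - c))\<^sup>2) has_real_derivative 2 * max 0 (x - c)) (at x)" for c
    using DERIV_shift[of "\<lambda>x. (max 0 x)\<^sup>2" "2 * max 0 (x - c)" x "- c"] has_real_derivative_max_0_square[of "x - c"]
    by simp
  show ?thesis unfolding smooth_step_def[abs_def] smooth_step_deriv_def
    by (rule derivative_eq_intros sh has_real_derivative_max_0_square refl | simp)+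
qed

lemma continuous_smooth_step_deriv: "continuous_on U smooth_step_deriv"
  unfolding smooth_step_deriv_def[abs_def] by (intro continuous_intros)

lemma smooth_step_eq_0 [simp]: "x \<le> 0 \<Longrightarrow> smooth_step x = 0"
  and smooth_step_eq_1 [simp]: "x \<ge> 1 \<Longrightarrow> smooth_step x = 1"
  and smooth_step_deriv_eq_0 [simp]: "x \<le> 0 \<or> x \<ge> 1 \<Longrightarrow> smooth_step_deriv x = 0"
  and smooth_step_deriv_nonneg: "smooth_step_deriv x \<ge> 0"
  and smooth_step_deriv_le: "smooth_step_deriv x \<le> 2"
  by (auto simp: smooth_step_def smooth_step_deriv_def max_def power2_eq_square algebra_simps)

lemma smooth_step_mono: "x \<le> y \<Longrightarrow> smooth_step x \<le> smooth_step y"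
  using DERIV_nonneg_imp_nondecreasing[of x y smooth_step] smooth_step_has_derivative smooth_step_deriv_nonneg
  by blast

lemma smooth_step_nonneg: "smooth_step x \<ge> 0"
  using smooth_step_mono[of "min x 0" x] by simp

lemma smooth_step_le_1: "smooth_step x \<le> 1"
  using smooth_step_mono[of x "max x 1"] by simp

lemma smooth_step_lipschitz: "x \<le> y \<Longrightarrow> smooth_step y - smooth_step x \<le> 2 * (y - x)"
proof -
  assume "x \<le> y"
  then have "2 * x - smooth_step x \<le> 2 * y - smooth_step y"
  proof (rule DERIV_nonneg_imp_nondecreasing)
    fix u
    have "((\<lambda>x. 2 * x - smooth_step x) has_real_derivative 2 - smooth_step_deriv u) (at u)"
      by (rule derivative_eq_intros smooth_step_has_derivative refl | simp)+
    then show "\<exists>d. ((\<lambda>x. 2 * x - smooth_step x) has_real_derivative d) (at u) \<and> 0 \<le> d"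
      using smooth_step_deriv_le[of u] by (intro exI[of _ "2 - smooth_step_deriv u"]) auto
  qed
  then show ?thesis by simp
qed

text \<open>
  The number of summands is chosen so that all later ones vanish when the steps \<open>\<tau>\<close> are at distance at
  least 1 and \<open>h\<close> vanishes on the negative half-line.
\<close>

definition stairs :: "(real \<Rightarrow> real) \<Rightarrow> (nat \<Rightarrow> real) \<Rightarrow> (nat \<Rightarrow> 'a::real_vector) \<Rightarrow> real \<Rightarrow> 'a" where
  "stairs h \<tau> c t = (\<Sum>k<nat \<lceil>t - \<tau> 0\<rceil>. h (t - \<tau> k) *\<^sub>R c k)"

locale spaced_steps =
  fixes \<tau> :: "nat \<Rightarrow> real"
  assumes spaced: "\<tau> k + 1 \<le> \<tau> (Suc k)"
begin

lemma step_mono: "j \<le> k \<Longrightarrow> \<tau> j \<le> \<tau> k"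
proof (rule lift_Suc_mono_le[of \<tau>])
  show "\<tau> n \<le> \<tau> (Suc n)" for n using spaced[of n] by simp
qed

lemma step_linear: "\<tau> 0 + real k \<le> \<tau> k"
proof (induction k)
  case (Suc k) then show ?case using spaced[of k] by simp
qed simp

lemma step_less: "j < k \<Longrightarrow> \<tau> j + 1 \<le> \<tau> k"
  using spaced[of j] step_mono[of "Suc j" k] by simp

lemma exists_step_above: "\<exists>m. t < \<tau> m"
proof -
  obtain m :: nat where "t - \<tau> 0 < real m" using reals_Archimedean2 by blast
  then show ?thesis using step_linear[of m] by (intro exI[of _ m]) simp
qed

text \<open>The upper limit of the sum can be fixed for all times up to \<open>\<tau> m\<close>; the
  stairs are therefore locally a sum of fixed length and may be differentiated term by term.\<close>

lemma stairs_eq_sum: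
  assumes h: "\<And>x. x \<le> 0 \<Longrightarrow> h x = 0" and m: "t \<le> \<tau> m"
  shows "stairs h \<tau> c t = (\<Sum>k<m. h (t - \<tau> k) *\<^sub>R c k)"
proof -
  let ?n = "nat \<lceil>t - \<tau> 0\<rceil>"
  have zero: "h (t - \<tau> k) = 0" if k: "k \<ge> m \<or> k \<ge> ?n" for k
  proof (rule h)
    consider "k \<ge> m" | "k \<ge> ?n" using k by blast
    then show "t - \<tau> k \<le> 0"
    proof cases
      case 1 then show ?thesis using m step_mono[of m k] by simp
    next
      case 2
      then have "t - \<tau> 0 \<le> real k" by linarith
      then show ?thesis using step_linear[of k] by simp
    qed
  qed
  have "(\<Sum>k<?n. h (t - \<tau> k) *\<^sub>R c k) = (\<Sum>k<max ?n m. h (t - \<tau> k) *\<^sub>R c k)"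
    by (rule sum.mono_neutral_left) (auto simp: zero)
  also have "\<dots> = (\<Sum>k<m. h (t - \<tau> k) *\<^sub>R c k)"
    by (rule sum.mono_neutral_right) (auto simp: zero)
  finally show ?thesis by (simp add: stairs_def)
qed

lemma stairs_block:
  assumes "\<tau> k \<le> t" "t \<le> \<tau> (Suc k)"
  shows "stairs smooth_step \<tau> c t = (\<Sum>j<k. c j) + smooth_step (t - \<tau> k) *\<^sub>R c k"
    and "stairs smooth_step_deriv \<tau> c t = smooth_step_deriv (t - \<tau> k) *\<^sub>R c k"
proof -
  have ge: "t - \<tau> j \<ge> 1" if "j < k" for j using step_less[OF that] assms by simp
  have "stairs smooth_step \<tau> c t = (\<Sum>j<Suc k. smooth_step (t - \<tau> j) *\<^sub>R c j)"
    using assms by (intro stairs_eq_sum) auto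
  then show "stairs smooth_step \<tau> c t = (\<Sum>j<k. c j) + smooth_step (t - \<tau> k) *\<^sub>R c k"
    using ge by simp
  have "stairs smooth_step_deriv \<tau> c t = (\<Sum>j<Suc k. smooth_step_deriv (t - \<tau> j) *\<^sub>R c j)"
    using assms by (intro stairs_eq_sum) auto
  then show "stairs smooth_step_deriv \<tau> c t = smooth_step_deriv (t - \<tau> k) *\<^sub>R c k"
    using ge by simp
qed

lemma stairs_before:
  assumes "t \<le> \<tau> 0"
  shows "stairs smooth_step \<tau> c t = 0"
  using stairs_eq_sum[of smooth_step t 0 c] assms by simp

lemma stairs_has_derivative:
  fixes c :: "nat \<Rightarrow> 'a::real_normed_vector"
  shows "(stairs smooth_step \<tau> c has_vector_derivative stairs smooth_step_deriv \<tau> c t) (at t)"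
proof -
  obtain m where m: "t < \<tau> m" using exists_step_above by blast
  have "((\<lambda>t. \<Sum>k<m. smooth_step (t - \<tau> k) *\<^sub>R c k) has_vector_derivative
      (\<Sum>k<m. smooth_step_deriv (t - \<tau> k) *\<^sub>R c k)) (at t)"
  proof (rule has_vector_derivative_sum)
    fix k
    have "((\<lambda>t. smooth_step (t - \<tau> k)) has_real_derivative smooth_step_deriv (t - \<tau> k)) (at t)"
      using DERIV_shift[of smooth_step "smooth_step_deriv (t - \<tau> k)" t "- \<tau> k"]
        smooth_step_has_derivative[of "t - \<tau> k"] by simp
    then show "((\<lambda>t. smooth_step (t - \<tau> k) *\<^sub>R c k) has_vector_derivative smooth_step_deriv (t - \<tau> k) *\<^sub>R c k) (at t)"
      using has_vector_derivative_scaleR[of "\<lambda>t. smooth_step (t - \<tau> k)" "smooth_step_deriv (t - \<tau> k)" t UNIV "\<lambda>_. c k" 0]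
      by simp
  qed
  then have "(stairs smooth_step \<tau> c has_vector_derivative (\<Sum>k<m. smooth_step_deriv (t - \<tau> k) *\<^sub>R c k)) (at t)"
    by (rule has_vector_derivative_transform_within_open[where S="{..<\<tau> m}"])
      (use m in \<open>auto intro!: stairs_eq_sum[symmetric]\<close>)
  then show ?thesis using m by (subst stairs_eq_sum[where m=m]) auto
qed

lemma stairs_deriv_continuous:
  fixes c :: "nat \<Rightarrow> 'a::real_normed_vector"
  shows "isCont (stairs smooth_step_deriv \<tau> c) t"
proof -
  obtain m where m: "t < \<tau> m" using exists_step_above by blast
  have "continuous_on {..<\<tau> m} (\<lambda>t. \<Sum>k<m. smooth_step_deriv (t - \<tau> k) *\<^sub>R c k)"
    by (intro continuous_intros continuous_on_compose2[OF continuous_smooth_step_deriv[of UNIV]]) auto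
  then have "continuous_on {..<\<tau> m} (stairs smooth_step_deriv \<tau> c)"
    by (rule continuous_on_eq) (auto intro!: stairs_eq_sum[symmetric])
  then show ?thesis using m by (simp add: continuous_on_eq_continuous_at)
qed

end

text \<open>Mean value inequality for q minus its linear part, with the continuity of the
  derivative. Two moving points are needed because a delta quotient compares a point with its jump,
  both of them near t.\<close>

lemma strict_derivative:
  fixes q :: "real \<Rightarrow> 'a::real_normed_vector"
  assumes der: "\<And>x. (q has_vector_derivative q' x) (at x)" and cont: "isCont q' t" and "e > 0"
  shows "\<exists>d>0. \<forall>x y. \<bar>x - t\<bar> < d \<longrightarrow> \<bar>y - t\<bar> < d \<longrightarrow> norm (q y - q x - (y - x) *\<^sub>R q' t) \<le> e * \<bar>y - x\<bar>"
proof -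
  have "\<forall>\<^sub>F x in nhds t. dist (q' x) (q' t) < e"
    using cont \<open>e > 0\<close> by (simp add: isCont_def tendsto_at_iff_tendsto_nhds tendstoD)
  then obtain d where d: "d > 0" "\<And>x. dist x t < d \<Longrightarrow> dist (q' x) (q' t) < e"
    unfolding eventually_nhds_metric by blast
  have "norm (q y - q x - (y - x) *\<^sub>R q' t) \<le> e * \<bar>y - x\<bar>" if xy: "\<bar>x - t\<bar> < d" "\<bar>y - t\<bar> < d" for x y
  proof -
    have "norm ((q y - y *\<^sub>R q' t) - (q x - x *\<^sub>R q' t)) \<le> e * norm (y - x)"
    proof (rule differentiable_bound[of "ball t d"])
      fix u assume u: "u \<in> ball t d"
      have "((\<lambda>u. q u - u *\<^sub>R q' t) has_vector_derivative (q' u - q' t)) (at u within ball t d)"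
        by (rule derivative_eq_intros has_vector_derivative_at_within[OF der] refl | simp)+
      then show "((\<lambda>u. q u - u *\<^sub>R q' t) has_derivative (\<lambda>h. h *\<^sub>R (q' u - q' t))) (at u within ball t d)"
        by (simp add: has_vector_derivative_def)
      show "onorm (\<lambda>h. h *\<^sub>R (q' u - q' t)) \<le> e"
        using d(2)[of u] u
        by (simp add: onorm_scaleR_left[OF bounded_linear_ident] onorm_id dist_commute dist_norm[symmetric])
    qed (use xy in \<open>auto simp: dist_real_def abs_minus_commute\<close>)
    then show ?thesis by (simp add: algebra_simps)
  qed
  then show ?thesis using d(1) by blast
qed

section \<open>Delta derivatives of continuously differentiable curves and the product rule\<close>

context half_scale begin

text \<open>From the left the jump is squeezed between s and t. From the right of a right-dense t,
  any point \<open>r\<close> of S just after t bounds the jumps of all points before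
  \<open>r\<close>.\<close>

lemma fwd_jump_tendsto:
  assumes "t \<in> S"
  shows "fwd_jump S t = t \<Longrightarrow> (fwd_jump S \<longlongrightarrow> t) (at t within S)"
    and "(fwd_jump S \<longlongrightarrow> t) (at t within (S \<inter> {..<t}))"
proof -
  have left: "\<bar>fwd_jump S s - t\<bar> \<le> \<bar>s - t\<bar>" if "s \<in> S" "s < t" for s
    using fwd_jump_ge[of s] fwd_jump_le[of t s] assms that by auto
  show "(fwd_jump S \<longlongrightarrow> t) (at t within (S \<inter> {..<t}))"
  proof (rule tendstoI)
    fix e :: real assume "e > 0"
    then show "\<forall>\<^sub>F s in at t within (S \<inter> {..<t}). dist (fwd_jump S s) t < e"
      unfolding eventually_at using left by (intro exI[of _ e]) (force simp: dist_real_def)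
  qed
  assume rd: "fwd_jump S t = t"
  show "(fwd_jump S \<longlongrightarrow> t) (at t within S)"
  proof (rule tendstoI)
    fix e :: real assume e: "e > 0"
    then obtain r where r: "r \<in> S" "t < r" "r < t + e" using right_dense_point[OF rd, of "t + e"] by auto
    show "\<forall>\<^sub>F s in at t within S. dist (fwd_jump S s) t < e"
      unfolding eventually_at
    proof (intro exI[of _ "r - t"] conjI ballI impI)
      fix s assume s: "s \<in> S" "s \<noteq> t \<and> dist s t < r - t"
      show "dist (fwd_jump S s) t < e"
      proof (cases "s < t")
        case True then show ?thesis using left[of s] s r by (auto simp: dist_real_def)
      next
        case False
        then have "t < s" "s < r" using s by (auto simp: dist_real_def)
        then show ?thesis using fwd_jump_ge[of s] fwd_jump_le[of r s] r by (auto simp: dist_real_def)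
      qed
    qed (use r in simp)
  qed
qed

lemma rd_continuous_graininess: "rd_continuous S (graininess S)"
  unfolding rd_continuous_def
proof (intro ballI conjI impI)
  fix t assume t: "t \<in> S"
  show "(graininess S \<longlongrightarrow> graininess S t) (at t within S)" if "fwd_jump S t = t"
    unfolding graininess_def[abs_def] that by (intro tendsto_intros fwd_jump_tendsto t that)
  show "\<exists>l. (graininess S \<longlongrightarrow> l) (at t within S \<inter> {..<t})"
    unfolding graininess_def[abs_def]
    using tendsto_diff[OF fwd_jump_tendsto(2)[OF t] tendsto_ident_at] by blast
qed

text \<open>The delta derivative along S of a curve given for all real times. It is written as a
  formula so that its one-sided limits can be computed; this is where the rd-continuous coefficients
  come from.\<close>

definition delta_quotient :: "(real \<Rightarrow> 'a::real_normed_vector) \<Rightarrow> (real \<Rightarrow> 'a) \<Rightarrow> real \<Rightarrow> 'a" where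
  "delta_quotient q q' t =
     (if fwd_jump S t = t then q' t else (1 / graininess S t) *\<^sub>R (q (fwd_jump S t) - q t))"

lemma delta_quotient_derivative:
  fixes q :: "real \<Rightarrow> 'a::real_normed_vector"
  assumes der: "\<And>x. (q has_vector_derivative q' x) (at x)" and t: "t \<in> S"
  shows "has_delta_derivative S q (delta_quotient q q' t) t"
proof (cases "fwd_jump S t = t")
  case True
  then show ?thesis using der t
    by (auto simp: delta_derivative_right_dense_iff delta_quotient_def intro: has_vector_derivative_at_within)
next
  case False
  then have gt: "fwd_jump S t > t" using fwd_jump_ge[of t] by simp
  have "(q \<longlongrightarrow> q t) (at t within S)"
    using has_vector_derivative_continuous[OF der] continuous_at_imp_continuous_within continuous_within by blast
  then show ?thesis using gt t by (simp add: delta_derivative_right_scattered_iff delta_quotient_def graininess_def)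
qed

text \<open>In the quotient both s and its jump tend to t, so strict differentiability decides. From
  the left the limit is \<open>q' t\<close> even at a right-scattered t, where the quotient itself
  may have another value; rd-continuity allows this.\<close>

lemma delta_quotient_tendsto:
  fixes q :: "real \<Rightarrow> 'a::real_normed_vector"
  assumes der: "\<And>x. (q has_vector_derivative q' x) (at x)" and cont: "\<And>x. isCont q' x"
    and jump: "(fwd_jump S \<longlongrightarrow> t) (at t within U)"
  shows "(delta_quotient q q' \<longlongrightarrow> q' t) (at t within U)"
proof (rule tendstoI)
  fix e :: real assume e: "e > 0"
  obtain d where d: "d > 0" "\<And>x y. \<bar>x - t\<bar> < d \<Longrightarrow> \<bar>y - t\<bar> < d \<Longrightarrow>
      norm (q y - q x - (y - x) *\<^sub>R q' t) \<le> e / 2 * \<bar>y - x\<bar>"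
    using strict_derivative[OF der cont, of "e/2" t] e by auto
  have 1: "\<forall>\<^sub>F s in at t within U. dist (q' s) (q' t) < e"
    using cont[of t] e by (intro tendstoD) (auto simp: isCont_def intro: tendsto_within_subset)
  have 2: "\<forall>\<^sub>F s in at t within U. dist (fwd_jump S s) t < d" using jump d by (intro tendstoD)
  have 3: "\<forall>\<^sub>F s in at t within U. dist s t < d"
    using d by (intro tendstoD) (auto intro: tendsto_ident_at)
  show "\<forall>\<^sub>F s in at t within U. dist (delta_quotient q q' s) (q' t) < e"
    using 1 2 3
  proof eventually_elim
    case (elim s)
    show ?case
    proof (cases "fwd_jump S s = s")
      case True then show ?thesis using elim by (simp add: delta_quotient_def)
    next
      case False
      then have mu: "graininess S s > 0" using fwd_jump_ge[of s] by (simp add: graininess_def)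
      have "delta_quotient q q' s - q' t = (1 / graininess S s) *\<^sub>R (q (fwd_jump S s) - q s - (fwd_jump S s - s) *\<^sub>R q' t)"
        using False mu by (simp add: delta_quotient_def scaleR_right_diff_distrib graininess_def)
      then have "norm (delta_quotient q q' s - q' t) = (1 / graininess S s) * norm (q (fwd_jump S s) - q s - (fwd_jump S s - s) *\<^sub>R q' t)"
        using mu by simp
      also have "\<dots> \<le> (1 / graininess S s) * (e / 2 * \<bar>fwd_jump S s - s\<bar>)"
        using elim mu by (intro mult_left_mono d(2)) (auto simp: dist_real_def)
      also have "\<dots> = e / 2" using mu by (simp add: graininess_def)
      finally show ?thesis using e by (simp add: dist_norm)
    qed
  qed
qed

lemma rd_continuous_delta_quotient:
  fixes q :: "real \<Rightarrow> 'a::real_normed_vector"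
  assumes der: "\<And>x. (q has_vector_derivative q' x) (at x)" and cont: "\<And>x. isCont q' x"
  shows "rd_continuous S (delta_quotient q q')"
  unfolding rd_continuous_def
proof (intro ballI conjI impI)
  fix t assume t: "t \<in> S"
  show "(delta_quotient q q' \<longlongrightarrow> delta_quotient q q' t) (at t within S)" if "fwd_jump S t = t"
    using delta_quotient_tendsto[OF der cont fwd_jump_tendsto(1)[OF t that]] that by (simp add: delta_quotient_def)
  show "\<exists>l. (delta_quotient q q' \<longlongrightarrow> l) (at t within S \<inter> {..<t})"
    using delta_quotient_tendsto[OF der cont fwd_jump_tendsto(2)[OF t]] by blast
qed

text \<open>In this product rule the second term carries \<open>X\<close> after the jump. For a
  solution that is (1 + \<mu> A) X, the source of the factor 1 + M \<mu> in later estimates.\<close>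

lemma delta_derivative_matrix_vector:
  fixes X :: "real \<Rightarrow> real^'n^'n" and q :: "real \<Rightarrow> real^'n"
  assumes t: "t \<in> S" and X: "has_delta_derivative S X D t" and q: "has_delta_derivative S q E t"
  shows "has_delta_derivative S (\<lambda>t. X t *v q t) (D *v q t + X (fwd_jump S t) *v E) t"
proof -
  interpret mv: bounded_bilinear "(*v) :: real^'n^'n \<Rightarrow> real^'n \<Rightarrow> real^'n"
    by (rule bounded_bilinear_matrix_vector_mult)
  show ?thesis
  proof (cases "fwd_jump S t = t")
    case True
    then show ?thesis using mv.has_vector_derivative[of X D t S q E] assms
      by (simp add: delta_derivative_right_dense_iff add.commute)
  next
    case False
    then have gt: "fwd_jump S t > t" using fwd_jump_ge[of t] by simp
    have j: "X (fwd_jump S t) = X t + graininess S t *\<^sub>R D" "q (fwd_jump S t) = q t + graininess S t *\<^sub>R E"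
      using delta_derivative_jump[OF t X] delta_derivative_jump[OF t q] .
    show ?thesis using t gt delta_derivative_continuous[OF t X] delta_derivative_continuous[OF t q]
      by (auto simp: delta_derivative_right_scattered_iff j intro!: mv.tendsto
          simp: mv.add_left mv.add_right mv.scaleR_left mv.scaleR_right algebra_simps)
  qed
qed

end

text \<open>Unboundedness above comes from the right-scattered points, since a time scale might be
  unbounded only below.\<close>

lemma half_scale_ts_from:
  assumes "time_scale T" "\<not> bdd_above (right_scattered T)" "a \<in> T"
  shows "half_scale (ts_from T a) a"
proof
  show "closed (ts_from T a)" using assms by (auto simp: ts_from_def time_scale_def)
  show "\<not> bdd_above (ts_from T a)"
  proof
    assume "bdd_above (ts_from T a)"
    then obtain m where m: "\<And>t. t \<in> T \<Longrightarrow> a \<le> t \<Longrightarrow> t \<le> m" unfolding bdd_above_def ts_from_def by auto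
    have "bdd_above (right_scattered T)"
      using m by (intro bdd_aboveI[of _ "max a m"]) (force simp: right_scattered_def)
    with assms show False by simp
  qed
qed (use assms in \<open>auto simp: ts_from_def\<close>)

lemma fwd_jump_ts_from: "a \<le> t \<Longrightarrow> fwd_jump (ts_from T a) t = fwd_jump T t"
  unfolding fwd_jump_def ts_from_def by (rule arg_cong[of _ _ Inf]) auto

lemma graininess_ts_from: "a \<le> t \<Longrightarrow> graininess (ts_from T a) t = graininess T t"
  by (simp add: graininess_def fwd_jump_ts_from)

lemma rd_continuous_ts_from:
  assumes "rd_continuous T g"
  shows "rd_continuous (ts_from T a) g"
  unfolding rd_continuous_def
proof (intro ballI conjI impI)
  fix t assume t: "t \<in> ts_from T a"
  then have tT: "t \<in> T" "a \<le> t" by (auto simp: ts_from_def)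
  show "(g \<longlongrightarrow> g t) (at t within ts_from T a)" if "fwd_jump (ts_from T a) t = t"
  proof (rule tendsto_within_subset)
    show "(g \<longlongrightarrow> g t) (at t within T)" using assms tT that by (simp add: rd_continuous_def fwd_jump_ts_from)
  qed (auto simp: ts_from_def)
  obtain l where "(g \<longlongrightarrow> l) (at t within T \<inter> {..<t})" using assms tT by (auto simp: rd_continuous_def)
  then show "\<exists>l. (g \<longlongrightarrow> l) (at t within ts_from T a \<inter> {..<t})"
    by (intro exI, rule tendsto_within_subset) (auto simp: ts_from_def)
qed

section \<open>Rotation of a growing orbit\<close>

lemma (in spaced_steps) block_exists:
  assumes "\<tau> 0 \<le> t"
  shows "\<exists>k. \<tau> k \<le> t \<and> t < \<tau> (Suc k)"
proof -
  define m where "m = (LEAST m. t < \<tau> m)"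
  have m: "t < \<tau> m" unfolding m_def using exists_step_above by (rule LeastI_ex)
  then obtain k where k: "m = Suc k" using assms by (cases m) auto
  have "\<not> t < \<tau> k" using not_less_Least[of k "\<lambda>m. t < \<tau> m"] k unfolding m_def by simp
  then show ?thesis using m k by (intro exI[of _ k]) auto
qed

lemma matrix_inverse_right: "invertible P \<Longrightarrow> P ** matrix_inv P = mat 1"
  and matrix_inverse_left: "invertible P \<Longrightarrow> matrix_inv P ** P = mat 1" for P :: "real^'n^'n"
  unfolding invertible_def matrix_inv_def by (metis (mono_tags, lifting) someI_ex)+

lemma matrix_norm_attained:
  fixes P :: "real^'n^'n"
  obtains v where "norm v = 1" "\<And>x. norm (P *v x) \<le> norm (P *v v) * norm x"
proof -
  have "compact (sphere (0::real^'n) 1)" by simp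
  moreover have "sphere (0::real^'n) 1 \<noteq> {}" by simp
  moreover have "continuous_on (sphere 0 1) (\<lambda>x. norm (P *v x))" by (intro continuous_intros)
  ultimately obtain v where v: "v \<in> sphere 0 1" "\<And>x. x \<in> sphere 0 1 \<Longrightarrow> norm (P *v x) \<le> norm (P *v v)"
    by (meson continuous_attains_sup)
  have "norm (P *v x) \<le> norm (P *v v) * norm x" for x
  proof (cases "x = 0")
    case False
    have "P *v x = norm x *\<^sub>R (P *v ((1 / norm x) *\<^sub>R x))"
      using False by (simp add: matrix_vector_mult_scaleR)
    then have "norm (P *v x) = norm x * norm (P *v ((1 / norm x) *\<^sub>R x))" by (metis norm_scaleR abs_norm_cancel)
    also have "\<dots> \<le> norm x * norm (P *v v)" using False by (intro mult_left_mono v) auto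
    finally show ?thesis by (simp add: mult.commute)
  qed simp
  then show ?thesis using that[of v] v by simp
qed

text \<open>The rank-one matrix v w^T. With w = y / |y|^2 it maps y to v and has norm |v| / |y|: the
  cheapest way to prescribe the value of a perturbation along an orbit.\<close>

definition outer :: "real^'n \<Rightarrow> real^'n \<Rightarrow> real^'n^'n" where
  "outer v w = (\<chi> i. (v $ i) *\<^sub>R w)"

lemma outer_mult: "outer v w *v x = (w \<bullet> x) *\<^sub>R v"
  by (simp add: outer_def matrix_vector_mult_def vec_eq_iff inner_vec_def sum_distrib_left sum_distrib_right mult_ac)

lemma norm_outer: "norm (outer v w) = norm v * norm w"
  by (simp add: outer_def norm_vec_def[of "\<chi> i. _ i"] norm_vec_def[of v] L2_set_left_distrib)

lemma bounded_bilinear_outer: "bounded_bilinear outer"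
  unfolding bilinear_conv_bounded_bilinear[symmetric]
  by (auto simp: bilinear_def linear_iff outer_def vec_eq_iff algebra_simps)

text \<open>Uniform regressivity appears as the lower bound \<open>regressive\<close>, the form that
  is needed to bound decay across long gaps; \<open>R \<ge> 1\<close> makes ln R
  nonnegative.\<close>

locale regressive_system =
  fixes T :: "real set" and A :: "real \<Rightarrow> real^'n^'n" and M R :: real
  assumes time_scale: "time_scale T" and scattered: "\<not> bdd_above (right_scattered T)"
    and rd_A: "rd_continuous T A" and M_pos: "M > 0" and A_le: "\<And>t. t \<in> T \<Longrightarrow> norm (A t) \<le> M"
    and R_ge: "R \<ge> 1"
    and regressive: "\<And>t v. t \<in> T \<Longrightarrow> norm v \<le> R * norm ((mat 1 + graininess T t *\<^sub>R A t) *v v)"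
begin

sublocale S0: half_scale "ts_from T 0" 0
  by (rule half_scale_ts_from[OF time_scale scattered]) (use time_scale in \<open>simp add: time_scale_def\<close>)

lemma half_scale_from: "a \<in> ts_from T 0 \<Longrightarrow> half_scale (ts_from T a) a"
  by (rule half_scale_ts_from[OF time_scale scattered]) (simp add: ts_from_def)

abbreviation T0 :: "real set" where "T0 \<equiv> ts_from T 0"

definition X :: "real \<Rightarrow> real^'n^'n" where "X = S0.transition A"

text \<open>Written through \<open>X\<close> for any two times, also backwards, so that composition
  and inversion become algebraic identities.\<close>

definition flow :: "real \<Rightarrow> real \<Rightarrow> real^'n^'n" where "flow t s = X t ** matrix_inv (X s)"

text \<open>The decay rate of \<open>delta_lower_bound\<close>. It is also at least M, so the same
  rate bounds growth.\<close>

definition K :: real where "K = 2 * (M + 1) * (1 + ln R)"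

lemma K_ge: "K \<ge> M" "K \<ge> 0"
proof -
  have "0 \<le> (M + 1) * ln R" using M_pos R_ge by simp
  then show "K \<ge> M" using M_pos by (simp add: K_def algebra_simps)
  then show "K \<ge> 0" using M_pos by simp
qed

lemma A_le0: "t \<in> T0 \<Longrightarrow> norm (A t) \<le> M"
  using A_le by (simp add: ts_from_def)

lemma X_0: "X 0 = mat 1"
  unfolding X_def by (rule S0.transition_start[OF rd_continuous_ts_from[OF rd_A] A_le0])

lemma X_continuous: "continuous_on {0..} X"
  unfolding X_def by (rule S0.transition_continuous[OF rd_continuous_ts_from[OF rd_A] A_le0])

lemma X_delta_derivative:
  assumes "a \<in> T0" "t \<in> ts_from T a"
  shows "has_delta_derivative (ts_from T a) X (A t ** X t) t"
proof -
  have t: "t \<in> T0" "0 \<le> t" "a \<le> t" "0 \<le> a" using assms by (auto simp: ts_from_def)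
  have "has_delta_derivative (T0) X (A t ** X t) t"
    unfolding X_def by (rule S0.transition_delta_derivative[OF rd_continuous_ts_from[OF rd_A] A_le0 t(1)])
  then show ?thesis
  proof (rule S0.delta_derivative_subset)
    show "ts_from T a \<subseteq> T0" using t by (auto simp: ts_from_def)
    show "fwd_jump (ts_from T a) t = fwd_jump (T0) t" using t by (simp add: fwd_jump_ts_from)
  qed
qed

lemma X_vector_delta_derivative:
  assumes "a \<in> T0" "t \<in> ts_from T a"
  shows "has_delta_derivative (ts_from T a) (\<lambda>t. X t *v v) (A t *v (X t *v v)) t"
proof -
  interpret H: half_scale "ts_from T a" a by (rule half_scale_from[OF assms(1)])
  show ?thesis
    using H.delta_derivative_bounded_linear[OF assms(2) X_delta_derivative[OF assms]
        bounded_bilinear.bounded_linear_left[OF bounded_bilinear_matrix_vector_mult, of v]]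
    by (simp add: matrix_vector_mul_assoc)
qed

lemma A_vector_le: "t \<in> T \<Longrightarrow> norm (A t *v v) \<le> M * norm v"
  by (rule order_trans[OF norm_matrix_vector_le mult_right_mono[OF A_le norm_ge_zero]])

lemma X_growth:
  assumes "s \<in> T0" "t \<in> ts_from T s"
  shows "norm (X t *v v) \<le> exp (M * (t - s)) * norm (X s *v v)"
    and "exp (- K * (t - s)) * norm (X s *v v) \<le> norm (X t *v v)"
proof -
  interpret H: half_scale "ts_from T s" s by (rule half_scale_from[OF assms(1)])
  have tT: "r \<in> T" if "r \<in> ts_from T s" for r using that by (simp add: ts_from_def)
  note d = X_vector_delta_derivative[OF assms(1)]
  show "norm (X t *v v) \<le> exp (M * (t - s)) * norm (X s *v v)"
    using M_pos by (intro H.delta_gronwall[OF _ assms(2) d A_vector_le] H.delta_derivative_continuous[OF _ d] assms tT) auto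
  show "exp (- K * (t - s)) * norm (X s *v v) \<le> norm (X t *v v)"
    unfolding K_def
  proof (rule H.delta_lower_bound[OF _ R_ge assms(2) d A_vector_le[OF tT]])
    fix r assume r: "r \<in> ts_from T s"
    have "graininess (ts_from T s) r = graininess T r"
      using r by (intro graininess_ts_from) (auto simp: ts_from_def)
    then have "X (fwd_jump (ts_from T s) r) *v v = X r *v v + graininess T r *\<^sub>R (A r *v (X r *v v))"
      using H.delta_derivative_jump[OF r d[OF r]] by simp
    also have "\<dots> = (mat 1 + graininess T r *\<^sub>R A r) *v (X r *v v)"
      by (simp add: matrix_vector_mult_add_rdistrib scaleR_matrix_vector_assoc)
    finally show "norm (X r *v v) \<le> R * norm (X (fwd_jump (ts_from T s) r) *v v)"
      using regressive[OF tT[OF r]] by simp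
  qed (use M_pos in auto)
qed

text \<open>The lower growth bound from time 0 leaves no room for a kernel.\<close>

lemma X_invertible:
  assumes "t \<in> T0"
  shows "invertible (X t)"
proof -
  have "x = 0" if "X t *v x = 0" for x
    using X_growth(2)[of 0 t x] assms that S0.start_in by (auto simp: X_0 mult_le_0_iff)
  then show ?thesis using invertible_left_inverse matrix_left_invertible_ker by blast
qed

lemma X_inverse [simp]:
  assumes "t \<in> T0"
  shows "X t *v (matrix_inv (X t) *v v) = v" "matrix_inv (X t) *v (X t *v v) = v"
  using X_invertible[OF assms] by (simp_all add: matrix_vector_mul_assoc matrix_inverse_left matrix_inverse_right)

lemma flow_X: "s \<in> T0 \<Longrightarrow> flow t s *v (X s *v v) = X t *v v"
  by (simp add: flow_def matrix_vector_mul_assoc[symmetric])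

lemma flow_comp: "s \<in> T0 \<Longrightarrow> flow t s *v (flow s r *v v) = flow t r *v v"
  by (simp add: flow_def matrix_vector_mul_assoc[symmetric])

lemma flow_inverse: "s \<in> T0 \<Longrightarrow> t \<in> T0 \<Longrightarrow> flow s t *v (flow t s *v v) = v"
  by (simp add: flow_comp) (simp add: flow_def matrix_vector_mul_assoc[symmetric])

lemma flow_pos:
  assumes "s \<in> T0" "t \<in> T0" "norm v = 1"
  shows "0 < norm (flow t s *v v)"
  using flow_inverse[OF assms(1,2), of v] assms(3) by auto

lemma flow_bound:
  assumes s: "s \<in> T0" and t: "t \<in> T0"
  shows "norm (flow t s *v v) \<le> exp (K * \<bar>t - s\<bar>) * norm v"
proof -
  define w where "w = matrix_inv (X s) *v v"
  have v: "v = X s *v w" using s by (simp add: w_def)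
  show ?thesis unfolding v flow_X[OF s]
  proof (cases "s \<le> t")
    case True
    have "norm (X t *v w) \<le> exp (M * (t - s)) * norm (X s *v w)"
      using True t by (intro X_growth s) (auto simp: ts_from_def)
    also have "\<dots> \<le> exp (K * \<bar>t - s\<bar>) * norm (X s *v w)"
      using True K_ge by (intro mult_right_mono) (auto intro: mult_right_mono)
    finally show "norm (X t *v w) \<le> exp (K * \<bar>t - s\<bar>) * norm (X s *v w)" .
  next
    case False
    then have "exp (- K * (s - t)) * norm (X t *v w) \<le> norm (X s *v w)"
      using s by (intro X_growth t) (auto simp: ts_from_def)
    then have "exp (K * (s - t)) * (exp (- K * (s - t)) * norm (X t *v w)) \<le> exp (K * (s - t)) * norm (X s *v w)"
      by (intro mult_left_mono) auto
    then show "norm (X t *v w) \<le> exp (K * \<bar>t - s\<bar>) * norm (X s *v w)"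
      using False by (simp add: mult.assoc[symmetric] exp_add[symmetric])
  qed
qed

lemma fundamental_matrix_eq_flow:
  assumes s: "s \<in> T0" and t: "t \<in> ts_from T s"
  shows "fundamental_matrix T A t s = flow t s"
proof -
  interpret H: half_scale "ts_from T s" s by (rule half_scale_from[OF s])
  have start: "flow s s = mat 1" using X_invertible[OF s] by (simp add: flow_def matrix_inverse_right)
  have der: "has_delta_derivative (ts_from T s) (\<lambda>t. flow t s) (A \<tau> ** flow \<tau> s) \<tau>" if \<tau>: "\<tau> \<in> ts_from T s" for \<tau>
    using H.delta_derivative_bounded_linear[OF \<tau> X_delta_derivative[OF s \<tau>]
        bounded_bilinear.bounded_linear_left[OF bounded_bilinear_matrix_mult, of "matrix_inv (X s)"]]
    by (simp add: flow_def matrix_mul_assoc)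
  obtain C where C: "C > 0" "\<And>(A :: real^'n^'n) (Z :: real^'n^'n). norm A \<le> M \<Longrightarrow> norm (A ** Z) \<le> C * norm Z"
    using matrix_mult_bound by blast
  have unique: "Z t = flow t s" if "Z s = mat 1"
    and Z: "\<And>\<tau>. \<tau> \<in> ts_from T s \<Longrightarrow> has_delta_derivative (ts_from T s) Z (A \<tau> ** Z \<tau>) \<tau>" for Z
  proof (rule H.delta_unique[OF t _ Z der])
    show "norm (A \<tau> ** Z \<tau> - A \<tau> ** flow \<tau> s) \<le> C * norm (Z \<tau> - flow \<tau> s)" if "\<tau> \<in> ts_from T s" for \<tau>
      using C(2)[of "A \<tau>" "Z \<tau> - flow \<tau> s"] A_le[of \<tau>] that
      by (simp add: ts_from_def bounded_bilinear.diff_right[OF bounded_bilinear_matrix_mult])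
  qed (use C that start in auto)
  show ?thesis unfolding fundamental_matrix_def
  proof (rule the_equality)
    show "\<exists>Z. Z s = mat 1 \<and> (\<forall>\<tau>\<in>ts_from T s. has_delta_derivative (ts_from T s) Z (A \<tau> ** Z \<tau>) \<tau>) \<and> flow t s = Z t"
      using start der by (intro exI[of _ "\<lambda>t. flow t s"]) auto
  qed (use unique in blast)
qed

text \<open>The next partition point is the first point of the scale at distance at least
  \<open>H\<close>. A block may be far longer than \<open>H\<close>, but then only through one gap
  at its end, as no point of the scale lies between \<open>p k + H\<close> and
  \<open>p (Suc k)\<close>.\<close>

lemma partition_exists:
  assumes a: "a \<in> T0" and H: "H > 0"
  obtains p where "p 0 = a" "\<And>k. p k \<in> T0" "\<And>k. p k + H \<le> p (Suc k)"
    "\<And>k s. s \<in> T \<Longrightarrow> s < p (Suc k) \<Longrightarrow> s < p k + H"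
proof -
  let ?nx = "\<lambda>u. Inf (T \<inter> {u + H..})"
  have nx: "?nx u \<in> T \<inter> {u + H..}" for u
  proof (rule closed_contains_Inf)
    obtain s where "s \<in> T0" "u + H < s" using S0.exists_above by blast
    then show "T \<inter> {u + H..} \<noteq> {}" by (auto simp: ts_from_def)
    show "closed (T \<inter> {u + H..})" using time_scale by (auto simp: time_scale_def)
  qed auto
  have nx_le: "s < u + H" if "s \<in> T" "s < ?nx u" for s u
  proof (rule ccontr)
    assume "\<not> s < u + H"
    then have "?nx u \<le> s" using that by (intro cInf_lower) auto
    with that show False by simp
  qed
  define p where "p = rec_nat a (\<lambda>_ u. ?nx u)"
  have p: "p 0 = a" "p (Suc k) = ?nx (p k)" for k by (simp_all add: p_def)
  have pT: "p k \<in> T0" for k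
  proof (induction k)
    case (Suc k)
    then show ?case using nx[of "p k"] H by (auto simp: p ts_from_def)
  qed (use a p in simp)
  show ?thesis using nx nx_le pT by (intro that[of p]) (auto simp: p)
qed

text \<open>
  The perturbed orbit is \<open>X\<close> applied to a curve that, at the beginning of each block, moves by a small
  vector \<open>u k\<close> pointing to the direction of largest growth of the block. The sign of \<open>u k\<close> is chosen
  such that the image of the sum is at least as long as the image of \<open>u k\<close>.
\<close>

lemma growth_sequence:
  assumes p: "\<And>k. p k \<in> T0" and v: "\<And>k. norm (v k) = 1" and \<kappa>: "\<kappa> \<ge> 0"
  obtains W :: "nat \<Rightarrow> real^'n" where "norm (X (p 0) *v W 0) = 1"
    "\<And>k. norm (X (p k) *v (W (Suc k) - W k)) = \<kappa> * norm (X (p k) *v W k)"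
    "\<And>k. norm (X (p (Suc k)) *v W (Suc k)) \<ge> \<kappa> * norm (flow (p (Suc k)) (p k) *v v k) * norm (X (p k) *v W k)"
proof -
  let ?P = "\<lambda>k w w'. norm (X (p k) *v (w' - w)) = \<kappa> * norm (X (p k) *v w) \<and>
     norm (X (p (Suc k)) *v w') \<ge> \<kappa> * norm (flow (p (Suc k)) (p k) *v v k) * norm (X (p k) *v w)"
  obtain e :: "real^'n" where e: "norm e = 1" using vector_choose_size[of 1] by auto
  let ?w0 = "matrix_inv (X (p 0)) *v e"
  have step: "\<exists>w'. ?P k w w'" for k w
  proof -
    \<comment> \<open>\<open>d\<close> is the displacement seen at time \<open>p k\<close>, and
      \<open>u\<close> the same displacement in coordinates of time 0, in which the unperturbed
      orbits are constant.\<close>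
    define d where "d = (\<kappa> * norm (X (p k) *v w)) *\<^sub>R v k"
    define u where "u = matrix_inv (X (p k)) *v d"
    have Xu: "X (p k) *v u = d" using p by (simp add: u_def)
    have nd: "norm d = \<kappa> * norm (X (p k) *v w)" using v \<kappa> by (simp add: d_def)
    have Xs: "X (p (Suc k)) *v u = flow (p (Suc k)) (p k) *v d" using flow_X[OF p, of "p (Suc k)" k u] Xu by simp
    then have ns: "norm (X (p (Suc k)) *v u) = \<kappa> * norm (flow (p (Suc k)) (p k) *v v k) * norm (X (p k) *v w)"
      using \<kappa> by (simp add: d_def matrix_vector_mult_scaleR)
    have two: "2 * norm b \<le> norm (c + b) + norm (c - b)" for b c :: "real^'n"
      using norm_triangle_ineq4[of "c + b" "c - b"] by (simp add: scaleR_2[symmetric])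
    have "norm (X (p (Suc k)) *v (w + u)) \<ge> norm (X (p (Suc k)) *v u) \<or>
        norm (X (p (Suc k)) *v (w - u)) \<ge> norm (X (p (Suc k)) *v u)"
      using two[of "X (p (Suc k)) *v u" "X (p (Suc k)) *v w"]
      by (auto simp: matrix_vector_mult_diff_distrib matrix_vector_right_distrib)
    moreover have "norm (X (p k) *v (w + u - w)) = norm d" "norm (X (p k) *v (w - u - w)) = norm d"
      using Xu by (auto simp: bounded_bilinear.minus_right[OF bounded_bilinear_matrix_vector_mult])
    ultimately show ?thesis using nd ns by metis
  qed
  obtain W where W: "W 0 = ?w0" "\<And>k. ?P k (W k) (W (Suc k))"
    using dependent_nat_choice[of "\<lambda>n w. n = 0 \<longrightarrow> w = ?w0" ?P] step by (metis nat.distinct(1))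
  have "norm (X (p 0) *v W 0) = 1" using W(1) p e by simp
  then show ?thesis using W(2) by (intro that[of W]) auto
qed

text \<open>The curve y = X q is turned into an orbit of a perturbed system. Its coordinate q
  follows the stairs through the \<open>W k\<close>, times exp(\<delta> (t - a)); the product rule
  leaves a remainder \<open>g\<close>, which a rank-one matrix of norm |g| / |y| absorbs. Everything
  reduces to |g| \<le> \<omega> |y|, where one half of \<omega> is reserved for the exponential
  factor and the other for the turns.\<close>

lemma block_growth_bound:
  assumes a: "a \<in> T0" and p0: "p 0 = a" and p: "\<And>k. p k \<in> T0"
    and pstep: "\<And>k. p k + 1 \<le> p (Suc k)" and v: "\<And>k. norm (v k) = 1"
    and \<omega>: "\<omega> > 0" and \<delta>: "0 \<le> \<delta>" "\<delta> \<le> \<omega> / 2"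
    and \<delta>_growth: "\<And>t. t \<in> ts_from T a \<Longrightarrow> exp (\<delta> * graininess T t) \<le> 2"
      "\<And>t. t \<in> ts_from T a \<Longrightarrow> (1 + M * graininess T t) * (exp (\<delta> * graininess T t) - 1) \<le> graininess T t * \<omega> / 2"
    and \<kappa>: "0 < \<kappa>" "\<kappa> \<le> 1 / 2" "16 * (1 + M) * \<kappa> * exp (2 * K) \<le> \<omega>"
    and stable: "\<And>B y b. continuous_on {a..} B \<Longrightarrow> (\<And>t. t \<ge> a \<Longrightarrow> norm (B t) \<le> \<omega>) \<Longrightarrow>
      (\<And>t. t \<in> ts_from T a \<Longrightarrow> has_delta_derivative (ts_from T a) y ((A t + B t) *v y t) t) \<Longrightarrow>
      b \<in> ts_from T a \<Longrightarrow> norm (y b) \<le> G * norm (y a)"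
  shows "exp (\<delta> * (p m - a)) * (\<kappa> ^ m * (\<Prod>k<m. norm (flow (p (Suc k)) (p k) *v v k))) \<le> G"
proof -
  interpret H: half_scale "ts_from T a" a by (rule half_scale_from[OF a])
  interpret spaced_steps p using pstep by unfold_locales
  have inT0: "t \<in> T0" if "t \<in> ts_from T a" for t using that a by (auto simp: ts_from_def)
  have inT: "t \<in> T" if "t \<in> ts_from T a" for t using that by (auto simp: ts_from_def)
  have gr: "graininess (ts_from T a) t = graininess T t" if "t \<in> ts_from T a" for t
    using that by (intro graininess_ts_from) (auto simp: ts_from_def)
  have pS: "p k \<in> ts_from T a" for k
    using p[of k] step_mono[of 0 k] p0 by (auto simp: ts_from_def)
  obtain W where W0: "norm (X (p 0) *v W 0) = 1"
    and Wd: "\<And>k. norm (X (p k) *v (W (Suc k) - W k)) = \<kappa> * norm (X (p k) *v W k)"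
    and Wg: "\<And>k. norm (X (p (Suc k)) *v W (Suc k)) \<ge> \<kappa> * norm (flow (p (Suc k)) (p k) *v v k) * norm (X (p k) *v W k)"
    using growth_sequence[of p v \<kappa>] p v \<kappa>(1) by (metis less_imp_le)
  define u where "u k = W (Suc k) - W k" for k
  have W_sum: "W 0 + (\<Sum>j<k. u j) = W k" for k
    by (induction k) (auto simp: u_def algebra_simps)
  have flow_pos: "norm (flow (p (Suc k)) (p k) *v v k) > 0" for k by (rule flow_pos[OF p p v])
  have growth: "norm (X (p m) *v W m) \<ge> \<kappa> ^ m * (\<Prod>k<m. norm (flow (p (Suc k)) (p k) *v v k))" for m
  proof (induction m)
    case 0 then show ?case using W0 by simp
  next
    case (Suc m)
    have "\<kappa> ^ Suc m * (\<Prod>k<Suc m. norm (flow (p (Suc k)) (p k) *v v k)) =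
        (\<kappa> * norm (flow (p (Suc m)) (p m) *v v m)) * (\<kappa> ^ m * (\<Prod>k<m. norm (flow (p (Suc k)) (p k) *v v k)))"
      by simp
    also have "\<dots> \<le> (\<kappa> * norm (flow (p (Suc m)) (p m) *v v m)) * norm (X (p m) *v W m)"
      using Suc \<kappa> by (intro mult_left_mono) auto
    also have "\<dots> \<le> norm (X (p (Suc m)) *v W (Suc m))" using Wg[of m] .
    finally show ?case .
  qed
  have zpos: "norm (X (p k) *v W k) > 0" for k
    using growth[of k] \<kappa>(1) flow_pos by (intro less_le_trans[OF _ growth] mult_pos_pos prod_pos) auto
  define w where "w t = W 0 + stairs smooth_step p u t" for t
  define w' where "w' = stairs smooth_step_deriv p u"
  have w_block: "w t = W k + smooth_step (t - p k) *\<^sub>R u k" if "p k \<le> t" "t \<le> p (Suc k)" for t k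
    using stairs_block(1)[OF that, of u] W_sum[of k] by (simp add: w_def add.assoc)
  have w_at: "w (p k) = W k" for k using w_block[of k "p k"] pstep[of k] by simp
  have w_der: "(w has_vector_derivative w' t) (at t)" for t
    unfolding w_def[abs_def] w'_def using has_vector_derivative_add[OF has_vector_derivative_const stairs_has_derivative] by simp
  have w'_cont: "isCont w' t" for t unfolding w'_def by (rule stairs_deriv_continuous)
  \<comment> \<open>As \<kappa> is at most 1/2, a turn removes at most half of the length, so the
    orbit never vanishes and may be divided by.\<close>
  have Xw_lower: "norm (X (p k) *v w t) \<ge> norm (X (p k) *v W k) / 2" if "p k \<le> t" "t \<le> p (Suc k)" for t k
  proof -
    let ?\<theta> = "smooth_step (t - p k)"
    have "X (p k) *v w t = X (p k) *v W k + ?\<theta> *\<^sub>R (X (p k) *v u k)"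
      by (simp add: w_block[OF that] matrix_vector_right_distrib matrix_vector_mult_scaleR)
    then have "norm (X (p k) *v w t) \<ge> norm (X (p k) *v W k) - ?\<theta> * norm (X (p k) *v u k)"
      using norm_diff_ineq[of "X (p k) *v W k" "?\<theta> *\<^sub>R (X (p k) *v u k)"] smooth_step_nonneg[of "t - p k"] by simp
    moreover have "norm (X (p k) *v u k) \<le> (1/2) * norm (X (p k) *v W k)"
      unfolding u_def Wd using \<kappa>(2) by (intro mult_right_mono) auto
    then have "?\<theta> * norm (X (p k) *v u k) \<le> 1 * ((1/2) * norm (X (p k) *v W k))"
      by (intro mult_mono smooth_step_le_1 smooth_step_nonneg) auto
    ultimately show ?thesis by simp
  qed
  have w_nz: "w t \<noteq> 0" if t: "t \<ge> a" for t
  proof -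
    obtain k where k: "p k \<le> t" "t < p (Suc k)" using block_exists[of t] t p0 by auto
    show ?thesis using Xw_lower[OF k(1) less_imp_le[OF k(2)]] zpos[of k] by auto
  qed
  \<comment> \<open>The factor 2 makes up for the lost half of the length. One exp(K) carries
    \<open>u k\<close> from \<open>p k\<close> to t, the other compares the orbit at
    \<open>p k\<close> with the orbit at t, each over at most one unit of time.\<close>
  define c where "c = 2 * \<kappa> * exp (2 * K)"
  have c_pos: "c > 0" using \<kappa> by (simp add: c_def)
  have Xu_small: "norm (X t *v u k) \<le> c * norm (X t *v w t)"
    if t: "t \<in> ts_from T a" "p k \<le> t" "t \<le> p (Suc k)" "t \<le> p k + 1" for t k
  proof -
    have K1: "exp (K * \<bar>t - p k\<bar>) \<le> exp K" "exp (K * \<bar>p k - t\<bar>) \<le> exp K"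
      using t K_ge mult_left_mono[of "t - p k" 1 K] by auto
    have "norm (X t *v u k) = norm (flow t (p k) *v (X (p k) *v u k))" using flow_X[OF p] by simp
    also have "\<dots> \<le> exp (K * \<bar>t - p k\<bar>) * norm (X (p k) *v u k)" by (intro flow_bound p inT0 t)
    also have "\<dots> \<le> exp K * norm (X (p k) *v u k)" using K1 by (intro mult_right_mono) auto
    also have "\<dots> = exp K * \<kappa> * norm (X (p k) *v W k)" using Wd by (simp add: u_def)
    also have "\<dots> \<le> exp K * \<kappa> * (2 * norm (X (p k) *v w t))"
      using Xw_lower[OF t(2,3)] \<kappa> by (intro mult_left_mono) auto
    also have "norm (X (p k) *v w t) = norm (flow (p k) t *v (X t *v w t))" using flow_X[OF inT0[OF t(1)]] by simp
    also have "exp K * \<kappa> * (2 * norm (flow (p k) t *v (X t *v w t))) \<le> exp K * \<kappa> * (2 * (exp (K * \<bar>p k - t\<bar>) * norm (X t *v w t)))"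
      using \<kappa> flow_bound[OF inT0[OF t(1)] p] by (intro mult_left_mono) auto
    also have "\<dots> \<le> exp K * \<kappa> * (2 * (exp K * norm (X t *v w t)))"
      using \<kappa> K1 by (intro mult_left_mono mult_right_mono) auto
    also have "\<dots> = c * norm (X t *v w t)" by (simp add: c_def exp_double power2_eq_square)
    finally show ?thesis .
  qed
  define E where "E t = exp (\<delta> * (t - a))" for t
  define q where "q t = E t *\<^sub>R w t" for t
  define q' where "q' t = E t *\<^sub>R w' t + (\<delta> * E t) *\<^sub>R w t" for t
  have E_der: "(E has_real_derivative \<delta> * E t) (at t)" for t
    unfolding E_def[abs_def] by (rule derivative_eq_intros refl | simp)+
  have q_der: "(q has_vector_derivative q' t) (at t)" for t
    unfolding q_def[abs_def] q'_def by (rule has_vector_derivative_scaleR[OF E_der w_der])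
  have E_cont: "isCont E t" for t using E_der DERIV_isCont by blast
  have w_cont: "isCont w t" for t using w_der has_vector_derivative_continuous by blast
  have q'_cont: "isCont q' t" for t
    unfolding q'_def[abs_def] by (intro continuous_intros E_cont w_cont w'_cont)
  define dq where "dq = H.delta_quotient q q'"
  define y where "y t = X t *v q t" for t
  \<comment> \<open>This is \<open>X\<close> after the jump applied to the delta derivative of
    \<open>q\<close>; at right-dense points the second summand vanishes.\<close>
  define g where "g t = X t *v dq t + (graininess (ts_from T a) t *\<^sub>R A t) *v (X t *v dq t)" for t
  define B where "B t = outer (g t) ((1 / (norm (y t))\<^sup>2) *\<^sub>R y t)" for t
  have y_nz: "y t \<noteq> 0" if t: "t \<in> ts_from T a" for t
  proof
    assume "y t = 0"
    then have "matrix_inv (X t) *v (X t *v q t) = 0" by (simp add: y_def)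
    then have "q t = 0" using X_inverse(2)[OF inT0[OF t]] by simp
    then show False using w_nz[of t] t by (simp add: q_def E_def ts_from_def)
  qed
  have y_der: "has_delta_derivative (ts_from T a) y (A t *v y t + g t) t" if t: "t \<in> ts_from T a" for t
  proof -
    have "has_delta_derivative (ts_from T a) y ((A t ** X t) *v q t + X (fwd_jump (ts_from T a) t) *v dq t) t"
      unfolding y_def[abs_def] dq_def
      by (intro H.delta_derivative_matrix_vector X_delta_derivative H.delta_quotient_derivative t a q_der)
    moreover have "X (fwd_jump (ts_from T a) t) = X t + graininess (ts_from T a) t *\<^sub>R (A t ** X t)"
      by (rule H.delta_derivative_jump[OF t X_delta_derivative[OF a t]])
    then have "X (fwd_jump (ts_from T a) t) *v dq t = g t"
      by (simp add: g_def matrix_vector_mult_add_rdistrib matrix_vector_mul_assoc scalar_matrix_assoc)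
    ultimately show ?thesis by (simp add: y_def matrix_vector_mul_assoc)
  qed
  have By: "B t *v y t = g t" if "t \<in> ts_from T a" for t
    using y_nz[OF that] by (simp add: B_def outer_mult power2_norm_eq_inner)
  have g_le: "norm (g t) \<le> \<omega> * norm (y t)" if t: "t \<in> ts_from T a" for t
  proof -
    obtain k where k: "p k \<le> t" "t < p (Suc k)" using block_exists[of t] t p0 by (auto simp: ts_from_def)
    let ?N = "norm (X t *v w t)"
    have yN: "norm (y t) = E t * ?N" by (simp add: y_def q_def matrix_vector_mult_scaleR E_def)
    have Epos: "E t > 0" by (simp add: E_def)
    show ?thesis
    proof (cases "fwd_jump (ts_from T a) t = t")
      case True
      have der: "smooth_step_deriv (t - p k) * norm (X t *v u k) \<le> 2 * (c * ?N)"
      proof (cases "t \<le> p k + 1")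
        case True
        then show ?thesis using Xu_small[OF t k(1) less_imp_le[OF k(2)]] smooth_step_deriv_le smooth_step_deriv_nonneg
          by (intro mult_mono) auto
      qed (use c_pos in simp)
      have "g t = X t *v q' t" using True by (simp add: g_def dq_def H.delta_quotient_def graininess_def)
      also have "\<dots> = E t *\<^sub>R (smooth_step_deriv (t - p k) *\<^sub>R (X t *v u k) + \<delta> *\<^sub>R (X t *v w t))"
        using stairs_block(2)[OF k(1) less_imp_le[OF k(2)], of u]
        by (simp add: q'_def w'_def matrix_vector_right_distrib matrix_vector_mult_scaleR scaleR_right_distrib mult.commute)
      also have "norm \<dots> \<le> E t * (smooth_step_deriv (t - p k) * norm (X t *v u k) + \<delta> * ?N)"
        using Epos smooth_step_deriv_nonneg[of "t - p k"] \<delta>(1)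
          norm_triangle_ineq[of "smooth_step_deriv (t - p k) *\<^sub>R (X t *v u k)" "\<delta> *\<^sub>R (X t *v w t)"] by simp
      also have "\<dots> \<le> E t * (2 * (c * ?N) + \<omega> / 2 * ?N)"
        using Epos der \<delta> by (intro mult_left_mono add_mono mult_right_mono) auto
      also have "\<dots> = (2 * c + \<omega> / 2) * norm (y t)" by (simp add: yN algebra_simps)
      also have "\<dots> \<le> \<omega> * norm (y t)"
      proof (rule mult_right_mono)
        have "0 < M * (\<kappa> * exp (2 * K))" "0 < \<kappa> * exp (2 * K)" using M_pos \<kappa> by auto
        then show "2 * c + \<omega> / 2 \<le> \<omega>" using \<kappa>(3) by (simp add: c_def algebra_simps)
      qed simp
      finally show ?thesis .
    next
      case False
      let ?\<sigma> = "fwd_jump (ts_from T a) t"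
      define \<mu> where "\<mu> = graininess T t"
      have \<mu>: "\<mu> > 0" "?\<sigma> = t + \<mu>" using False H.fwd_jump_ge[of t] gr[OF t] by (auto simp: \<mu>_def graininess_def)
      have \<sigma>p: "?\<sigma> \<le> p (Suc k)" using H.fwd_jump_le[OF pS k(2)] .
      \<comment> \<open>The increment of the step across a gap is at most 2 \<mu>, which settles the
        summand 1 of the factor 1 + M \<mu>, and at most 1, which settles the summand M \<mu>
        however long the gap is.\<close>
      define \<Delta> where "\<Delta> = smooth_step (?\<sigma> - p k) - smooth_step (t - p k)"
      have \<Delta>: "0 \<le> \<Delta>" "\<Delta> \<le> 1" "\<Delta> \<le> 2 * \<mu>"
        using smooth_step_mono[of "t - p k" "?\<sigma> - p k"] smooth_step_le_1[of "?\<sigma> - p k"] smooth_step_nonneg[of "t - p k"]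
          smooth_step_lipschitz[of "t - p k" "?\<sigma> - p k"] \<mu> by (auto simp: \<Delta>_def)
      \<comment> \<open>Only the left end t of the gap has to lie within one unit after
        \<open>p k\<close>, however far the gap reaches; for a later t the turn is already
        complete.\<close>
      have small: "\<Delta> * norm (X t *v u k) \<le> \<Delta> * (c * ?N)"
      proof (cases "t \<le> p k + 1")
        case True
        then show ?thesis using Xu_small[OF t k(1) less_imp_le[OF k(2)]] \<Delta> by (intro mult_left_mono) auto
      next
        case False
        then have "\<Delta> = 0" using \<mu> by (simp add: \<Delta>_def)
        then show ?thesis by simp
      qed
      have "q ?\<sigma> - q t = E t *\<^sub>R ((exp (\<delta> * \<mu>) * \<Delta>) *\<^sub>R u k + (exp (\<delta> * \<mu>) - 1) *\<^sub>R w t)"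
      proof -
        have E\<sigma>: "E ?\<sigma> = E t * exp (\<delta> * \<mu>)" by (simp add: E_def \<mu> exp_add[symmetric] algebra_simps)
        have "w ?\<sigma> = w t + \<Delta> *\<^sub>R u k"
          using w_block[OF k(1) less_imp_le[OF k(2)]] w_block[of k ?\<sigma>] \<sigma>p k \<mu> by (simp add: \<Delta>_def algebra_simps)
        then show ?thesis by (simp add: q_def E\<sigma> algebra_simps)
      qed
      then have Xdq: "X t *v dq t = (E t / \<mu>) *\<^sub>R ((exp (\<delta> * \<mu>) * \<Delta>) *\<^sub>R (X t *v u k) + (exp (\<delta> * \<mu>) - 1) *\<^sub>R (X t *v w t))"
        using False gr[OF t]
        by (simp add: dq_def H.delta_quotient_def \<mu>_def matrix_vector_right_distrib matrix_vector_mult_scaleR scaleR_right_distrib)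
      have e1: "exp (\<delta> * \<mu>) \<ge> 1" using \<delta> \<mu> by simp
      have "norm (X t *v dq t) \<le> (E t / \<mu>) * (exp (\<delta> * \<mu>) * (\<Delta> * norm (X t *v u k)) + (exp (\<delta> * \<mu>) - 1) * ?N)"
        unfolding Xdq using Epos \<mu> \<Delta> e1
          norm_triangle_ineq[of "(exp (\<delta> * \<mu>) * \<Delta>) *\<^sub>R (X t *v u k)" "(exp (\<delta> * \<mu>) - 1) *\<^sub>R (X t *v w t)"]
        by (simp add: mult_left_mono divide_right_mono mult.assoc)
      also have "\<dots> \<le> (E t / \<mu>) * (2 * (\<Delta> * (c * ?N)) + (exp (\<delta> * \<mu>) - 1) * ?N)"
      proof (intro mult_left_mono add_right_mono)
        show "exp (\<delta> * \<mu>) * (\<Delta> * norm (X t *v u k)) \<le> 2 * (\<Delta> * (c * ?N))"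
          by (rule mult_mono) (use \<delta>_growth(1)[OF t] small \<Delta> in \<open>auto simp: \<mu>_def\<close>)
      qed (use Epos \<mu> in auto)
      finally have Xdq_le: "norm (X t *v dq t) \<le> (E t / \<mu>) * (2 * (\<Delta> * (c * ?N)) + (exp (\<delta> * \<mu>) - 1) * ?N)" .
      have "norm (g t) \<le> norm (X t *v dq t) + norm ((\<mu> *\<^sub>R A t) *v (X t *v dq t))"
        unfolding g_def gr[OF t] \<mu>_def by (rule norm_triangle_ineq)
      also have "norm ((\<mu> *\<^sub>R A t) *v (X t *v dq t)) = \<mu> * norm (A t *v (X t *v dq t))"
        using \<mu> by (simp add: scaleR_matrix_vector_assoc[symmetric])
      also have "norm (X t *v dq t) + \<dots> \<le> norm (X t *v dq t) + \<mu> * (M * norm (X t *v dq t))"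
        using \<mu> by (intro add_left_mono mult_left_mono A_vector_le inT t) auto
      also have "\<dots> = (1 + M * \<mu>) * norm (X t *v dq t)" by (simp add: algebra_simps)
      also have "\<dots> \<le> (1 + M * \<mu>) * ((E t / \<mu>) * (2 * (\<Delta> * (c * ?N)) + (exp (\<delta> * \<mu>) - 1) * ?N))"
        using \<mu> M_pos by (intro mult_left_mono Xdq_le) auto
      also have "\<dots> = (E t * ?N / \<mu>) * (2 * c * ((1 + M * \<mu>) * \<Delta>) + (1 + M * \<mu>) * (exp (\<delta> * \<mu>) - 1))"
      proof -
        have "r * ((E t / \<mu>) * (2 * (\<Delta> * (c * ?N)) + x * ?N)) = (E t * ?N / \<mu>) * (2 * c * (r * \<Delta>) + r * x)" for r x
          by (simp add: divide_inverse algebra_simps)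
        then show ?thesis .
      qed
      also have "\<dots> \<le> (E t * ?N / \<mu>) * (2 * c * (2 * (1 + M) * \<mu>) + \<mu> * \<omega> / 2)"
      proof (intro mult_left_mono add_mono)
        have "M * \<mu> * \<Delta> \<le> M * \<mu> * 1" using M_pos \<mu> \<Delta> by (intro mult_left_mono) auto
        moreover have "0 < M * \<mu>" using M_pos \<mu> by simp
        ultimately have "\<Delta> + M * \<mu> * \<Delta> \<le> 2 * \<mu> + 2 * (M * \<mu>)" using \<Delta>(3) by linarith
        then show "(1 + M * \<mu>) * \<Delta> \<le> 2 * (1 + M) * \<mu>" by (simp add: algebra_simps)
        show "(1 + M * \<mu>) * (exp (\<delta> * \<mu>) - 1) \<le> \<mu> * \<omega> / 2" using \<delta>_growth(2)[OF t] by (simp add: \<mu>_def)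
      qed (use c_pos Epos \<mu> in auto)
      \<comment> \<open>With c = 2 \<kappa> exp(2K) the first term is 8 (1 + M) \<kappa> exp(2K),
        which must not exceed \<omega> / 2: the origin of the 16 in the condition on
        \<kappa>.\<close>
      also have "\<dots> = (4 * c * (1 + M) + \<omega> / 2) * norm (y t)"
        using \<mu> unfolding yN by (simp add: field_simps)
      also have "\<dots> \<le> \<omega> * norm (y t)"
        using \<kappa>(3) by (intro mult_right_mono) (auto simp: c_def algebra_simps)
      finally show ?thesis .
    qed
  qed
  have B_le: "norm (B t) \<le> \<omega>" if t: "t \<in> ts_from T a" for t
  proof -
    have "norm (B t) = norm (g t) * (1 / norm (y t))"
      using y_nz[OF t] by (simp add: B_def norm_outer power2_eq_square)
    also have "\<dots> \<le> (\<omega> * norm (y t)) * (1 / norm (y t))" using g_le[OF t] by (intro mult_right_mono) auto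
    also have "\<dots> = \<omega>" using y_nz[OF t] by simp
    finally show ?thesis .
  qed
  have X_rd: "rd_continuous (ts_from T a) X"
    using inT0 S0.S_subset by (intro continuous_imp_rd_continuous continuous_on_subset[OF X_continuous]) blast
  have g_rd: "rd_continuous (ts_from T a) g"
    unfolding g_def[abs_def] dq_def
    by (intro rd_continuous_add rd_continuous_compose2[OF bounded_bilinear_matrix_vector_mult]
        rd_continuous_compose2[OF bounded_bilinear_scaleR] X_rd H.rd_continuous_delta_quotient q_der q'_cont
        H.rd_continuous_graininess rd_continuous_ts_from[OF rd_A])
  have y_cont: "continuous_on (ts_from T a) y"
    unfolding continuous_on_def using H.delta_derivative_continuous[OF _ y_der] by blast
  have B_rd: "rd_continuous (ts_from T a) B"
    unfolding B_def[abs_def]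
    using y_nz by (intro rd_continuous_compose2[OF bounded_bilinear_outer] g_rd continuous_imp_rd_continuous
        continuous_intros y_cont) auto
  have "norm (y (p m)) \<le> G * norm (y a)"
  proof (rule H.rd_continuous_perturbation_bound[OF rd_continuous_ts_from[OF rd_A] A_le[OF inT] stable B_rd B_le _ pS])
    show "has_delta_derivative (ts_from T a) y ((A t + B t) *v y t) t" if "t \<in> ts_from T a" for t
      using y_der[OF that] By[OF that] by (simp add: matrix_vector_mult_add_rdistrib)
  qed
  moreover have "norm (y a) = 1" using W0 w_at[of 0] p0 by (simp add: y_def q_def E_def)
  moreover have "norm (y (p m)) = exp (\<delta> * (p m - a)) * norm (X (p m) *v W m)"
    by (simp add: y_def q_def w_at matrix_vector_mult_scaleR E_def)
  ultimately have "exp (\<delta> * (p m - a)) * norm (X (p m) *v W m) \<le> G" by simp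
  moreover have "exp (\<delta> * (p m - a)) * (\<kappa> ^ m * (\<Prod>k<m. norm (flow (p (Suc k)) (p k) *v v k))) \<le>
      exp (\<delta> * (p m - a)) * norm (X (p m) *v W m)"
    by (intro mult_left_mono growth) auto
  ultimately show ?thesis by linarith
qed

end

section \<open>The central upper exponent\<close>

lemma vector_norm_equivalent:
  fixes N :: "real^'n \<Rightarrow> real"
  assumes "vector_norm N"
  obtains c1 c2 where "c1 > 0" "c2 > 0" "\<And>x. c1 * norm x \<le> N x" "\<And>x. N x \<le> c2 * norm x"
proof -
  have N: "N x \<ge> 0" "N x = 0 \<longleftrightarrow> x = 0" "N (c *\<^sub>R x) = \<bar>c\<bar> * N x" "N (x + y) \<le> N x + N y" for x y c
    using assms by (auto simp: vector_norm_def)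
  have N_sum: "N (sum f F) \<le> (\<Sum>i\<in>F. N (f i))" if "finite F" for f and F :: "'n set"
    using that
  proof (induction F rule: finite_induct)
    case empty then show ?case using N(2)[of 0] by simp
  next
    case (insert i F) then show ?case using N(4)[of "f i" "sum f F"] by simp
  qed
  define c2 where "c2 = (\<Sum>i\<in>UNIV. N (axis i 1)) + 1"
  have c2: "c2 > 0" unfolding c2_def by (intro add_nonneg_pos sum_nonneg N) auto
  have upper: "N x \<le> c2 * norm x" for x
  proof -
    have "x = (\<Sum>i\<in>UNIV. x $ i *\<^sub>R axis i 1)"
      using basis_expansion[of x] by (simp add: scalar_mult_eq_scaleR)
    then have "N x \<le> (\<Sum>i\<in>UNIV. N (x $ i *\<^sub>R axis i 1))" using N_sum[of UNIV "\<lambda>i. x $ i *\<^sub>R axis i 1"] by simp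
    also have "\<dots> \<le> (\<Sum>i\<in>UNIV. norm x * N (axis i 1))"
      by (intro sum_mono) (simp add: N mult_right_mono component_le_norm_cart)
    also have "\<dots> \<le> c2 * norm x" by (simp add: c2_def sum_distrib_left[symmetric] algebra_simps)
    finally show ?thesis .
  qed
  have "\<bar>N x - N y\<bar> \<le> c2 * norm (x - y)" for x y
    using N(4)[of "x - y" y] N(4)[of "y - x" x] upper[of "x - y"] upper[of "y - x"] by (simp add: norm_minus_commute abs_le_iff)
  then have "c2-lipschitz_on UNIV N" using c2 by (intro lipschitz_onI) (auto simp: dist_norm)
  then have "continuous_on UNIV N" by (rule lipschitz_on_continuous_on)
  then have "continuous_on (sphere (0::real^'n) 1) N" by (rule continuous_on_subset) simp
  moreover have "compact (sphere (0::real^'n) 1)" "sphere (0::real^'n) 1 \<noteq> {}" by simp_all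
  ultimately obtain v where v: "v \<in> sphere 0 1" "\<And>x. x \<in> sphere 0 1 \<Longrightarrow> N v \<le> N x"
    by (meson continuous_attains_inf)
  have "N v > 0" using v N(1,2)[of v] by (auto simp: less_le)
  moreover have "N v * norm x \<le> N x" for x
  proof (cases "x = 0")
    case False
    have "N v \<le> N ((1 / norm x) *\<^sub>R x)" using False by (intro v) simp
    then show ?thesis using False by (simp add: N field_simps)
  qed (use N in simp)
  ultimately show ?thesis using c2 upper by (intro that[of "N v" c2]) auto
qed

lemma operator_norm_le:
  fixes N :: "real^'n \<Rightarrow> real" and P :: "real^'n^'n"
  assumes N: "vector_norm N" and c: "c1 > 0" "c2 > 0" "\<And>x. c1 * norm x \<le> N x" "\<And>x. N x \<le> c2 * norm x"
    and P: "\<And>x. norm (P *v x) \<le> b * norm x" and b: "b \<ge> 0"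
  shows "operator_norm N P \<le> c2 / c1 * b"
  unfolding operator_norm_def
proof (rule cSup_least)
  have "N 0 = 0" using N by (auto simp: vector_norm_def)
  then have "N (P *v 0) \<in> {N (P *v x) |x. N x \<le> 1}" by (intro CollectI exI[of _ 0]) auto
  then show "{N (P *v x) |x. N x \<le> 1} \<noteq> {}" by blast
  fix z assume "z \<in> {N (P *v x) |x. N x \<le> 1}"
  then obtain x where x: "z = N (P *v x)" "N x \<le> 1" by blast
  have "norm x \<le> 1 / c1" using c(3)[of x] x(2) c(1) by (simp add: field_simps)
  have "z \<le> c2 * norm (P *v x)" using c x by simp
  also have "\<dots> \<le> c2 * (b * (1 / c1))"
    using P[of x] c b mult_left_mono[OF \<open>norm x \<le> 1 / c1\<close> b] by (intro mult_left_mono) auto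
  finally show "z \<le> c2 / c1 * b" by (simp add: field_simps)
qed

section \<open>From bounds of the flow to bounds of the exponent\<close>

context regressive_system begin

text \<open>The integral is a definite description: \<open>P\<close> is one antiderivative of the
  integrand, and any other differs from it by a constant, by uniqueness with Lipschitz constant
  0.\<close>

lemma exponent_integral_eq:
  assumes der: "\<And>t. (P has_real_derivative P' t) (at t)"
    and u: "\<And>t. t \<in> T0 \<Longrightarrow> cylinder (graininess T t) (u t) = S0.delta_quotient P P' t"
    and s: "s \<in> T0" and t: "t \<in> T0"
  shows "exponent_integral T u s t = P t - P s"
proof -
  have derv: "(P has_vector_derivative P' t) (at t)" for t
    using der by (simp add: has_real_derivative_iff_has_vector_derivative)
  have dP: "has_delta_derivative (T0) P (cylinder (graininess T t) (u t)) t" if "t \<in> T0" for t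
    using S0.delta_quotient_derivative[OF derv that] u[OF that] by simp
  show ?thesis unfolding exponent_integral_def delta_integral_def
  proof (rule the_equality)
    show "\<exists>F. (\<forall>t\<in>T0. has_delta_derivative (T0) F (cylinder (graininess T t) (u t)) t) \<and> P t - P s = F t - F s"
      using dP by blast
    fix I assume "\<exists>F. (\<forall>t\<in>T0. has_delta_derivative (T0) F (cylinder (graininess T t) (u t)) t) \<and> I = F t - F s"
    then obtain F where F: "\<And>t. t \<in> T0 \<Longrightarrow> has_delta_derivative (T0) F (cylinder (graininess T t) (u t)) t"
      and I: "I = F t - F s" by blast
    have "F r = (F 0 - P 0) + P r" if "r \<in> T0" for r
      by (rule S0.delta_unique[OF that order_refl F, where z="\<lambda>r. (F 0 - P 0) + P r"])
        (auto simp: delta_derivative_add_const dP)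
    then show "I = P t - P s" using I s t by simp
  qed
qed

text \<open>The function u is the delta derivative of exp(P) divided by exp(P). Then 1 + \<mu> u is
  exp(P(\<sigma>(t)) - P(t)), the cylinder transform returns the delta derivative of
  \<open>P\<close>, and the generalized exponential is exp(P t - P s). Smoothness of
  \<open>P\<close> in real time makes u rd-continuous.\<close>

lemma central_upper_exponent_le:
  assumes N: "vector_norm N"
    and der: "\<And>t. (P has_real_derivative P' t) (at t)" and cont: "\<And>t. isCont P' t"
    and C: "C > 0" and flow_le: "\<And>s t v. s \<in> T0 \<Longrightarrow> t \<in> ts_from T s \<Longrightarrow>
      norm (flow t s *v v) \<le> C * exp (P t - P s) * norm v"
    and growth: "\<And>t. t \<in> T0 \<Longrightarrow> P t \<le> D + l * t"
  shows "central_upper_exponent N T A \<le> ereal l"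
proof -
  define E where "E t = exp (P t)" for t
  define E' where "E' t = exp (P t) * P' t" for t
  define u where "u t = S0.delta_quotient E E' t * exp (- P t)" for t
  have P_cont: "isCont P t" for t using der DERIV_isCont by blast
  have E_der: "(E has_vector_derivative E' t) (at t)" for t
    unfolding E_def[abs_def] E'_def has_real_derivative_iff_has_vector_derivative[symmetric]
    by (rule derivative_eq_intros der refl | simp)+
  have E'_cont: "isCont E' t" for t
    unfolding E'_def[abs_def] by (intro continuous_intros P_cont cont)
  have gr: "graininess (T0) t = graininess T t" "fwd_jump (T0) t = fwd_jump T t"
    if "t \<in> T0" for t using that by (auto simp: ts_from_def intro!: graininess_ts_from[unfolded ts_from_def] fwd_jump_ts_from[unfolded ts_from_def])
  have one_plus: "1 + graininess T t * u t = exp (P (fwd_jump T t) - P t)" if t: "t \<in> T0" for t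
  proof (cases "fwd_jump T t = t")
    case False
    then have "graininess T t \<noteq> 0" by (simp add: graininess_def)
    then show ?thesis using False gr[OF t]
      by (simp add: u_def S0.delta_quotient_def E_def exp_diff exp_minus field_simps)
  qed (simp add: graininess_def)
  have cyl: "cylinder (graininess T t) (u t) = S0.delta_quotient P P' t" if t: "t \<in> T0" for t
  proof (cases "fwd_jump T t = t")
    case True
    then show ?thesis using gr[OF t]
      by (simp add: cylinder_def graininess_def u_def S0.delta_quotient_def E'_def exp_minus)
  next
    case False
    then have "graininess T t \<noteq> 0" by (simp add: graininess_def)
    then show ?thesis using False gr[OF t] one_plus[OF t]
      by (simp add: cylinder_def S0.delta_quotient_def mult.commute)
  qed
  have ei: "exponent_integral T u s t = P t - P s" if "s \<in> T0" "t \<in> T0" for s t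
    by (rule exponent_integral_eq[OF der cyl]) (use that in auto)
  obtain c1 c2 where c: "c1 > 0" "c2 > 0" "\<And>x. c1 * norm x \<le> N x" "\<And>x. N x \<le> c2 * norm x"
    using vector_norm_equivalent[OF N] by blast
  have "upper_function N T A u"
    unfolding upper_function_def
  proof (intro conjI ballI exI[of _ "c2 / c1 * C"])
    show "rd_continuous (T0) u"
      unfolding u_def[abs_def]
      by (intro rd_continuous_compose2[OF bounded_bilinear_mult] S0.rd_continuous_delta_quotient E_der E'_cont
          continuous_imp_rd_continuous continuous_at_imp_continuous_on ballI continuous_intros P_cont)
    show "0 < 1 + graininess T t * u t" if "t \<in> T0" for t using one_plus[OF that] by simp
    show "0 < c2 / c1 * C" using c C by simp
    fix s t assume st: "s \<in> T0" "t \<in> ts_from T s"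
    then have t0: "t \<in> T0" by (auto simp: ts_from_def)
    have "operator_norm N (fundamental_matrix T A t s) \<le> c2 / c1 * (C * exp (P t - P s))"
      unfolding fundamental_matrix_eq_flow[OF st]
      by (intro operator_norm_le[OF N c] flow_le st) (use C in auto)
    then show "operator_norm N (fundamental_matrix T A t s) \<le> c2 / c1 * C * gen_exp T u t s"
      by (simp add: gen_exp_def ei st t0)
  qed
  then have "central_upper_exponent N T A \<le> Limsup (ts_at_top T) (\<lambda>t. ereal (1 / t * exponent_integral T u 0 t))"
    unfolding central_upper_exponent_def by (intro INF_lower) simp
  also have "\<dots> \<le> ereal l"
  proof (rule ereal_le_epsilon2)
    fix e :: real assume e: "e > 0"
    have "\<forall>\<^sub>F t in at_top. t \<in> T \<longrightarrow> 1 / t * exponent_integral T u 0 t \<le> l + e"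
      using eventually_gt_at_top[of "max 1 (\<bar>D - P 0\<bar> / e)"]
    proof eventually_elim
      case (elim t)
      show ?case
      proof
        assume "t \<in> T"
        then have t: "t \<in> T0" using elim by (simp add: ts_from_def)
        have "exponent_integral T u 0 t = P t - P 0" by (rule ei[OF S0.start_in t])
        also have "\<dots> \<le> (D - P 0) + l * t" using growth[OF t] by simp
        also have "\<dots> \<le> e * t + l * t"
        proof -
          have "\<bar>D - P 0\<bar> < e * t" using elim e by (simp add: field_simps)
          then show ?thesis by linarith
        qed
        finally show "1 / t * exponent_integral T u 0 t \<le> l + e" using elim by (simp add: field_simps)
      qed
    qed
    then show "Limsup (ts_at_top T) (\<lambda>t. ereal (1 / t * exponent_integral T u 0 t)) \<le> ereal l + ereal e"
      unfolding ts_at_top_def by (intro Limsup_bounded) (simp add: eventually_inf_principal)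
  qed
  finally show ?thesis .
qed

text \<open>
  Almost all of the interval between two partition points may be a gap, over which the flow grows without
  a bound depending only on \<open>H\<close>. Therefore \<open>P\<close> performs its \<open>k\<close>-th step within the last unit of time
  before \<open>p (k + 1)\<close>, so that a point of the scale strictly inside that step forces the block to be short.
\<close>

lemma central_upper_exponent_partition:
  assumes N: "vector_norm N" and a: "a \<in> T0" and H: "H \<ge> 1"
    and p0: "p 0 = a" and p: "\<And>k. p k \<in> T0" and pstep: "\<And>k. p k + H \<le> p (Suc k)"
    and pshort: "\<And>k s. s \<in> T \<Longrightarrow> s < p (Suc k) \<Longrightarrow> s < p k + H"
    and v: "\<And>k. norm (v k) = 1" "\<And>k x. norm (flow (p (Suc k)) (p k) *v x) \<le> norm (flow (p (Suc k)) (p k) *v v k) * norm x"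
    and L: "L \<ge> 0"
    and sum_le: "\<And>m. (\<Sum>k<m. ln (norm (flow (p (Suc k)) (p k) *v v k))) \<le> D - \<delta> * (p m - a) + real m * L"
  shows "central_upper_exponent N T A \<le> ereal (L / H - \<delta>)"
proof -
  define \<alpha> where "\<alpha> k = norm (flow (p (Suc k)) (p k) *v v k)" for k
  define c where "c k = ln (\<alpha> k)" for k
  define S where "S k = (\<Sum>j<k. c j)" for k
  define \<tau> where "\<tau> k = p (Suc k) - 1" for k
  interpret sp: spaced_steps p using pstep H by unfold_locales (meson add_left_mono order_trans)
  interpret st: spaced_steps \<tau> unfolding \<tau>_def using pstep H by unfold_locales (smt (verit))
  define P where "P = stairs smooth_step \<tau> c"
  define P' where "P' = stairs smooth_step_deriv \<tau> c"
  have der: "(P has_real_derivative P' t) (at t)" for t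
    unfolding P_def P'_def has_real_derivative_iff_has_vector_derivative by (rule st.stairs_has_derivative)
  have cont: "isCont P' t" for t unfolding P'_def by (rule st.stairs_deriv_continuous)
  have \<alpha>_upper: "\<alpha> k \<le> exp (K * (p (Suc k) - p k))" for k
    using flow_bound[OF p[of k] p[of "Suc k"], of "v k"] v(1)[of k] pstep[of k] H by (simp add: \<alpha>_def)
  have \<alpha>_lower: "1 \<le> exp (K * (p (Suc k) - p k)) * \<alpha> k" for k
  proof -
    have "flow (p k) (p (Suc k)) *v (flow (p (Suc k)) (p k) *v v k) = v k" by (rule flow_inverse[OF p p])
    then have "1 = norm (flow (p k) (p (Suc k)) *v (flow (p (Suc k)) (p k) *v v k))" using v by simp
    also have "\<dots> \<le> exp (K * \<bar>p k - p (Suc k)\<bar>) * \<alpha> k" unfolding \<alpha>_def by (rule flow_bound[OF p p])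
    finally show ?thesis using pstep[of k] H by simp
  qed
  have \<alpha>_pos: "\<alpha> k > 0" for k
    using \<alpha>_lower[of k] by (metis \<alpha>_def less_eq_real_def mult_zero_right norm_ge_zero not_one_le_zero)
  have exp_c: "exp (c k) = \<alpha> k" for k using \<alpha>_pos by (simp add: c_def)
  have c_abs: "\<bar>c k\<bar> \<le> K * (p (Suc k) - p k)" for k
  proof -
    have "exp (c k) \<le> exp (K * (p (Suc k) - p k))" using \<alpha>_upper exp_c by simp
    moreover have "exp 0 \<le> exp (K * (p (Suc k) - p k) + c k)" using \<alpha>_lower[of k] by (simp add: exp_add exp_c)
    ultimately have "c k \<le> K * (p (Suc k) - p k)" "0 \<le> K * (p (Suc k) - p k) + c k"
      by (simp_all only: exp_le_cancel_iff)
    then show ?thesis by linarith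
  qed
  \<comment> \<open>Times before \<open>a\<close> are counted to block 0; this is why
    \<open>a\<close> enters the distance bound below.\<close>
  define blk where "blk k t \<longleftrightarrow> (k = 0 \<or> p k \<le> t) \<and> t < p (Suc k)" for k t
  have blk_ex: "\<exists>k. blk k t" if "t \<in> T0" for t
  proof (cases "a \<le> t")
    case True
    then show ?thesis using sp.block_exists[of t] p0 by (auto simp: blk_def)
  next
    case False
    then have "blk 0 t" using pstep[of 0] p0 H by (simp add: blk_def)
    then show ?thesis by blast
  qed
  define D1 where "D1 = K * (H + 1)"
  have a0: "a \<ge> 0" using a by (simp add: ts_from_def)
  have dist_blk: "\<bar>t - p k\<bar> \<le> a + H" if "blk k t" "t \<in> T0" for k t
  proof -
    have tT: "t \<in> T" "t \<ge> 0" using that by (auto simp: ts_from_def)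
    have "t < p k + H" using pshort[OF tT(1)] that by (simp add: blk_def)
    moreover have "p k \<le> t + a" using that p0 tT(2) a0 by (auto simp: blk_def)
    ultimately show ?thesis using a0 H by (simp add: abs_le_iff)
  qed
  have P_blk: "\<bar>P t - S k\<bar> \<le> D1" if b: "blk k t" and t: "t \<in> T0" for k t
  proof (cases "t \<le> \<tau> k")
    case True
    have "P t = S k"
    proof (cases k)
      case 0
      then show ?thesis using True st.stairs_before[of t c] by (simp add: P_def S_def)
    next
      case (Suc j)
      then have "\<tau> j + 1 \<le> t" using b by (simp add: \<tau>_def blk_def)
      then show ?thesis using st.stairs_block(1)[of j t c] True Suc by (simp add: P_def S_def)
    qed
    then show ?thesis using K_ge H by (simp add: D1_def)
  next
    case False
    have tT: "t \<in> T" using t by (simp add: ts_from_def)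
    have tl: "t < p (Suc k)" using b by (simp add: blk_def)
    have "t < p k + H" using pshort[OF tT tl] .
    then have len: "p (Suc k) - p k \<le> H + 1" using False by (simp add: \<tau>_def)
    have "t \<le> \<tau> (Suc k)" using tl pstep[of "Suc k"] H by (simp add: \<tau>_def)
    then have "P t - S k = smooth_step (t - \<tau> k) * c k"
      using st.stairs_block(1)[of k t c] False by (simp add: P_def S_def)
    then have "\<bar>P t - S k\<bar> = smooth_step (t - \<tau> k) * \<bar>c k\<bar>" by (simp add: abs_mult smooth_step_nonneg)
    also have "\<dots> \<le> 1 * (K * (p (Suc k) - p k))"
      using c_abs smooth_step_le_1 smooth_step_nonneg by (intro mult_mono) auto
    also have "\<dots> \<le> D1" using len K_ge by (simp add: D1_def mult_left_mono)
    finally show ?thesis .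
  qed
  have flow_p: "norm (flow (p (i + n)) (p i) *v x) \<le> exp (S (i + n) - S i) * norm x" for i n x
  proof (induction n)
    case 0
    then show ?case using p[of i] by (simp add: flow_def matrix_vector_mul_assoc[symmetric])
  next
    case (Suc n)
    have "norm (flow (p (i + Suc n)) (p i) *v x) = norm (flow (p (Suc (i + n))) (p (i + n)) *v (flow (p (i + n)) (p i) *v x))"
      by (simp add: flow_comp[OF p])
    also have "\<dots> \<le> exp (c (i + n)) * norm (flow (p (i + n)) (p i) *v x)"
      unfolding exp_c \<alpha>_def by (rule v)
    also have "\<dots> \<le> exp (c (i + n)) * (exp (S (i + n) - S i) * norm x)" by (intro mult_left_mono Suc) auto
    also have "\<dots> = exp (S (i + Suc n) - S i) * norm x" by (simp add: S_def exp_add[symmetric] exp_diff)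
    finally show ?case .
  qed
  define C1 where "C1 = exp (K * (a + H))"
  have flow_blk: "norm (flow t (p k) *v x) \<le> C1 * norm x" "norm (flow (p k) t *v x) \<le> C1 * norm x"
    if "blk k t" "t \<in> T0" for k t x
  proof -
    have "K * \<bar>t - p k\<bar> \<le> K * (a + H)" using dist_blk[OF that] K_ge by (intro mult_left_mono) auto
    then have "exp (K * \<bar>t - p k\<bar>) * norm x \<le> C1 * norm x" "exp (K * \<bar>p k - t\<bar>) * norm x \<le> C1 * norm x"
      by (auto simp: C1_def abs_minus_commute intro!: mult_right_mono)
    then show "norm (flow t (p k) *v x) \<le> C1 * norm x" "norm (flow (p k) t *v x) \<le> C1 * norm x"
      using flow_bound[OF p[of k] that(2), of x] flow_bound[OF that(2) p[of k], of x] by linarith+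
  qed
  define l where "l = L / H - \<delta>"
  show ?thesis unfolding l_def[symmetric]
  proof (rule central_upper_exponent_le[OF N der cont])
    show "0 < C1 * C1 * exp (2 * D1)" by (simp add: C1_def)
    fix s t x assume s: "s \<in> T0" and "t \<in> ts_from T s"
    then have t: "t \<in> T0" "s \<le> t" by (auto simp: ts_from_def)
    obtain i j where ij: "blk i s" "blk j t" using blk_ex s t by blast
    have "i \<le> j"
    proof (rule ccontr)
      assume "\<not> i \<le> j"
      then have "p (Suc j) \<le> p i" "i \<noteq> 0" by (auto intro: sp.step_mono)
      then show False using ij t by (auto simp: blk_def)
    qed
    then obtain n where n: "j = i + n" using le_Suc_ex by blast
    have "norm (flow t s *v x) = norm (flow t (p j) *v (flow (p j) (p i) *v (flow (p i) s *v x)))"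
      by (simp add: flow_comp[OF p])
    also have "\<dots> \<le> C1 * norm (flow (p j) (p i) *v (flow (p i) s *v x))" by (rule flow_blk[OF ij(2) t(1)])
    also have "\<dots> \<le> C1 * (exp (S j - S i) * norm (flow (p i) s *v x))"
      unfolding n by (intro mult_left_mono flow_p) (simp add: C1_def)
    also have "\<dots> \<le> C1 * (exp (S j - S i) * (C1 * norm x))"
      by (intro mult_left_mono flow_blk ij s) (simp_all add: C1_def)
    also have "\<dots> \<le> C1 * (exp (2 * D1 + (P t - P s)) * (C1 * norm x))"
      using P_blk[OF ij(1) s] P_blk[OF ij(2) t(1)]
      by (intro mult_left_mono mult_right_mono) (auto simp: C1_def abs_le_iff)
    also have "\<dots> = C1 * C1 * exp (2 * D1) * exp (P t - P s) * norm x" by (simp add: exp_add mult_ac)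
    finally show "norm (flow t s *v x) \<le> C1 * C1 * exp (2 * D1) * exp (P t - P s) * norm x" .
  next
    fix t assume t: "t \<in> T0"
    obtain k where k: "blk k t" using blk_ex t by blast
    have kH: "real k * H \<le> p k - a"
    proof (induction k)
      case (Suc k) then show ?case using pstep[of k] by (simp add: algebra_simps)
    qed (simp add: p0)
    have "P t \<le> S k + D1" using P_blk[OF k t] by simp
    also have "S k \<le> D - \<delta> * (p k - a) + real k * L" unfolding S_def c_def \<alpha>_def by (rule sum_le)
    \<comment> \<open>Every block has length at least H, so, L being nonnegative, the number of
      blocks may be replaced by the elapsed time over H.\<close>
    also have "real k * L = (real k * H) * (L / H)" using H by simp
    also have "\<dots> \<le> (p k - a) * (L / H)" using kH L H by (intro mult_right_mono) auto
    also have "D - \<delta> * (p k - a) + (p k - a) * (L / H) = D + l * (p k - a)" by (simp add: l_def algebra_simps)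
    \<comment> \<open>The number l may be negative, so the bounded difference between
      \<open>p k - a\<close> and t is charged with its absolute value.\<close>
    also have "l * (p k - a) \<le> l * t + \<bar>l\<bar> * (2 * a + H)"
    proof -
      have "l * (p k - a) - l * t = l * (p k - a - t)" by (simp add: algebra_simps)
      also have "\<dots> \<le> \<bar>l\<bar> * \<bar>p k - a - t\<bar>" by (metis abs_ge_self abs_mult)
      also have "\<dots> \<le> \<bar>l\<bar> * (2 * a + H)" using dist_blk[OF k t] a0 by (intro mult_left_mono) auto
      finally show ?thesis by simp
    qed
    finally show "P t \<le> (D + \<bar>l\<bar> * (2 * a + H) + D1) + l * t" by simp
  qed
qed

text \<open>The limit superior bounds the graininess beyond some point \<open>t1\<close> of the
  scale, and a point before \<open>t1\<close> jumps at most to \<open>t1\<close>.\<close>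

lemma syndetic_graininess_bound:
  assumes "syndetic T"
  obtains m where "m \<ge> 1" "\<And>t. t \<in> T0 \<Longrightarrow> graininess T t \<le> m"
proof -
  obtain r where r: "Limsup (ts_at_top T) (\<lambda>t. ereal (graininess T t)) < ereal r"
    using assms unfolding syndetic_def by (metis ereal_dense2 less_PInf_Ex_of_nat ereal_less_PInfty less_ereal.simps(2))
  then have "\<forall>\<^sub>F t in ts_at_top T. ereal (graininess T t) < ereal r" by (rule Limsup_lessD)
  then have "\<forall>\<^sub>F t in at_top. t \<in> T \<longrightarrow> graininess T t < r"
    by (simp add: ts_at_top_def eventually_inf_principal)
  then obtain t0 where t0: "\<And>t. t \<ge> t0 \<Longrightarrow> t \<in> T \<Longrightarrow> graininess T t < r" unfolding eventually_at_top_linorder by blast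
  obtain t1 where t1: "t1 \<in> T0" "t1 > t0" using S0.exists_above by blast
  have "graininess T t \<le> max 1 (max r t1)" if t: "t \<in> T0" for t
  proof (cases "t < t1")
    case True
    have "fwd_jump (T0) t = fwd_jump T t"
      using t by (intro fwd_jump_ts_from) (simp add: ts_from_def)
    then have "fwd_jump T t \<le> t1" using S0.fwd_jump_le[OF t1(1) True] by simp
    then show ?thesis using t by (auto simp: graininess_def ts_from_def)
  next
    case False
    then show ?thesis using t0[of t] t t1 by (auto simp: ts_from_def)
  qed
  then show ?thesis by (intro that[of "max 1 (max r t1)"]) auto
qed

text \<open>Taken logarithmically, the product bound loses -ln \<kappa> per block and gains \<delta>
  per unit of time. The condition on \<kappa> does not involve \<open>H\<close>, and the constant ln
  G disappears in the limit.\<close>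

lemma exponent_bound_of_stability:
  assumes N: "vector_norm N" and a: "a \<in> T0" and \<omega>: "\<omega> > 0" and H: "H \<ge> 1" and G: "G > 0"
    and \<delta>: "0 \<le> \<delta>" "\<delta> \<le> \<omega> / 2"
    and \<delta>_growth: "\<And>t. t \<in> ts_from T a \<Longrightarrow> exp (\<delta> * graininess T t) \<le> 2"
      "\<And>t. t \<in> ts_from T a \<Longrightarrow> (1 + M * graininess T t) * (exp (\<delta> * graininess T t) - 1) \<le> graininess T t * \<omega> / 2"
    and \<kappa>: "0 < \<kappa>" "\<kappa> \<le> 1 / 2" "16 * (1 + M) * \<kappa> * exp (2 * K) \<le> \<omega>"
    and stable: "\<And>B y b. continuous_on {a..} B \<Longrightarrow> (\<And>t. t \<ge> a \<Longrightarrow> norm (B t) \<le> \<omega>) \<Longrightarrow>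
      (\<And>t. t \<in> ts_from T a \<Longrightarrow> has_delta_derivative (ts_from T a) y ((A t + B t) *v y t) t) \<Longrightarrow>
      b \<in> ts_from T a \<Longrightarrow> norm (y b) \<le> G * norm (y a)"
  shows "central_upper_exponent N T A \<le> ereal (- ln \<kappa> / H - \<delta>)"
proof -
  have "H > 0" using H by simp
  then obtain p where p: "p 0 = a" "\<And>k. p k \<in> T0" "\<And>k. p k + H \<le> p (Suc k)"
    "\<And>k s. s \<in> T \<Longrightarrow> s < p (Suc k) \<Longrightarrow> s < p k + H"
    using partition_exists[OF a] by metis
  have "\<forall>k. \<exists>v. norm v = 1 \<and> (\<forall>x. norm (flow (p (Suc k)) (p k) *v x) \<le> norm (flow (p (Suc k)) (p k) *v v) * norm x)"
    by (meson matrix_norm_attained)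
  then obtain v where v: "\<And>k. norm (v k) = 1"
    "\<And>k x. norm (flow (p (Suc k)) (p k) *v x) \<le> norm (flow (p (Suc k)) (p k) *v v k) * norm x"
    by metis
  have pstep: "p k + 1 \<le> p (Suc k)" for k using p(3)[of k] H by simp
  have pos: "norm (flow (p (Suc k)) (p k) *v v k) > 0" for k by (rule flow_pos[OF p(2) p(2) v(1)])
  have "(\<Sum>k<m. ln (norm (flow (p (Suc k)) (p k) *v v k))) \<le> ln G - \<delta> * (p m - a) + real m * (- ln \<kappa>)" for m
  proof -
    let ?\<Pi> = "\<Prod>k<m. norm (flow (p (Suc k)) (p k) *v v k)"
    have \<Pi>: "?\<Pi> > 0" using pos by (intro prod_pos) auto
    have "exp (\<delta> * (p m - a)) * (\<kappa> ^ m * ?\<Pi>) \<le> G"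
      by (rule block_growth_bound[OF a p(1,2) pstep v(1) \<omega> \<delta> \<delta>_growth \<kappa> stable])
    then have "ln (exp (\<delta> * (p m - a)) * (\<kappa> ^ m * ?\<Pi>)) \<le> ln G"
      using \<kappa> \<Pi> G by (subst ln_le_cancel_iff) auto
    moreover have "ln (exp z * (\<kappa> ^ m * r)) = z + (real m * ln \<kappa> + ln r)" if "r > 0" for z r
      using \<kappa>(1) that by (simp add: ln_mult ln_realpow)
    then have "ln (exp (\<delta> * (p m - a)) * (\<kappa> ^ m * ?\<Pi>)) = \<delta> * (p m - a) + (real m * ln \<kappa> + ln ?\<Pi>)"
      using \<Pi> by blast
    moreover have "ln ?\<Pi> = (\<Sum>k<m. ln (norm (flow (p (Suc k)) (p k) *v v k)))"
      using pos by (intro ln_prod) auto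
    ultimately show ?thesis by linarith
  qed
  moreover have "- ln \<kappa> \<ge> 0" using \<kappa> by simp
  ultimately show ?thesis
    by (intro central_upper_exponent_partition[OF N a H p v])
qed

text \<open>The start \<open>a\<close> and the factor \<open>G\<close> are arbitrary; this is what
  allows windows to follow one another with ever smaller initial values.\<close>

lemma destabilizing_perturbation:
  assumes N: "vector_norm N" and a: "a \<in> T0" and \<omega>: "\<omega> > 0" and G: "G > 0"
    and \<chi>: "central_upper_exponent N T A > 0 \<or> syndetic T \<and> central_upper_exponent N T A \<ge> 0"
  obtains B y b where "continuous_on {a..} B" "\<And>t. t \<ge> a \<Longrightarrow> norm (B t) \<le> \<omega>"
    "\<And>t. t \<in> ts_from T a \<Longrightarrow> has_delta_derivative (ts_from T a) y ((A t + B t) *v y t) t"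
    "b \<in> ts_from T a" "norm (y b) > G * norm (y a)"
proof (rule ccontr)
  assume no_thesis: "\<not> thesis"
  note conclude = that
  have stable: "norm (y b) \<le> G * norm (y a)"
    if B: "continuous_on {a..} B" "\<And>t. t \<ge> a \<Longrightarrow> norm (B t) \<le> \<omega>"
      and y: "\<And>t. t \<in> ts_from T a \<Longrightarrow> has_delta_derivative (ts_from T a) y ((A t + B t) *v y t) t"
      and b: "b \<in> ts_from T a" for B y b
    using conclude[OF B y b] no_thesis not_le_imp_less by blast
  define d where "d = 16 * (1 + M) * exp (2 * K)"
  have d: "d > 0" using M_pos by (simp add: d_def)
  \<comment> \<open>The largest value that the conditions allow; it depends on \<omega>, M and K
    only.\<close>
  define \<kappa> where "\<kappa> = min (1/2) (\<omega> / d)"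
  have \<kappa>: "0 < \<kappa>" "\<kappa> \<le> 1 / 2" "16 * (1 + M) * \<kappa> * exp (2 * K) \<le> \<omega>"
  proof -
    show "0 < \<kappa>" unfolding \<kappa>_def using d \<omega> by simp
    show "\<kappa> \<le> 1 / 2" unfolding \<kappa>_def by (rule min.cobounded1)
    have "\<kappa> * d \<le> (\<omega> / d) * d" using d by (intro mult_right_mono) (auto simp: \<kappa>_def)
    also have "\<dots> = \<omega>" using d by simp
    finally show "16 * (1 + M) * \<kappa> * exp (2 * K) \<le> \<omega>" by (simp add: d_def mult_ac)
  qed
  define L where "L = - ln \<kappa>"
  have L: "L \<ge> 0" using \<kappa> by (simp add: L_def)
  have bound: "central_upper_exponent N T A \<le> ereal (L / H - \<delta>)"
    if "H \<ge> 1" "0 \<le> \<delta>" "\<delta> \<le> \<omega> / 2"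
      "\<And>t. t \<in> ts_from T a \<Longrightarrow> exp (\<delta> * graininess T t) \<le> 2"
      "\<And>t. t \<in> ts_from T a \<Longrightarrow> (1 + M * graininess T t) * (exp (\<delta> * graininess T t) - 1) \<le> graininess T t * \<omega> / 2" for H \<delta>
    unfolding L_def by (rule exponent_bound_of_stability[OF N a \<omega> that(1) G that(2-5) \<kappa> stable])
  have gr0: "graininess T t \<ge> 0" if "t \<in> ts_from T a" for t
  proof -
    have "graininess (T0) t = graininess T t"
      using that a by (intro graininess_ts_from) (auto simp: ts_from_def)
    then show ?thesis using S0.graininess_ge_0[of t] by simp
  qed
  from \<chi> show False
  proof
    assume "central_upper_exponent N T A > 0"
    then obtain r where r: "0 < r" "ereal r < central_upper_exponent N T A"
      using ereal_dense2[of 0 "central_upper_exponent N T A"] by auto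
    \<comment> \<open>So large that L / H is at most r, which lies strictly below the exponent. With
      \<delta> = 0 both growth conditions on the gaps are trivial.\<close>
    define H where "H = max 1 (L / r)"
    have H: "H \<ge> 1" "L \<le> r * H" using r by (auto simp: H_def max_def field_simps)
    have "central_upper_exponent N T A \<le> ereal (L / H - 0)"
      using H \<omega> gr0 by (intro bound) auto
    also have "\<dots> \<le> ereal r" using H by (simp add: field_simps)
    finally show False using r by simp
  next
    assume syn: "syndetic T \<and> central_upper_exponent N T A \<ge> 0"
    then obtain m where m: "m \<ge> 1" "\<And>t. t \<in> T0 \<Longrightarrow> graininess T t \<le> m"
      using syndetic_graininess_bound by blast
    have gr_m: "graininess T t \<le> m" if "t \<in> ts_from T a" for t
      using that a by (intro m) (auto simp: ts_from_def)
    \<comment> \<open>The three bounds serve half of \<omega> at right-dense points, exp(\<delta>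
      \<mu>) \<le> 2 for all gaps up to \<open>m\<close>, and, through exp(x) - 1 \<le> x exp(x)
      \<le> 2 x, the smallness of (1 + M \<mu>) (exp(\<delta> \<mu>) - 1).\<close>
    define \<delta> where "\<delta> = Min {\<omega> / 2, ln 2 / m, \<omega> / (4 * (1 + M * m))}"
    have Mm: "1 + M * m > 0" using M_pos m by (simp add: add_pos_nonneg)
    have \<delta>_pos: "\<delta> > 0" unfolding \<delta>_def using \<omega> m(1) Mm by (subst Min_gr_iff) auto
    have \<delta>_le: "\<delta> \<le> \<omega> / 2" "\<delta> \<le> ln 2 / m" "\<delta> \<le> \<omega> / (4 * (1 + M * m))"
      unfolding \<delta>_def by (rule Min_le; simp)+
    note \<delta> = \<delta>_pos \<delta>_le
    \<comment> \<open>Now L / H is at most \<delta> / 2, so the exponent would be at most -\<delta>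
      / 2, which excludes even the value 0.\<close>
    define H where "H = max 1 (2 * L / \<delta>)"
    have H: "H \<ge> 1" "2 * L \<le> \<delta> * H" using \<delta> by (auto simp: H_def max_def field_simps)
    have e2: "exp (\<delta> * graininess T t) \<le> 2" if t: "t \<in> ts_from T a" for t
    proof -
      have "\<delta> * graininess T t \<le> (ln 2 / m) * m" using \<delta> m gr_m[OF t] gr0[OF t] by (intro mult_mono) auto
      also have "(ln 2 / m) * m = ln 2" using m(1) by simp
      finally have "exp (\<delta> * graininess T t) \<le> exp (ln 2)" by (simp only: exp_le_cancel_iff)
      also have "exp (ln 2) = (2::real)" by simp
      finally show ?thesis .
    qed
    have "central_upper_exponent N T A \<le> ereal (L / H - \<delta>)"
    proof (rule bound[OF H(1) less_imp_le[OF \<delta>(1)] \<delta>(2) e2])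
      fix t assume t: "t \<in> ts_from T a"
      let ?\<mu> = "graininess T t"
      have "1 - \<delta> * ?\<mu> \<le> exp (- (\<delta> * ?\<mu>))" using exp_ge_add_one_self[of "- (\<delta> * ?\<mu>)"] by simp
      then have "(1 - \<delta> * ?\<mu>) * exp (\<delta> * ?\<mu>) \<le> exp (- (\<delta> * ?\<mu>)) * exp (\<delta> * ?\<mu>)" by (rule mult_right_mono) simp
      then have "exp (\<delta> * ?\<mu>) - 1 \<le> \<delta> * ?\<mu> * exp (\<delta> * ?\<mu>)" by (simp add: exp_add[symmetric] algebra_simps)
      also have "\<dots> \<le> \<delta> * ?\<mu> * 2" using \<delta> gr0[OF t] e2[OF t] by (intro mult_left_mono) auto
      finally have "(1 + M * ?\<mu>) * (exp (\<delta> * ?\<mu>) - 1) \<le> (1 + M * m) * (\<delta> * ?\<mu> * 2)"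
        using gr_m[OF t] gr0[OF t] M_pos \<delta> Mm by (intro mult_mono) auto
      also have "\<dots> = \<delta> * (4 * (1 + M * m)) * (?\<mu> / 2)" by (simp add: algebra_simps)
      also have "\<dots> \<le> \<omega> * (?\<mu> / 2)" using \<delta>(4) Mm gr0[OF t] by (intro mult_right_mono) (auto simp: field_simps)
      finally show "(1 + M * ?\<mu>) * (exp (\<delta> * ?\<mu>) - 1) \<le> ?\<mu> * \<omega> / 2" by (simp add: mult.commute)
    qed
    also have "L / H - \<delta> \<le> - \<delta> / 2" using H by (simp add: field_simps)
    finally have "central_upper_exponent N T A \<le> ereal (- \<delta> / 2)" by simp
    also have "\<dots> < 0" using \<delta> by simp
    finally show False using syn leD by blast
  qed
qed

end

section \<open>The nonlinear perturbation\<close>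

lemma continuous_on_locally:
  assumes "\<And>p. p \<in> S \<Longrightarrow> \<exists>V. open V \<and> p \<in> V \<and> continuous_on (S \<inter> V) f"
  shows "continuous_on S f"
  unfolding continuous_on_def
proof
  fix p assume p: "p \<in> S"
  then obtain V where V: "open V" "p \<in> V" "continuous_on (S \<inter> V) f" using assms by blast
  have "at p within S = at p within (S \<inter> V)" by (rule at_within_nhd[OF V(2,1)]) auto
  then show "(f \<longlongrightarrow> f p) (at p within S)" using V p by (simp add: continuous_on_def)
qed

text \<open>The inner product in place of the norm keeps it differentiable at the origin. The
  transition takes place between the radii \<rho> and sqrt(2) \<rho>.\<close>

definition cutoff :: "real \<Rightarrow> real^'n \<Rightarrow> real" where
  "cutoff \<rho> x = smooth_step (x \<bullet> x / \<rho>\<^sup>2 - 1)"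

definition cutoff_field :: "real \<Rightarrow> real^'n^'n \<Rightarrow> real^'n \<Rightarrow> real^'n" where
  "cutoff_field \<rho> B x = cutoff \<rho> x *\<^sub>R (B *v x)"

definition cutoff_jacobian :: "real \<Rightarrow> real^'n^'n \<Rightarrow> real^'n \<Rightarrow> real^'n^'n" where
  "cutoff_jacobian \<rho> B x =
     cutoff \<rho> x *\<^sub>R B + outer (B *v x) ((smooth_step_deriv (x \<bullet> x / \<rho>\<^sup>2 - 1) * 2 / \<rho>\<^sup>2) *\<^sub>R x)"

lemma cutoff_eq_0: "\<rho> > 0 \<Longrightarrow> norm x \<le> \<rho> \<Longrightarrow> cutoff \<rho> x = 0"
  unfolding cutoff_def power2_norm_eq_inner[symmetric]
  by (intro smooth_step_eq_0) (simp add: power_mono)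

lemma cutoff_eq_1: "\<rho> > 0 \<Longrightarrow> 2 * \<rho>\<^sup>2 \<le> (norm x)\<^sup>2 \<Longrightarrow> cutoff \<rho> x = 1"
  unfolding cutoff_def power2_norm_eq_inner[symmetric]
  by (intro smooth_step_eq_1) (simp add: field_simps)

lemma cutoff_field_has_derivative:
  assumes "\<rho> > 0"
  shows "(cutoff_field \<rho> B has_derivative (*v) (cutoff_jacobian \<rho> B x)) (at x)"
proof -
  let ?s = "smooth_step_deriv (x \<bullet> x / \<rho>\<^sup>2 - 1)"
  have "((\<lambda>x. x \<bullet> x / \<rho>\<^sup>2 - 1) has_derivative (\<lambda>h. (x \<bullet> h + h \<bullet> x) / \<rho>\<^sup>2 - 0)) (at x)"
    by (intro has_derivative_diff has_derivative_const bounded_linear.has_derivative[OF bounded_linear_divide]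
        has_derivative_inner has_derivative_ident)
  then have "((\<lambda>x. x \<bullet> x / \<rho>\<^sup>2 - 1) has_derivative (\<lambda>h. 2 * (x \<bullet> h) / \<rho>\<^sup>2)) (at x)"
    by (simp add: inner_commute)
  then have c: "(cutoff \<rho> has_derivative (\<lambda>h. ?s * (2 * (x \<bullet> h) / \<rho>\<^sup>2))) (at x)"
    unfolding cutoff_def[abs_def]
    by (rule has_derivative_compose[OF _ smooth_step_has_derivative[unfolded has_field_derivative_def]])
  have b: "((*v) B has_derivative (*v) B) (at x)"
    by (rule bounded_linear_imp_has_derivative)
      (rule bounded_bilinear.bounded_linear_right[OF bounded_bilinear_matrix_vector_mult])
  have "(cutoff_field \<rho> B has_derivative (\<lambda>h. cutoff \<rho> x *\<^sub>R (B *v h) + (?s * (2 * (x \<bullet> h) / \<rho>\<^sup>2)) *\<^sub>R (B *v x))) (at x)"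
    unfolding cutoff_field_def[abs_def] by (rule has_derivative_scaleR[OF c b])
  also have "(\<lambda>h. cutoff \<rho> x *\<^sub>R (B *v h) + (?s * (2 * (x \<bullet> h) / \<rho>\<^sup>2)) *\<^sub>R (B *v x)) = (*v) (cutoff_jacobian \<rho> B x)"
    by (simp add: fun_eq_iff cutoff_jacobian_def matrix_vector_mult_add_rdistrib scaleR_matrix_vector_assoc[symmetric] outer_mult)
  finally show ?thesis .
qed

lemma jacobian_cutoff_field:
  assumes "\<rho> > 0"
  shows "jacobian (cutoff_field \<rho> B) (at x) = cutoff_jacobian \<rho> B x"
  unfolding jacobian_def using frechet_derivative_at[OF cutoff_field_has_derivative[OF assms]]
  by (metis matrix_of_matrix_vector_mul)

text \<open>Scale invariance: the gradient of the cutoff is of the order |x| / \<rho>^2 and vanishes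
  where |x|^2 > 2 \<rho>^2, so against |B x| \<le> |B| |x| the radius cancels. The slope of the
  step, the derivative of the square and the outer radius contribute a factor 2 each, which gives 8;
  the linear part adds 1.\<close>

lemma norm_cutoff_jacobian_le:
  assumes \<rho>: "\<rho> > 0"
  shows "norm (cutoff_jacobian \<rho> B x) \<le> 9 * norm B"
proof -
  let ?s = "smooth_step_deriv (x \<bullet> x / \<rho>\<^sup>2 - 1)"
  have s: "?s * (norm x)\<^sup>2 \<le> 2 * (2 * \<rho>\<^sup>2)"
  proof (cases "(norm x)\<^sup>2 \<le> 2 * \<rho>\<^sup>2")
    case True
    then show ?thesis using smooth_step_deriv_le smooth_step_deriv_nonneg by (intro mult_mono) auto
  next
    case False
    then have "x \<bullet> x / \<rho>\<^sup>2 - 1 \<ge> 1" using \<rho> by (simp add: power2_norm_eq_inner field_simps)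
    then show ?thesis by simp
  qed
  have "norm (cutoff_jacobian \<rho> B x) \<le> cutoff \<rho> x * norm B + norm (B *v x) * (?s * 2 / \<rho>\<^sup>2 * norm x)"
    unfolding cutoff_jacobian_def
    using norm_triangle_ineq[of "cutoff \<rho> x *\<^sub>R B" "outer (B *v x) ((?s * 2 / \<rho>\<^sup>2) *\<^sub>R x)"]
    by (simp add: norm_outer cutoff_def smooth_step_nonneg smooth_step_deriv_nonneg)
  also have "\<dots> \<le> 1 * norm B + (norm B * norm x) * (?s * 2 / \<rho>\<^sup>2 * norm x)"
    using smooth_step_le_1 smooth_step_deriv_nonneg norm_matrix_vector_le
    by (intro add_mono mult_right_mono) (auto simp: cutoff_def)
  also have "(norm B * norm x) * (?s * 2 / \<rho>\<^sup>2 * norm x) = norm B * (2 / \<rho>\<^sup>2 * (?s * (norm x)\<^sup>2))"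
    by (simp add: power2_eq_square)
  also have "\<dots> \<le> norm B * (2 / \<rho>\<^sup>2 * (2 * (2 * \<rho>\<^sup>2)))" by (intro mult_left_mono s) auto
  also have "\<dots> = 8 * norm B" using \<rho> by simp
  finally show ?thesis by simp
qed

lemma cutoff_field_lipschitz:
  assumes "\<rho> > 0"
  shows "norm (cutoff_field \<rho> B x - cutoff_field \<rho> B y) \<le> 9 * norm B * norm (x - y)"
proof (rule differentiable_bound[of UNIV])
  show "(cutoff_field \<rho> B has_derivative (*v) (cutoff_jacobian \<rho> B z)) (at z within UNIV)" for z
    by (rule cutoff_field_has_derivative[OF assms])
  show "onorm ((*v) (cutoff_jacobian \<rho> B z)) \<le> 9 * norm B" for z
  proof (rule onorm_le)
    fix h
    have "norm (cutoff_jacobian \<rho> B z *v h) \<le> norm (cutoff_jacobian \<rho> B z) * norm h" by (rule norm_matrix_vector_le)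
    also have "\<dots> \<le> 9 * norm B * norm h" by (intro mult_right_mono norm_cutoff_jacobian_le assms) simp
    finally show "norm (cutoff_jacobian \<rho> B z *v h) \<le> 9 * norm B * norm h" .
  qed
qed auto

lemma continuous_on_matrix_vector_mult [continuous_intros]:
  fixes f :: "'a::topological_space \<Rightarrow> real^'n^'n" and g :: "'a \<Rightarrow> real^'n"
  assumes "continuous_on S f" "continuous_on S g"
  shows "continuous_on S (\<lambda>x. f x *v g x)"
  by (rule bounded_bilinear.continuous_on[OF bounded_bilinear_matrix_vector_mult assms])

lemma continuous_on_outer [continuous_intros]:
  assumes "continuous_on S f" "continuous_on S g"
  shows "continuous_on S (\<lambda>x. outer (f x) (g x))"
  by (rule bounded_bilinear.continuous_on[OF bounded_bilinear_outer assms])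

lemma continuous_on_smooth_step: "continuous_on U smooth_step"
  using smooth_step_has_derivative DERIV_isCont by (meson continuous_at_imp_continuous_on)

lemma continuous_on_cutoff:
  fixes g :: "'a::topological_space \<Rightarrow> real^'n"
  assumes "continuous_on S B" "continuous_on S g" and "\<rho> > 0"
  shows "continuous_on S (\<lambda>p. cutoff_field \<rho> (B p) (g p))"
    and "continuous_on S (\<lambda>p. cutoff_jacobian \<rho> (B p) (g p))"
proof -
  have g2: "continuous_on S (\<lambda>p. g p \<bullet> g p / \<rho>\<^sup>2 - 1)"
    using \<open>\<rho> > 0\<close> by (intro continuous_intros assms) simp
  have c: "continuous_on S (\<lambda>p. cutoff \<rho> (g p))"
    unfolding cutoff_def by (rule continuous_on_compose2[OF continuous_on_smooth_step[of UNIV] g2]) simp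
  have d: "continuous_on S (\<lambda>p. smooth_step_deriv (g p \<bullet> g p / \<rho>\<^sup>2 - 1))"
    by (rule continuous_on_compose2[OF continuous_smooth_step_deriv[of UNIV] g2]) simp
  show "continuous_on S (\<lambda>p. cutoff_field \<rho> (B p) (g p))"
    unfolding cutoff_field_def by (intro continuous_on_scaleR c continuous_on_matrix_vector_mult assms)
  have "continuous_on S (\<lambda>p. smooth_step_deriv (g p \<bullet> g p / \<rho>\<^sup>2 - 1) * 2 / \<rho>\<^sup>2)"
    using \<open>\<rho> > 0\<close> by (intro continuous_intros d) simp
  then show "continuous_on S (\<lambda>p. cutoff_jacobian \<rho> (B p) (g p))"
    unfolding cutoff_jacobian_def
    by (intro continuous_on_add continuous_on_scaleR continuous_on_outer continuous_on_matrix_vector_mult c assms)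
qed

section \<open>Windows and the unstable nonlinear system\<close>

context regressive_system begin

text \<open>
  A window \<open>[a, c]\<close> ends at a right-scattered point, so that the perturbations of consecutive windows need
  no continuous transition. Before the window, the orbit stays in the ball of radius \<open>r\<close>, where the
  perturbations of the earlier windows vanish.
\<close>

definition window ::
    "real \<Rightarrow> real \<Rightarrow> nat \<Rightarrow> (real \<Rightarrow> real^'n^'n) \<times> real \<times> (real \<Rightarrow> real^'n) \<times> real \<times> real \<Rightarrow> bool" where
  "window a r n = (\<lambda>(B, \<rho>, y, b, c).
     continuous_on {a..} B \<and> (\<forall>t\<ge>a. norm (B t) \<le> 1 / real (Suc n)) \<and> \<rho> > 0 \<and>
     (\<forall>t\<in>ts_from T a. has_delta_derivative (ts_from T a) y ((A t + B t) *v y t) t) \<and>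
     b \<in> ts_from T a \<and> norm (y b) = 1 \<and> (\<forall>t\<in>ts_from T a. t \<le> b \<longrightarrow> 2 * \<rho>\<^sup>2 \<le> (norm (y t))\<^sup>2) \<and>
     (\<forall>t\<in>T0. t \<le> a \<longrightarrow> norm (flow t a *v y a) \<le> min r (1 / real (Suc n))) \<and>
     c \<in> T0 \<and> b \<le> c \<and> a + 1 \<le> c \<and> c < fwd_jump T c)"

text \<open>A linear orbit can be rescaled: with length 1 at its end \<open>b\<close>, an orbit that
  grows by more than \<open>G\<close> starts with length below 1 / G.\<close>

lemma window_exists:
  assumes N: "vector_norm N"
    and \<chi>: "central_upper_exponent N T A > 0 \<or> syndetic T \<and> central_upper_exponent N T A \<ge> 0"
    and a: "a \<in> T0" and r: "r > 0"
  shows "\<exists>w. window a r n w"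
proof -
  interpret H: half_scale "ts_from T a" a by (rule half_scale_from[OF a])
  let ?\<omega> = "1 / real (Suc n)"
  define m where "m = min r ?\<omega>"
  have m: "m > 0" using r by (simp add: m_def)
  \<comment> \<open>Going back from \<open>a\<close> along the unperturbed flow costs at most exp(K
    a); the rest of the factor brings the orbit below \<open>m\<close> at all earlier times.\<close>
  define G where "G = exp (K * a) / m"
  have G: "G > 0" using m by (simp add: G_def)
  have "?\<omega> > 0" by simp
  then obtain B z b where B: "continuous_on {a..} B" "\<And>t. t \<ge> a \<Longrightarrow> norm (B t) \<le> ?\<omega>"
    and z: "\<And>t. t \<in> ts_from T a \<Longrightarrow> has_delta_derivative (ts_from T a) z ((A t + B t) *v z t) t"
    and b: "b \<in> ts_from T a" and zb: "norm (z b) > G * norm (z a)"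
    using destabilizing_perturbation[OF N a _ G \<chi>] by metis
  have zb0: "norm (z b) > 0" using zb G by (meson le_less_trans mult_nonneg_nonneg less_imp_le norm_ge_zero)
  define y where "y t = (1 / norm (z b)) *\<^sub>R z t" for t
  have y: "has_delta_derivative (ts_from T a) y ((A t + B t) *v y t) t" if "t \<in> ts_from T a" for t
    unfolding y_def[abs_def]
    using H.delta_derivative_bounded_linear[OF that z[OF that] bounded_linear_scaleR_right[of "1 / norm (z b)"]]
    by (simp add: matrix_vector_mult_scaleR)
  have yb: "norm (y b) = 1" using zb0 by (simp add: y_def)
  have ya: "G * norm (y a) \<le> 1" using zb zb0 by (simp add: y_def field_simps)
  have small: "norm (flow t a *v y a) \<le> m" if t: "t \<in> T0" "t \<le> a" for t
  proof -
    have "norm (flow t a *v y a) \<le> exp (K * \<bar>t - a\<bar>) * norm (y a)" by (rule flow_bound[OF a t(1)])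
    also have "\<dots> \<le> exp (K * a) * norm (y a)"
      using t K_ge by (intro mult_right_mono) (auto simp: ts_from_def intro!: mult_left_mono)
    also have "\<dots> = m * (G * norm (y a))" using m by (simp add: G_def)
    also have "\<dots> \<le> m * 1" using m ya by (intro mult_left_mono) auto
    finally show ?thesis by simp
  qed
  \<comment> \<open>By Gronwall an orbit that vanishes at t would remain 0 up to \<open>b\<close>,
    where its length is 1.\<close>
  have nz: "y t \<noteq> 0" if t: "t \<in> ts_from T a" "t \<le> b" for t
  proof
    assume "y t = 0"
    have t0: "t \<in> T0" and bt: "b \<in> ts_from T t" using t a b by (auto simp: ts_from_def)
    interpret I: half_scale "ts_from T t" t by (rule half_scale_from[OF t0])
    have y': "has_delta_derivative (ts_from T t) y ((A s + B s) *v y s) s" if s: "s \<in> ts_from T t" for s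
    proof (rule H.delta_derivative_subset[OF y])
      show "s \<in> ts_from T a" "ts_from T t \<subseteq> ts_from T a" using s t by (auto simp: ts_from_def)
      have "a \<le> s" "t \<le> s" using s t by (auto simp: ts_from_def)
      then show "fwd_jump (ts_from T t) s = fwd_jump (ts_from T a) s" by (simp add: fwd_jump_ts_from)
    qed
    have "norm (y b) \<le> exp ((M + ?\<omega>) * (b - t)) * norm (y t)"
    proof (rule I.delta_gronwall[OF _ bt y'])
      fix s assume s: "s \<in> ts_from T t"
      have "norm ((A s + B s) *v y s) \<le> norm (A s + B s) * norm (y s)" by (rule norm_matrix_vector_le)
      also have "\<dots> \<le> (M + ?\<omega>) * norm (y s)"
        using s t by (intro mult_right_mono norm_triangle_mono A_le B) (auto simp: ts_from_def)
      finally show "norm ((A s + B s) *v y s) \<le> (M + ?\<omega>) * norm (y s)" .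
    qed (use M_pos I.delta_derivative_continuous[OF bt y'[OF bt]] in auto)
    then show False using \<open>y t = 0\<close> yb by simp
  qed
  have "compact (ts_from T a \<inter> {..b})"
  proof -
    have "ts_from T a \<inter> {..b} = T \<inter> {a..b}" by (auto simp: ts_from_def)
    then show ?thesis using time_scale by (simp add: time_scale_def closed_Int_compact)
  qed
  moreover have "ts_from T a \<inter> {..b} \<noteq> {}" using b by auto
  moreover have "continuous_on (ts_from T a) y"
    unfolding continuous_on_def using H.delta_derivative_continuous[OF _ y] by blast
  then have "continuous_on (ts_from T a \<inter> {..b}) (\<lambda>t. norm (y t))"
    by (intro continuous_on_norm) (auto intro: continuous_on_subset)
  ultimately obtain s where s: "s \<in> ts_from T a \<inter> {..b}" "\<And>t. t \<in> ts_from T a \<inter> {..b} \<Longrightarrow> norm (y s) \<le> norm (y t)"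
    by (meson continuous_attains_inf)
  \<comment> \<open>Half of the least length of the orbit on the compact part of the scale up to
    \<open>b\<close>, so that the cutoff is 1 along all of it.\<close>
  define \<rho> where "\<rho> = norm (y s) / 2"
  have \<rho>: "\<rho> > 0" using nz s by (simp add: \<rho>_def)
  have lower: "2 * \<rho>\<^sup>2 \<le> (norm (y t))\<^sup>2" if "t \<in> ts_from T a" "t \<le> b" for t
  proof -
    have "(norm (y s))\<^sup>2 \<le> (norm (y t))\<^sup>2" using s(2)[of t] that by (intro power_mono) auto
    moreover have "2 * \<rho>\<^sup>2 \<le> (norm (y s))\<^sup>2" by (simp add: \<rho>_def power2_eq_square)
    ultimately show ?thesis by linarith
  qed
  obtain c where c: "c \<in> right_scattered T" "c > max b (a + 1)"
    using scattered by (meson bdd_aboveI not_le_imp_less)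
  have "0 \<le> a" using a by (simp add: ts_from_def)
  then have "window a r n (B, \<rho>, y, b, c)"
    unfolding window_def using B \<rho> y b yb lower small c
    by (auto simp: m_def right_scattered_def ts_from_def)
  then show ?thesis by blast
qed

text \<open>Against stability, the k-th orbit is continued to time 0 by the unperturbed flow; for
  large k it starts there as close to the origin as desired. Uniqueness forces the nonlinear
  solution to coincide with it up to \<open>a k\<close>, where all earlier perturbations vanish
  along it, and then up to \<open>b k\<close>, where the cutoff is 1 along it.\<close>

theorem unstable_perturbation_exists:
  assumes N: "vector_norm N"
    and \<chi>: "central_upper_exponent N T A > 0 \<or> syndetic T \<and> central_upper_exponent N T A \<ge> 0"
  shows "\<exists>f. continuous_on (ts_from T 0 \<times> ball 0 1) (\<lambda>(t, x). f t x) \<and>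
             f \<in> class_F T 1 \<and> zero_unstable N T 1 A f"
proof -
  define win where "win a r n = (SOME w. window a r n w)" for a r n
  have win: "window a r n (win a r n)" if "a \<in> T0" "r > 0" for a r n
    unfolding win_def using window_exists[OF N \<chi> that] by (rule someI_ex)
  \<comment> \<open>The state is the start of the next window and the minimum of 1 and all earlier
    radii. The next window begins at the far end of the gap after \<open>c\<close>.\<close>
  define st where "st = rec_nat (0, 1) (\<lambda>n (a, r). case win a r n of (B, \<rho>, y, b, c) \<Rightarrow> (fwd_jump T c, min r \<rho>))"
  define a where "a n = fst (st n)" for n
  define r where "r n = snd (st n)" for n
  define B where "B n = fst (win (a n) (r n) n)" for n
  define \<rho> where "\<rho> n = fst (snd (win (a n) (r n) n))" for n
  define y where "y n = fst (snd (snd (win (a n) (r n) n)))" for n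
  define b where "b n = fst (snd (snd (snd (win (a n) (r n) n))))" for n
  define c where "c n = snd (snd (snd (snd (win (a n) (r n) n))))" for n
  have win_eq: "win (a n) (r n) n = (B n, \<rho> n, y n, b n, c n)" for n
    by (simp add: B_def \<rho>_def y_def b_def c_def)
  have a_0: "a 0 = 0" and r_0: "r 0 = 1" by (simp_all add: a_def r_def st_def)
  have Suc: "a (Suc n) = fwd_jump T (c n)" "r (Suc n) = min (r n) (\<rho> n)" for n
  proof -
    have "st (Suc n) = (case st n of (a, r) \<Rightarrow> case win a r n of (B, \<rho>, y, b, c) \<Rightarrow> (fwd_jump T c, min r \<rho>))"
      by (simp add: st_def)
    also have "st n = (a n, r n)" by (simp add: a_def r_def)
    finally have "st (Suc n) = (fwd_jump T (c n), min (r n) (\<rho> n))" by (simp add: win_eq)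
    then show "a (Suc n) = fwd_jump T (c n)" "r (Suc n) = min (r n) (\<rho> n)" by (simp_all add: a_def r_def)
  qed
  have ar: "a n \<in> T0 \<and> r n > 0" for n
  proof (induction n)
    case 0 then show ?case using S0.start_in by (simp add: a_0 r_0)
  next
    case (Suc n)
    then have "window (a n) (r n) n (B n, \<rho> n, y n, b n, c n)" using win win_eq by metis
    then have "c n \<in> T0" "\<rho> n > 0" by (auto simp: window_def)
    moreover have "fwd_jump T (c n) = fwd_jump (T0) (c n)"
      using \<open>c n \<in> T0\<close> by (intro fwd_jump_ts_from[symmetric]) (simp add: ts_from_def)
    ultimately show ?case using Suc S0.fwd_jump_in by (simp add: \<open>\<And>n. a (Suc n) = fwd_jump T (c n)\<close> \<open>\<And>n. r (Suc n) = min (r n) (\<rho> n)\<close>)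
  qed
  have W: "window (a n) (r n) n (B n, \<rho> n, y n, b n, c n)" for n using win ar win_eq by metis
  have B_cont: "continuous_on {a n..} (B n)" and B_le: "\<And>t. t \<ge> a n \<Longrightarrow> norm (B n t) \<le> 1 / real (Suc n)"
    and \<rho>_pos: "\<rho> n > 0" and y_der: "\<And>t. t \<in> ts_from T (a n) \<Longrightarrow> has_delta_derivative (ts_from T (a n)) (y n) ((A t + B n t) *v y n t) t"
    and b_in: "b n \<in> ts_from T (a n)" and y_b: "norm (y n (b n)) = 1"
    and y_lower: "\<And>t. t \<in> ts_from T (a n) \<Longrightarrow> t \<le> b n \<Longrightarrow> 2 * (\<rho> n)\<^sup>2 \<le> (norm (y n t))\<^sup>2"
    and y_small: "\<And>t. t \<in> T0 \<Longrightarrow> t \<le> a n \<Longrightarrow> norm (flow t (a n) *v y n (a n)) \<le> min (r n) (1 / real (Suc n))"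
    and c_in: "c n \<in> T0" and bc: "b n \<le> c n" and ac: "a n + 1 \<le> c n" and c_jump: "c n < fwd_jump T (c n)" for n
    using W[of n] by (auto simp: window_def)
  interpret spaced_steps a
  proof
    show "a k + 1 \<le> a (Suc k)" for k using ac[of k] c_jump[of k] by (simp add: Suc)
  qed
  have r_mono: "r k \<le> r j" if "j \<le> k" for j k
    using that by (rule lift_Suc_antimono_le[of r, rotated]) (simp add: Suc)
  have r_le: "r k \<le> \<rho> j" if "j < k" for j k
    using r_mono[of "Suc j" k] that by (simp add: Suc)
  define idx where "idx t = (LEAST k. t < a (Suc k))" for t
  have idx_eq: "idx t = k" if "a k \<le> t" "t < a (Suc k)" for t k
    unfolding idx_def
  proof (rule Least_equality)
    fix j assume j: "t < a (Suc j)"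
    show "k \<le> j"
    proof (rule ccontr)
      assume "\<not> k \<le> j"
      then have "a (Suc j) \<le> a k" by (intro step_mono) simp
      then show False using j that by simp
    qed
  qed (use that in simp)
  have block: "\<exists>k. a k \<le> t \<and> t < a (Suc k)" if "t \<in> T0" for t
    using block_exists[of t] that by (simp add: a_0 ts_from_def)
  have idx_block: "a (idx t) \<le> t" "t < a (Suc (idx t))" if "t \<in> T0" for t
    using block[OF that] idx_eq by auto
  have idx_ge: "k \<le> idx t" if "t \<in> T0" "a k \<le> t" for t k
  proof (rule ccontr)
    assume "\<not> k \<le> idx t"
    then have "a (Suc (idx t)) \<le> a k" by (intro step_mono) simp
    then show False using idx_block(2)[OF that(1)] that(2) by simp
  qed
  \<comment> \<open>No point of T lies strictly between \<open>c j\<close> and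
    \<open>a (Suc j)\<close>, so the open interval from \<open>lo k\<close> to
    \<open>a (Suc k)\<close> meets the scale exactly in the k-th window. The windows are thus
    relatively open and continuity is checked in each separately; -1 stands for any time before
    0.\<close>
  define lo where "lo k = (case k of 0 \<Rightarrow> - 1 | Suc j \<Rightarrow> c j)" for k
  have lo_less: "lo k < a k" for k
    using c_jump by (cases k) (auto simp: lo_def a_0 Suc)
  have idx_open: "idx t = k \<and> a k \<le> t" if t: "t \<in> T0" "lo k < t" "t < a (Suc k)" for t k
  proof -
    have "a k \<le> t"
    proof (cases k)
      case 0 then show ?thesis using t by (simp add: a_0 ts_from_def)
    next
      case (Suc j)
      have "fwd_jump (T0) (c j) \<le> t" using t Suc by (intro S0.fwd_jump_le) (auto simp: lo_def)
      moreover have "fwd_jump (T0) (c j) = fwd_jump T (c j)"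
        using c_in[of j] by (intro fwd_jump_ts_from) (simp add: ts_from_def)
      ultimately show ?thesis using Suc \<open>\<And>n. a (Suc n) = fwd_jump T (c n)\<close> by simp
    qed
    then show ?thesis using idx_eq t by blast
  qed
  define f where "f t = cutoff_field (\<rho> (idx t)) (B (idx t) t)" for t
  define J where "J t = cutoff_jacobian (\<rho> (idx t)) (B (idx t) t)" for t
  have B_idx: "norm (B (idx t) t) \<le> 1 / real (Suc (idx t))" if "t \<in> T0" for t
    using B_le[OF idx_block(1)[OF that]] .
  have local: "continuous_on (T0 \<times> UNIV) (\<lambda>(t, x). f t x) \<and> continuous_on (T0 \<times> UNIV) (\<lambda>(t, x). J t x)"
  proof -
    have loc: "continuous_on ((T0 \<times> UNIV) \<inter> ({lo k<..<a (Suc k)} \<times> UNIV)) (\<lambda>p. f (fst p) (snd p)) \<and>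
        continuous_on ((T0 \<times> UNIV) \<inter> ({lo k<..<a (Suc k)} \<times> UNIV)) (\<lambda>p. J (fst p) (snd p))" for k
    proof -
      let ?U = "(T0 \<times> (UNIV :: (real^'n) set)) \<inter> ({lo k<..<a (Suc k)} \<times> UNIV)"
      have idx: "idx t = k" "a k \<le> t" if "t \<in> T0" "lo k < t" "t < a (Suc k)" for t
        using that idx_open by auto
      have Bc: "continuous_on ?U (\<lambda>p. B k (fst p))"
        by (rule continuous_on_compose2[OF B_cont continuous_on_fst[OF continuous_on_id]]) (use idx in auto)
      have sn: "continuous_on ?U snd" by (intro continuous_intros)
      have "continuous_on ?U (\<lambda>p. cutoff_field (\<rho> k) (B k (fst p)) (snd p))"
        "continuous_on ?U (\<lambda>p. cutoff_jacobian (\<rho> k) (B k (fst p)) (snd p))"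
        by (rule continuous_on_cutoff[OF Bc sn \<rho>_pos])+
      then show ?thesis
        by (auto simp: f_def J_def idx elim!: continuous_on_eq)
    qed
    have ex: "\<exists>V. open V \<and> p \<in> V \<and> continuous_on ((T0 \<times> UNIV) \<inter> V) (\<lambda>p. f (fst p) (snd p)) \<and>
        continuous_on ((T0 \<times> UNIV) \<inter> V) (\<lambda>p. J (fst p) (snd p))"
      if "p \<in> T0 \<times> UNIV" for p
    proof -
      have t: "fst p \<in> T0" using that by auto
      have "p \<in> {lo (idx (fst p))<..<a (Suc (idx (fst p)))} \<times> UNIV"
        using idx_block[OF t] lo_less[of "idx (fst p)"] by (cases p) auto
      then show ?thesis using loc[of "idx (fst p)"] open_Times[OF open_greaterThanLessThan open_UNIV] by blast
    qed
    show ?thesis unfolding case_prod_beta' using ex by (intro conjI continuous_on_locally) blast+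
  qed
  have f_cont: "continuous_on (T0 \<times> ball 0 1) (\<lambda>(t, x). f t x)"
    using local by (auto intro: continuous_on_subset)
  have f_J: "jacobian (f t) (at x) = J t x" for t x
    unfolding f_def J_def by (rule jacobian_cutoff_field[OF \<rho>_pos])
  have J_le: "norm (J t x) \<le> 9 / real (Suc k)" if t: "t \<in> T0" "a k \<le> t" for t x k
  proof -
    have "norm (J t x) \<le> 9 * norm (B (idx t) t)" unfolding J_def by (rule norm_cutoff_jacobian_le[OF \<rho>_pos])
    also have "\<dots> \<le> 9 * (1 / real (Suc (idx t)))" by (intro mult_left_mono B_idx t) simp
    also have "\<dots> \<le> 9 * (1 / real (Suc k))" using idx_ge[OF t] by (intro mult_left_mono frac_le) auto
    finally show ?thesis by simp
  qed
  have J_unif: "uniformly_continuous_on (T0 \<times> ball 0 1) (\<lambda>(t, x). J t x)"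
    unfolding uniformly_continuous_on_def
  proof (intro allI impI)
    fix e :: real assume e: "e > 0"
    obtain k where k: "inverse (real (Suc k)) < e / 18" using reals_Archimedean[of "e / 18"] e by auto
    then have k: "9 / real (Suc k) < e / 2" by (simp add: field_simps)
    \<comment> \<open>The compact part reaches one unit beyond \<open>a k\<close> and distances are
      kept below 1, so two times lie both in it or both after \<open>a k\<close>, where each value
      of the Jacobian is below e / 2.\<close>
    let ?C = "(T0 \<inter> {..a k + 1}) \<times> cball (0::real^'n) 1"
    have "T0 \<inter> {..a k + 1} = T \<inter> {0..a k + 1}" by (auto simp: ts_from_def)
    then have "compact ?C" using time_scale by (intro compact_Times) (simp_all add: time_scale_def closed_Int_compact)
    moreover have "continuous_on ?C (\<lambda>(t, x). J t x)" using local by (auto intro: continuous_on_subset)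
    ultimately have "uniformly_continuous_on ?C (\<lambda>(t, x). J t x)" by (intro compact_uniformly_continuous)
    then obtain d where d: "d > 0" "\<And>p q. p \<in> ?C \<Longrightarrow> q \<in> ?C \<Longrightarrow> dist q p < d \<Longrightarrow>
        dist (case q of (t, x) \<Rightarrow> J t x) (case p of (t, x) \<Rightarrow> J t x) < e"
      unfolding uniformly_continuous_on_def using e by metis
    show "\<exists>d>0. \<forall>p\<in>T0 \<times> ball 0 1. \<forall>q\<in>T0 \<times> ball 0 1. dist q p < d \<longrightarrow>
        dist (case q of (t, x) \<Rightarrow> J t x) (case p of (t, x) \<Rightarrow> J t x) < e"
    proof (intro exI[of _ "min d 1"] conjI ballI impI)
      fix p q assume p: "p \<in> T0 \<times> ball (0::real^'n) 1" and q: "q \<in> T0 \<times> ball (0::real^'n) 1"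
        and pq: "dist q p < min d 1"
      obtain t x s z where eq: "p = (t, x)" "q = (s, z)" by (cases p, cases q)
      have ts: "\<bar>s - t\<bar> < 1" using pq dist_fst_le[of q p] by (simp add: eq dist_real_def)
      show "dist (case q of (t, x) \<Rightarrow> J t x) (case p of (t, x) \<Rightarrow> J t x) < e"
      proof (cases "t \<le> a k + 1 \<and> s \<le> a k + 1")
        case True
        then have "p \<in> ?C" "q \<in> ?C" using p q by (auto simp: eq)
        then show ?thesis using d(2) pq by simp
      next
        case False
        then have "a k \<le> t" "a k \<le> s" using ts by auto
        then have "norm (J t x) < e / 2" "norm (J s z) < e / 2"
          using J_le[of t k x] J_le[of s k z] k p q by (auto simp: eq)
        then show ?thesis using norm_triangle_ineq4[of "J s z" "J t x"] by (simp add: eq dist_norm)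
      qed
    qed (use d in simp)
  qed
  have f_F: "f \<in> class_F T 1"
    unfolding class_F_def
  proof (intro CollectI conjI ballI)
    show "f t 0 = 0" for t by (simp add: f_def cutoff_field_def)
    show "f t differentiable (at x)" for t x
      unfolding f_def differentiable_def using cutoff_field_has_derivative[OF \<rho>_pos] by blast
    show "jacobian (f t) (at 0) = 0" for t
      unfolding f_J J_def cutoff_jacobian_def cutoff_def by (simp add: outer_def vec_eq_iff)
    show "uniformly_continuous_on (T0 \<times> ball 0 1) (\<lambda>(t, x). jacobian (f t) (at x))"
      unfolding f_J by (rule J_unif)
  qed
  \<comment> \<open>The estimate is global because nothing confines the orbits \<open>y k\<close> to
    the unit ball.\<close>
  have f_lip: "norm (A t *v x + f t x - (A t *v z + f t z)) \<le> (M + 9) * norm (x - z)"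
    if t: "t \<in> T0" for t x z
  proof -
    have "norm (A t *v (x - z)) \<le> M * norm (x - z)" using t by (intro A_vector_le) (simp add: ts_from_def)
    moreover have "norm (f t x - f t z) \<le> 9 * norm (B (idx t) t) * norm (x - z)"
      unfolding f_def by (rule cutoff_field_lipschitz[OF \<rho>_pos])
    moreover have "9 * norm (B (idx t) t) * norm (x - z) \<le> 9 * 1 * norm (x - z)"
    proof (intro mult_right_mono mult_left_mono)
      have "1 / real (Suc (idx t)) \<le> 1" by simp
      then show "norm (B (idx t) t) \<le> 1" using B_idx[OF t] by linarith
    qed auto
    moreover have "A t *v x + f t x - (A t *v z + f t z) = A t *v (x - z) + (f t x - f t z)"
      by (simp add: matrix_vector_mult_diff_distrib)
    ultimately show ?thesis
      using norm_triangle_ineq[of "A t *v (x - z)" "f t x - f t z"] by (simp add: algebra_simps)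
  qed
  have "zero_unstable N T 1 A f"
  proof
    assume stable: "zero_stable N T 1 A f"
    obtain c1 c2 where c12: "c1 > 0" "c2 > 0" "\<And>x. c1 * norm x \<le> N x" "\<And>x. N x \<le> c2 * norm x"
      using vector_norm_equivalent[OF N] by blast
    \<comment> \<open>Stability is tested with the tolerance \<open>c1\<close>, which is reached as
      soon as the Euclidean length is 1.\<close>
    obtain \<delta> where \<delta>: "\<delta> > 0" "\<And>x0. N x0 < \<delta> \<Longrightarrow>
        \<exists>x. is_solution T 1 A f 0 x \<and> x 0 = x0 \<and> (\<forall>t\<in>T0. N (x t) < c1)"
      using bspec[OF stable[unfolded zero_stable_def] S0.start_in] c12(1) by blast
    obtain k where "inverse (real (Suc k)) < \<delta> / c2" using reals_Archimedean[of "\<delta> / c2"] \<delta> c12 by auto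
    then have k: "c2 * (1 / real (Suc k)) < \<delta>" using c12 by (simp add: field_simps)
    define z where "z t = flow t (a k) *v y k (a k)" for t
    have ak: "a k \<in> T0" "0 \<le> a k" using ar[of k] by (auto simp: ts_from_def)
    have "N (z 0) \<le> c2 * norm (z 0)" by (rule c12)
    also have "\<dots> \<le> c2 * (1 / real (Suc k))"
      using y_small[OF S0.start_in ak(2)] c12 by (intro mult_left_mono) (auto simp: z_def)
    finally have "N (z 0) < \<delta>" using k by linarith
    then obtain x where x: "is_solution T 1 A f 0 x" "x 0 = z 0" "\<And>t. t \<in> T0 \<Longrightarrow> N (x t) < c1"
      using \<delta>(2)[of "z 0"] by blast
    have x_der: "has_delta_derivative (T0) x (A t *v x t + f t (x t)) t" if "t \<in> T0" for t
      using x(1) that by (simp add: is_solution_def)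
    have z_der: "has_delta_derivative (T0) z (A t *v z t) t" if "t \<in> T0" for t
      using X_vector_delta_derivative[OF S0.start_in that, of "matrix_inv (X (a k)) *v y k (a k)"]
      by (simp add: z_def[abs_def] flow_def matrix_vector_mul_assoc[symmetric])
    have "x (a k) = z (a k)"
    proof (rule S0.delta_unique[OF ak(1) _ x_der z_der _ x(2)])
      fix t assume t: "t \<in> T0" "t < a k"
      have "idx t < k"
      proof (rule ccontr)
        assume "\<not> idx t < k"
        then have "a k \<le> a (idx t)" by (intro step_mono) simp
        then show False using idx_block(1)[OF t(1)] t(2) by simp
      qed
      \<comment> \<open>The orbit stays below \<open>r k\<close> before \<open>a k\<close>, and
        \<open>r k\<close> is at most every earlier radius.\<close>
      then have "norm (z t) \<le> \<rho> (idx t)" using y_small[OF t(1), of k] t(2) r_le[of "idx t" k] by (simp add: z_def)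
      then have "f t (z t) = 0" by (simp add: f_def cutoff_field_def cutoff_eq_0 \<rho>_pos)
      then show "norm (A t *v x t + f t (x t) - A t *v z t) \<le> (M + 9) * norm (x t - z t)"
        using f_lip[OF t(1), of "x t" "z t"] by simp
    qed (use M_pos in simp)
    also have "z (a k) = y k (a k)"
      using ak by (simp add: z_def flow_def matrix_vector_mul_assoc[symmetric])
    finally have start: "x (a k) = y k (a k)" .
    interpret H: half_scale "ts_from T (a k)" "a k" by (rule half_scale_from[OF ak(1)])
    have "x (b k) = y k (b k)"
    proof (rule H.delta_unique[where L="M + 9" and D="\<lambda>t. A t *v x t + f t (x t)" and E="\<lambda>t. (A t + B k t) *v y k t"])
      fix t assume t: "t \<in> ts_from T (a k)"
      have t0: "t \<in> T0" "a k \<le> t" "0 \<le> t" using t ak by (auto simp: ts_from_def)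
      show "has_delta_derivative (ts_from T (a k)) x (A t *v x t + f t (x t)) t"
      proof (rule S0.delta_derivative_subset[OF x_der[OF t0(1)]])
        show "ts_from T (a k) \<subseteq> T0" using ak by (auto simp: ts_from_def)
        show "fwd_jump (ts_from T (a k)) t = fwd_jump (T0) t" using t0 by (simp add: fwd_jump_ts_from)
      qed
      assume tb: "t < b k"
      have "t < a (Suc k)" using tb bc[of k] c_jump[of k] by (simp add: Suc)
      then have "idx t = k" using idx_eq t0 by blast
      then have "f t (y k t) = B k t *v y k t"
        using cutoff_eq_1[OF \<rho>_pos y_lower[OF t less_imp_le[OF tb]]] by (simp add: f_def cutoff_field_def)
      then show "norm (A t *v x t + f t (x t) - (A t + B k t) *v y k t) \<le> (M + 9) * norm (x t - y k t)"
        using f_lip[OF t0(1), of "x t" "y k t"] by (simp add: matrix_vector_mult_add_rdistrib)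
    next
      show "b k \<in> ts_from T (a k)" by (rule b_in)
      show "0 \<le> M + 9" using M_pos by simp
      show "has_delta_derivative (ts_from T (a k)) (y k) ((A t + B k t) *v y k t) t" if "t \<in> ts_from T (a k)" for t
        using that by (rule y_der)
      show "x (a k) = y k (a k)" by (rule start)
    qed
    then have "c1 \<le> N (x (b k))" using c12(3)[of "x (b k)"] y_b by simp
    moreover have "b k \<in> T0" using b_in[of k] ak by (auto simp: ts_from_def)
    ultimately show False using x(3)[of "b k"] by simp
  qed
  then show ?thesis using f_cont f_F by blast
qed

end

theorem theorem6p4:
  fixes T :: "real set" and A :: "real \<Rightarrow> real^'n^'n" and N :: "real^'n \<Rightarrow> real"
  assumes "time_scale T"
    and "\<not> bdd_above (right_scattered T)"
    and "vector_norm N"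
    and "bounded (A ` T)"
    and "rd_continuous T A"
    and "uniformly_regressive T A"
  shows "(central_upper_exponent N T A > 0 \<longrightarrow>
            (\<exists>f. continuous_on (ts_from T 0 \<times> ball 0 1) (\<lambda>(t, x). f t x) \<and>
                 f \<in> class_F T 1 \<and> zero_unstable N T 1 A f)) \<and>
         (syndetic T \<and> central_upper_exponent N T A \<ge> 0 \<longrightarrow>
            (\<exists>f. continuous_on (ts_from T 0 \<times> ball 0 1) (\<lambda>(t, x). f t x) \<and>
                 f \<in> class_F T 1 \<and> zero_unstable N T 1 A f))"
proof -
  obtain M where M: "M > 0" "\<And>t. t \<in> T \<Longrightarrow> norm (A t) \<le> M"
    using assms(4) unfolding bounded_pos by blast
  define P where "P t = mat 1 + graininess T t *\<^sub>R A t" for t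
  have inv: "invertible (P t)" if "t \<in> T" for t
    using assms(6) that by (simp add: uniformly_regressive_def P_def)
  obtain R where R: "\<And>t. t \<in> T \<Longrightarrow> norm (matrix_inv (P t)) \<le> R"
    using assms(6) unfolding uniformly_regressive_def bounded_iff P_def by blast
  \<comment> \<open>The bound on the inverses becomes a lower bound for 1 + \<mu> A; the maximum
    with 1 provides the normalisation of the constant.\<close>
  interpret regressive_system T A M "max 1 R"
  proof
    show "norm v \<le> max 1 R * norm ((mat 1 + graininess T t *\<^sub>R A t) *v v)" if t: "t \<in> T" for t v
    proof -
      have "v = matrix_inv (P t) *v (P t *v v)"
        using inv[OF t] by (simp add: matrix_vector_mul_assoc matrix_inverse_left)
      then have "norm v \<le> norm (matrix_inv (P t)) * norm (P t *v v)" by (metis norm_matrix_vector_le)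
      also have "\<dots> \<le> max 1 R * norm (P t *v v)" using R[OF t] by (intro mult_right_mono) auto
      finally show ?thesis by (simp add: P_def)
    qed
  qed (use assms M in auto)
  show ?thesis using unstable_perturbation_exists[OF assms(3)] by blast
qed

end
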